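(* Let $R$ be a regular $F$-finite ring of prime characteristic $p$ and let $\mathfrak{a}$ be an ideal in $R$. Then for every positive real number $c$ we have $\tau(\mathfrak{a}^c)=\tau'(\mathfrak{a}^c)$, where $\tau(\mathfrak{a}^c)$ is the ideal $\bigcup_{e>0}\left(\mathfrak{a}^{\lceil cp^e\rceil}\right)^{[1/p^e]}$ and $\tau'(\mathfrak{a}^c)$ is the Hara--Yoshida $\mathfrak{a}^c$-test ideal $\mathrm{Ann}_R\left(0_E^{*\mathfrak{a}^c}\right)$.
   Context: All rings are commutative and Noetherian. A ring $R$ of prime characteristic $p$ is $F$-finite if the Frobenius morphism $F\colon R\to R$, $x\mapsto x^p$, is finite. $R$ is not assumed local. Definition of $\tau$: for an ideal $J$ of $R$ and $q=p^e$, $J^{[q]}$ is the ideal generated by $\{u^q \mid u\in J\}$. For an ideal $\mathfrak{b}$ of $R$ and $q=p^e$ with $e\geq 1$, $\mathfrak{b}^{[1/q]}$ denotes the unique smallest ideal $J$ of $R$ (with respect to inclusion) such that $\mathfrak{b}\subseteq J^{[q]}$ (it exists for regular $F$-finite $R$). For a real number $c>0$, $\tau(\mathfrak{a}^c)=\bigcup_{e>0}\left(\mathfrak{a}^{\lceil cp^e\rceil}\right)^{[1/p^e]}$, an increasing union of ideals. Definition of $\tau'$ (Hara--Yoshida, regular case): for $e\geq1$ let $R^e$ denote the $R$-$R$-bimodule which is $R$ as an abelian group, with its usual left $R$-module structure and with right $R$-module structure induced by $F^e\colon R\to R$. For $R$-modules $N\subseteq M$, let $N_M^{[p^e]}$ be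 the image of the induced map of left $R$-modules $R^e\otimes_R N\to R^e\otimes_R M$. For $c>0$, an element $m\in M$ is in the $\mathfrak{a}^c$-tight closure $N_M^{*\mathfrak{a}^c}$ of $N$ in $M$ if there is $u\in R$, not in any minimal prime of $R$, such that for all $e\gg0$ the set $u\,\mathfrak{a}^{\lceil cp^e\rceil}\otimes m=\{uh\otimes m\mid h\in \mathfrak{a}^{\lceil cp^e\rceil}\}\subseteq R^e\otimes_R M$ is contained in $N_M^{[p^e]}$. Let $E=\bigoplus_{\mathfrak{m}}E_R(R/\mathfrak{m})$, the direct sum over all maximal ideals $\mathfrak{m}$ of $R$ of the injective hulls of the residue fields. Then $\tau'(\mathfrak{a}^c)$ is the annihilator in $R$ of the $R$-module $0_E^{*\mathfrak{a}^c}$ (the $\mathfrak{a}^c$-tight closure of the zero submodule in $E$). *)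

theory Defs
  imports Complex_Main "HOL-Algebra.Algebra"
    "HOL-Library.Extended_Nat"
begin

section \<open>Regular rings\<close>

text \<open>The class of the fraction $a/s$ with respect to the multiplicative set $R \setminus P$:
  all pairs $(b,t)$ with $v(at - bs) = 0$ for some $v \notin P$.\<close>

definition frac_class :: "('a, 'r) ring_scheme \<Rightarrow> 'a set \<Rightarrow> 'a \<Rightarrow> 'a \<Rightarrow> ('a \<times> 'a) set" where
  "frac_class R P a s =
     {(b, t). b \<in> carrier R \<and> t \<in> carrier R - P \<and>
        (\<exists>v \<in> carrier R - P. v \<otimes>\<^bsub>R\<^esub> (a \<otimes>\<^bsub>R\<^esub> t) = v \<otimes>\<^bsub>R\<^esub> (b \<otimes>\<^bsub>R\<^esub> s))}"

text \<open>In the operations, the classes being united are all equal, so each union is a single class.\<close>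

definition localization :: "('a, 'r) ring_scheme \<Rightarrow> 'a set \<Rightarrow> ('a \<times> 'a) set ring" where
  "localization R P =
     \<lparr>carrier = {frac_class R P a s | a s. a \<in> carrier R \<and> s \<in> carrier R - P},
      monoid.mult = (\<lambda>K L. \<Union>(a, s) \<in> K. \<Union>(b, t) \<in> L. frac_class R P (a \<otimes>\<^bsub>R\<^esub> b) (s \<otimes>\<^bsub>R\<^esub> t)),
      monoid.one = frac_class R P \<one>\<^bsub>R\<^esub> \<one>\<^bsub>R\<^esub>,
      ring.zero = frac_class R P \<zero>\<^bsub>R\<^esub> \<one>\<^bsub>R\<^esub>,
      ring.add = (\<lambda>K L. \<Union>(a, s) \<in> K. \<Union>(b, t) \<in> L.
               frac_class R P ((a \<otimes>\<^bsub>R\<^esub> t) \<oplus>\<^bsub>R\<^esub> (b \<otimes>\<^bsub>R\<^esub> s)) (s \<otimes>\<^bsub>R\<^esub> t))\<rparr>"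

definition krull_dim :: "('a, 'r) ring_scheme \<Rightarrow> enat" where
  "krull_dim R = Sup {enat n | n. \<exists>P :: nat \<Rightarrow> 'a set.
     (\<forall>i\<le>n. primeideal (P i) R) \<and> (\<forall>i<n. P i \<subset> P (Suc i))}"

definition regular_local_ring :: "('a, 'r) ring_scheme \<Rightarrow> bool" where
  "regular_local_ring R \<longleftrightarrow> cring R \<and> noetherian_ring R \<and>
     (\<exists>M. {I. maximalideal I R} = {M} \<and>
        (\<exists>A \<subseteq> carrier R. finite A \<and> M = genideal R A \<and> enat (card A) = krull_dim R))"

definition regular_ring :: "('a, 'r) ring_scheme \<Rightarrow> bool" where
  "regular_ring R \<longleftrightarrow> cring R \<and> noetherian_ring R \<and>
     (\<forall>P. primeideal P R \<longrightarrow> regular_local_ring (localization R P))"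

definition minimal_prime :: "('a, 'r) ring_scheme \<Rightarrow> 'a set \<Rightarrow> bool" where
  "minimal_prime R P \<longleftrightarrow> primeideal P R \<and> (\<forall>Q. primeideal Q R \<and> Q \<subseteq> P \<longrightarrow> Q = P)"

section \<open>Modules\<close>

text \<open>A module record also has the ring fields \<open>mult\<close> and \<open>one\<close>; the locale
  \<open>module\<close> ignores them, and so does everything below.\<close>

definition self_module :: "('a, 'r) ring_scheme \<Rightarrow> ('a, 'a) module" where
  "self_module R =
     \<lparr>carrier = carrier R, monoid.mult = monoid.mult R, monoid.one = monoid.one R, ring.zero = ring.zero R, ring.add = ring.add R, smult = monoid.mult R\<rparr>"

definition restrict_scalars :: "('c \<Rightarrow> 'a) \<Rightarrow> ('a, 'b, 'm) module_scheme \<Rightarrow> ('c, 'b) module" where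
  "restrict_scalars f M =
     \<lparr>carrier = carrier M, monoid.mult = monoid.mult M, monoid.one = monoid.one M, ring.zero = ring.zero M, ring.add = ring.add M,
      smult = (\<lambda>r x. f r \<odot>\<^bsub>M\<^esub> x)\<rparr>"

definition fin_gen_module :: "('a, 'r) ring_scheme \<Rightarrow> ('a, 'b, 'm) module_scheme \<Rightarrow> bool" where
  "fin_gen_module R M \<longleftrightarrow>
     (\<exists>S \<subseteq> carrier M. finite S \<and> (\<forall>N. submodule N R M \<and> S \<subseteq> N \<longrightarrow> N = carrier M))"

definition mod_hom ::
  "('a, 'r) ring_scheme \<Rightarrow> ('a, 'b, 'm) module_scheme \<Rightarrow> ('a, 'c, 'n) module_scheme \<Rightarrow> ('b \<Rightarrow> 'c) set"
  where
  "mod_hom R M N = {f \<in> carrier M \<rightarrow> carrier N.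
     (\<forall>x \<in> carrier M. \<forall>y \<in> carrier M. f (x \<oplus>\<^bsub>M\<^esub> y) = f x \<oplus>\<^bsub>N\<^esub> f y) \<and>
     (\<forall>r \<in> carrier R. \<forall>x \<in> carrier M. f (r \<odot>\<^bsub>M\<^esub> x) = r \<odot>\<^bsub>N\<^esub> f x)}"

text \<open>HOL cannot quantify over all types inside a definition, so the test modules \<open>A\<close>, \<open>B\<close> live on
  the type \<open>'a + 'b\<close>. Every submodule of \<open>R\<close> has a copy there, hence by Baer's criterion this
  is injectivity with respect to all modules.\<close>

definition injective_module :: "('a, 'r) ring_scheme \<Rightarrow> ('a, 'b) module \<Rightarrow> bool" where
  "injective_module R E \<longleftrightarrow> module R E \<and>
     (\<forall>(A :: ('a, 'a + 'b) module) (B :: ('a, 'a + 'b) module) f g.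
        module R A \<and> module R B \<and> f \<in> mod_hom R A B \<and> inj_on f (carrier A) \<and> g \<in> mod_hom R A E
        \<longrightarrow> (\<exists>h \<in> mod_hom R B E. \<forall>x \<in> carrier A. h (f x) = g x))"

definition injective_hull :: "('a, 'r) ring_scheme \<Rightarrow> ('a, 'k) module \<Rightarrow> ('a, 'b) module \<Rightarrow> bool" where
  "injective_hull R K E \<longleftrightarrow> injective_module R E \<and>
     (\<exists>i \<in> mod_hom R K E. inj_on i (carrier K) \<and>
        (\<forall>N. submodule N R E \<and> N \<noteq> {\<zero>\<^bsub>E\<^esub>} \<longrightarrow> N \<inter> i ` carrier K \<noteq> {\<zero>\<^bsub>E\<^esub>}))"

definition residue_field :: "('a, 'r) ring_scheme \<Rightarrow> 'a set \<Rightarrow> ('a, 'a set) module" where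
  "residue_field R M = restrict_scalars (\<lambda>r. M +>\<^bsub>R\<^esub> r) (self_module (R Quot M))"

definition direct_sum :: "'i set \<Rightarrow> ('i \<Rightarrow> ('a, 'b) module) \<Rightarrow> ('a, 'i \<Rightarrow> 'b) module" where
  "direct_sum I M =
     \<lparr>carrier = {x \<in> (\<Pi>\<^sub>E i\<in>I. carrier (M i)). finite {i \<in> I. x i \<noteq> \<zero>\<^bsub>M i\<^esub>}},
      monoid.mult = (\<lambda>x y. \<lambda>i\<in>I. x i \<otimes>\<^bsub>M i\<^esub> y i),
      monoid.one = (\<lambda>i\<in>I. \<one>\<^bsub>M i\<^esub>),
      ring.zero = (\<lambda>i\<in>I. \<zero>\<^bsub>M i\<^esub>),
      ring.add = (\<lambda>x y. \<lambda>i\<in>I. x i \<oplus>\<^bsub>M i\<^esub> y i),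
      smult = (\<lambda>r x. \<lambda>i\<in>I. r \<odot>\<^bsub>M i\<^esub> x i)\<rparr>"

definition annihilator :: "('a, 'r) ring_scheme \<Rightarrow> ('a, 'b) module \<Rightarrow> 'b set \<Rightarrow> 'a set" where
  "annihilator R M N = {r \<in> carrier R. \<forall>x \<in> N. r \<odot>\<^bsub>M\<^esub> x = \<zero>\<^bsub>M\<^esub>}"

section \<open>Tensor products\<close>

text \<open>The free abelian group on \<open>M \<times> N\<close> modulo the bilinear and balancing relations. Since \<open>R\<close> is
  commutative, the right action of \<open>R\<close> on the left factor \<open>M\<close> is recorded as its \<open>smult\<close>. Library
  free abelian groups, and hence the tensor product, are written multiplicatively.\<close>

definition tensor_relations ::
  "('a, 'r) ring_scheme \<Rightarrow> ('a, 'b) module \<Rightarrow> ('a, 'c) module \<Rightarrow> (('b \<times> 'c) \<Rightarrow>\<^sub>0 int) set" where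
  "tensor_relations R M N =
     {frag_of (x \<oplus>\<^bsub>M\<^esub> x', y) - frag_of (x, y) - frag_of (x', y) | x x' y.
        x \<in> carrier M \<and> x' \<in> carrier M \<and> y \<in> carrier N} \<union>
     {frag_of (x, y \<oplus>\<^bsub>N\<^esub> y') - frag_of (x, y) - frag_of (x, y') | x y y'.
        x \<in> carrier M \<and> y \<in> carrier N \<and> y' \<in> carrier N} \<union>
     {frag_of (r \<odot>\<^bsub>M\<^esub> x, y) - frag_of (x, r \<odot>\<^bsub>N\<^esub> y) | r x y.
        r \<in> carrier R \<and> x \<in> carrier M \<and> y \<in> carrier N}"

definition tensor_kernel ::
  "('a, 'r) ring_scheme \<Rightarrow> ('a, 'b) module \<Rightarrow> ('a, 'c) module \<Rightarrow> (('b \<times> 'c) \<Rightarrow>\<^sub>0 int) set" where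
  "tensor_kernel R M N =
     generate (free_Abelian_group (carrier M \<times> carrier N)) (tensor_relations R M N)"

definition tensor_product ::
  "('a, 'r) ring_scheme \<Rightarrow> ('a, 'b) module \<Rightarrow> ('a, 'c) module \<Rightarrow> (('b \<times> 'c) \<Rightarrow>\<^sub>0 int) set monoid" where
  "tensor_product R M N =
     free_Abelian_group (carrier M \<times> carrier N) Mod tensor_kernel R M N"

definition pure_tensor ::
  "('a, 'r) ring_scheme \<Rightarrow> ('a, 'b) module \<Rightarrow> ('a, 'c) module \<Rightarrow> 'b \<Rightarrow> 'c \<Rightarrow> (('b \<times> 'c) \<Rightarrow>\<^sub>0 int) set"
  where
  "pure_tensor R M N x y =
     tensor_kernel R M N #>\<^bsub>free_Abelian_group (carrier M \<times> carrier N)\<^esub> frag_of (x, y)"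

text \<open>The map \<open>M \<otimes> N \<rightarrow> M \<otimes> N'\<close> induced by a homomorphism \<open>g\<close> from \<open>N\<close> to \<open>N'\<close>; its value on a
  coset is the common coset of the images of all representatives.\<close>

definition tensor_map ::
  "('a, 'r) ring_scheme \<Rightarrow> ('a, 'b) module \<Rightarrow> ('a, 'd) module \<Rightarrow> ('c \<Rightarrow> 'd)
    \<Rightarrow> (('b \<times> 'c) \<Rightarrow>\<^sub>0 int) set \<Rightarrow> (('b \<times> 'd) \<Rightarrow>\<^sub>0 int) set" where
  "tensor_map R M N' g K =
     (\<Union>z \<in> K. tensor_kernel R M N' #>\<^bsub>free_Abelian_group (carrier M \<times> carrier N')\<^esub>
        frag_extend (\<lambda>(x, y). frag_of (x, g y)) z)"

section \<open>Frobenius\<close>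

definition has_characteristic :: "('a, 'r) ring_scheme \<Rightarrow> nat \<Rightarrow> bool" where
  "has_characteristic R p \<longleftrightarrow> (\<forall>n::nat. add_pow R n \<one>\<^bsub>R\<^esub> = \<zero>\<^bsub>R\<^esub> \<longleftrightarrow> p dvd n)"

text \<open>The abelian group \<open>R\<close> on which a scalar \<open>r\<close> acts as multiplication by \<open>r\<close> to the power \<open>p ^ e\<close>;
  this is the right module structure of the bimodule $R^e$.\<close>

definition frobenius_module :: "('a, 'r) ring_scheme \<Rightarrow> nat \<Rightarrow> nat \<Rightarrow> ('a, 'a) module" where
  "frobenius_module R p e = restrict_scalars (\<lambda>r. r [^]\<^bsub>R\<^esub> (p ^ e)) (self_module R)"

definition F_finite :: "('a, 'r) ring_scheme \<Rightarrow> nat \<Rightarrow> bool" where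
  "F_finite R p \<longleftrightarrow> fin_gen_module R (frobenius_module R p 1)"

section \<open>The ideal \<open>\<tau>\<close>\<close>

definition frobenius_power :: "('a, 'r) ring_scheme \<Rightarrow> nat \<Rightarrow> 'a set \<Rightarrow> 'a set" where
  "frobenius_power R q J = genideal R ((\<lambda>u. u [^]\<^bsub>R\<^esub> q) ` J)"

text \<open>\<open>THE\<close> is meaningful when a smallest such ideal exists, as it does for regular F-finite rings.\<close>

definition frobenius_root :: "('a, 'r) ring_scheme \<Rightarrow> nat \<Rightarrow> 'a set \<Rightarrow> 'a set" where
  "frobenius_root R q B = (THE J. ideal J R \<and> B \<subseteq> frobenius_power R q J \<and>
     (\<forall>I. ideal I R \<and> B \<subseteq> frobenius_power R q I \<longrightarrow> J \<subseteq> I))"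

definition scaled_ideal_power :: "('a, 'r) ring_scheme \<Rightarrow> nat \<Rightarrow> 'a set \<Rightarrow> real \<Rightarrow> nat \<Rightarrow> 'a set" where
  "scaled_ideal_power R p \<aa> c e = \<aa> [^]\<^bsub>ideals_set R\<^esub> nat \<lceil>c * real p ^ e\<rceil>"

definition tau :: "('a, 'r) ring_scheme \<Rightarrow> nat \<Rightarrow> 'a set \<Rightarrow> real \<Rightarrow> 'a set" where
  "tau R p \<aa> c = (\<Union>e \<in> {0<..}. frobenius_root R (p ^ e) (scaled_ideal_power R p \<aa> c e))"

section \<open>The ideal \<open>\<tau>'\<close>\<close>

text \<open>\<open>frobenius_image R p e M N\<close> is $N_M^{[p^e]}$, for a submodule \<open>N\<close> of \<open>M\<close> given by its carrier.\<close>

definition frobenius_image ::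
  "('a, 'r) ring_scheme \<Rightarrow> nat \<Rightarrow> nat \<Rightarrow> ('a, 'b) module \<Rightarrow> 'b set \<Rightarrow> (('a \<times> 'b) \<Rightarrow>\<^sub>0 int) set set" where
  "frobenius_image R p e M N =
     tensor_map R (frobenius_module R p e) M (\<lambda>y. y) `
       carrier (tensor_product R (frobenius_module R p e) (M\<lparr>carrier := N\<rparr>))"

definition tight_closure ::
  "('a, 'r) ring_scheme \<Rightarrow> nat \<Rightarrow> 'a set \<Rightarrow> real \<Rightarrow> ('a, 'b) module \<Rightarrow> 'b set \<Rightarrow> 'b set" where
  "tight_closure R p \<aa> c M N =
     {m \<in> carrier M. \<exists>u \<in> carrier R. (\<forall>P. minimal_prime R P \<longrightarrow> u \<notin> P) \<and>
        (\<forall>\<^sub>F e in sequentially.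
           {pure_tensor R (frobenius_module R p e) M (u \<otimes>\<^bsub>R\<^esub> h) m | h.
              h \<in> scaled_ideal_power R p \<aa> c e}
           \<subseteq> frobenius_image R p e M N)}"

text \<open>\<open>E\<close> assigns to each maximal ideal a chosen injective hull of its residue field.\<close>

definition tau' ::
  "('a, 'r) ring_scheme \<Rightarrow> nat \<Rightarrow> ('a set \<Rightarrow> ('a, 'b) module) \<Rightarrow> 'a set \<Rightarrow> real \<Rightarrow> 'a set" where
  "tau' R p E \<aa> c =
     (let S = direct_sum {M. maximalideal M R} E
      in annihilator R S (tight_closure R p \<aa> c S {\<zero>\<^bsub>S\<^esub>}))"

end

theory Submission
  imports Defs
begin

text \<open>Write \<open>J\<^bsup>[q]\<^esup>\<close> for \<open>frobenius_power R q J\<close>, where \<open>q\<close> is a power of \<open>p\<close>, and call an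
  additive map \<open>\<phi>\<close> with \<open>\<phi> (a\<^sup>q x) = a (\<phi> x)\<close> a Cartier map. The only consequence of regularity and
  F-finiteness that is needed is that Cartier maps detect Frobenius powers: \<open>x \<in> J\<^bsup>[q]\<^esup>\<close> if and only if
  \<open>\<phi> x \<in> J\<close> for all \<open>\<phi>\<close>. It comes from the freeness of Frobenius over the local rings of \<open>R\<close>, which holds because the
  \<open>p\<close>-th powers of the parameters form a regular sequence.

  Consequently Frobenius powers commute with colon ideals, smallest ideals with \<open>B \<subseteq> J\<^bsup>[q]\<^esup>\<close> exist, and a
  tensor \<open>y \<otimes> m\<close> vanishes if and only if \<open>y\<close> lies in the \<open>q\<close>-th Frobenius power of the annihilator \<open>J\<close> of \<open>m\<close>.
  If \<open>u \<aa>\<^sub>e \<subseteq> J\<^bsup>[q]\<^esup>\<close> for all large \<open>q = p\<^sup>e\<close>, with \<open>\<aa>\<^sub>e\<close> the power of \<open>\<aa>\<close> with exponent \<open>c q\<close> rounded up,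
  but \<open>\<aa>\<^sub>e \<subseteq> J\<^bsup>[q]\<^esup>\<close> fails for some \<open>e\<close>, then \<open>u\<close> lies in all
  Frobenius powers of some maximal ideal, hence in a minimal prime. So the tight closure of zero in \<open>E\<close> consists of the elements
  killed by \<open>\<tau>\<close>, and the annihilator of that set is \<open>\<tau>\<close> again because \<open>E\<close> is an injective
  cogenerator.\<close>

section \<open>Noetherian commutative rings\<close>

text \<open>The definition of regularity speaks of the dimension of each local ring, while detection
  by Cartier maps is a statement about \<open>R\<close> itself; bridging the two shapes the
  development. Dimension is used only through chains of primes: by Krull's principal ideal theorem,
  dividing by an element of the top prime costs a chain at most one step. Hence a local ring whose
  dimension equals its number of parameters stays regular modulo some of them and is a domain, which
  makes the parameters a regular sequence in every order. Krull's theorem works at two nested primes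
  at once. Instead of localizing repeatedly, its proof stays in \<open>R\<close> and uses ideals
  from which elements outside the prime cancel. The localization itself is entered once, in
  \<open>local_p_basis\<close>. F-finiteness leaves finitely many denominators there, so one element
  outside \<open>N\<close> clears them all and the local coefficient functions can be moved back to
  \<open>R\<close>.\<close>

locale noetherian_cring = cring R + noetherian_ring R for R (structure)

context cring
begin

lemma ideal_from_closure:
  assumes "I \<subseteq> carrier R" "\<zero> \<in> I"
    and add: "\<And>a b. a \<in> I \<Longrightarrow> b \<in> I \<Longrightarrow> a \<oplus> b \<in> I"
    and mult: "\<And>a r. a \<in> I \<Longrightarrow> r \<in> carrier R \<Longrightarrow> r \<otimes> a \<in> I"
  shows "ideal I R"
proof (rule idealI)
  show "subgroup I (add_monoid R)"
  proof (rule add.subgroupI)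
    fix a assume a: "a \<in> I"
    then have "\<ominus> a = (\<ominus> \<one>) \<otimes> a" using assms(1) by (simp add: l_minus subset_iff)
    then show "\<ominus> a \<in> I" using mult[OF a] by simp
  qed (use assms in auto)
  show "a \<otimes> r \<in> I" if "a \<in> I" "r \<in> carrier R" for a r
    using mult[OF that] that assms(1) by (metis m_comm subsetD)
qed (use mult ring_axioms in auto)

lemma ideal_minus: "ideal I R \<Longrightarrow> a \<in> I \<Longrightarrow> b \<in> I \<Longrightarrow> a \<ominus> b \<in> I"
  unfolding a_minus_def
  by (simp add: additive_subgroup.a_closed additive_subgroup.a_inv_closed ideal.axioms(1))

lemma ideal_add: "ideal I R \<Longrightarrow> a \<in> I \<Longrightarrow> b \<in> I \<Longrightarrow> a \<oplus> b \<in> I"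
  by (simp add: additive_subgroup.a_closed ideal.axioms(1))

lemma ideal_zero: "ideal I R \<Longrightarrow> \<zero> \<in> I"
  by (simp add: additive_subgroup.zero_closed ideal.axioms(1))

lemma ideal_finsum:
  assumes "ideal I R" "\<And>i. i \<in> A \<Longrightarrow> f i \<in> I"
  shows "(\<Oplus>i\<in>A. f i) \<in> I"
  using assms(2)
proof (induction A rule: infinite_finite_induct)
  case (insert x F)
  then have "f \<in> F \<rightarrow> carrier R" "f x \<in> carrier R" using ideal.Icarr[OF assms(1)] by auto
  with insert show ?case by (simp add: ideal_add[OF assms(1)])
qed (use ideal_zero[OF assms(1)] in \<open>auto simp: finsum_infinite\<close>)

lemma ideal_add_cancel:
  assumes "ideal I R" "a \<oplus> b \<in> I" "a \<in> I" "b \<in> carrier R"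
  shows "b \<in> I"
proof -
  have "a \<in> carrier R" using assms ideal.Icarr by metis
  then have "b = (a \<oplus> b) \<ominus> a" using assms(4) by algebra
  then show ?thesis using ideal_minus[OF assms(1,2,3)] by simp
qed

lemma prime_one_notin: "primeideal N R \<Longrightarrow> \<one> \<notin> N"
  using ideal.one_imp_carrier primeideal.axioms(1) primeideal.I_notcarr by metis

lemma prime_Compl_mult:
  "primeideal N R \<Longrightarrow> s \<in> carrier R - N \<Longrightarrow> t \<in> carrier R - N \<Longrightarrow> s \<otimes> t \<in> carrier R - N"
  using primeideal.I_prime by fastforce

lemma prime_pow_mem:
  assumes "primeideal N R" "a \<in> carrier R" "a [^] (n::nat) \<in> N"
  shows "a \<in> N"
  using assms(3)
proof (induction n)
  case 0 then show ?case using prime_one_notin[OF assms(1)] by simp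
next
  case (Suc n)
  then show ?case using primeideal.I_prime[OF assms(1), of "a [^] n" a] assms(2) by auto
qed

lemma ideal_pow_mem:
  assumes "ideal I R" "a \<in> I" "0 < (n::nat)"
  shows "a [^] n \<in> I"
proof -
  obtain m where "n = Suc m" using assms(3) gr0_implies_Suc by blast
  then show ?thesis
    using ideal.I_l_closed[OF assms(1,2)] ideal.Icarr[OF assms(1,2)] nat_pow_closed by force
qed

lemma ideal_colon:
  assumes "ideal I R" "s \<in> carrier R"
  shows "ideal {r \<in> carrier R. r \<otimes> s \<in> I} R"
proof (rule ideal_from_closure)
  fix a b assume "a \<in> {r \<in> carrier R. r \<otimes> s \<in> I}" "b \<in> {r \<in> carrier R. r \<otimes> s \<in> I}"
  then show "a \<oplus> b \<in> {r \<in> carrier R. r \<otimes> s \<in> I}"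
    using assms by (simp add: l_distr ideal_add)
next
  fix a r assume "a \<in> {r \<in> carrier R. r \<otimes> s \<in> I}" "r \<in> carrier R"
  then show "r \<otimes> a \<in> {r \<in> carrier R. r \<otimes> s \<in> I}"
    using assms by (simp add: m_assoc ideal.I_l_closed)
qed (use assms ideal_zero in auto)

lemma Idl_insert_iff:
  assumes "I \<subseteq> carrier R" "x \<in> carrier R"
  shows "a \<in> Idl (insert x I) \<longleftrightarrow> (\<exists>b\<in>Idl I. \<exists>r\<in>carrier R. a = b \<oplus> r \<otimes> x)"
proof
  have id: "ideal (Idl I) R" by (rule genideal_ideal[OF assms(1)])
  let ?K = "{a. \<exists>b\<in>Idl I. \<exists>r\<in>carrier R. a = b \<oplus> r \<otimes> x}"
  have "ideal ?K R"
  proof (rule ideal_from_closure)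
    show "?K \<subseteq> carrier R" using ideal.Icarr[OF id] assms by auto
    show "\<zero> \<in> ?K" using ideal_zero[OF id] assms by (auto intro!: bexI[of _ \<zero>])
    fix a a' assume "a \<in> ?K" "a' \<in> ?K"
    then obtain b r b' r' where *: "b \<in> Idl I" "r \<in> carrier R" "a = b \<oplus> r \<otimes> x"
      "b' \<in> Idl I" "r' \<in> carrier R" "a' = b' \<oplus> r' \<otimes> x" by auto
    have "b \<in> carrier R" "b' \<in> carrier R" using * ideal.Icarr[OF id] by auto
    then have "a \<oplus> a' = (b \<oplus> b') \<oplus> (r \<oplus> r') \<otimes> x" using * assms by algebra
    then show "a \<oplus> a' \<in> ?K" using * ideal_add[OF id] by blast
  next
    fix a t assume "a \<in> ?K" "t \<in> carrier R"
    then obtain b r where *: "b \<in> Idl I" "r \<in> carrier R" "a = b \<oplus> r \<otimes> x" by auto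
    have "b \<in> carrier R" using * ideal.Icarr[OF id] by auto
    then have "t \<otimes> a = t \<otimes> b \<oplus> (t \<otimes> r) \<otimes> x" using * assms \<open>t \<in> carrier R\<close> by algebra
    then show "t \<otimes> a \<in> ?K" using * ideal.I_l_closed[OF id] \<open>t \<in> carrier R\<close> m_closed by blast
  qed
  moreover have "insert x I \<subseteq> ?K"
  proof -
    have "x = \<zero> \<oplus> \<one> \<otimes> x" using assms by simp
    then have "x \<in> ?K" using ideal_zero[OF id] by blast
    moreover have "b \<in> ?K" if "b \<in> I" for b
    proof -
      have "b = b \<oplus> \<zero> \<otimes> x" using assms that by auto
      then show ?thesis using genideal_self[OF assms(1)] that by blast
    qed
    ultimately show ?thesis by blast
  qed
  ultimately have "Idl (insert x I) \<subseteq> ?K" by (rule genideal_minimal)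
  then show "a \<in> Idl (insert x I) \<Longrightarrow> \<exists>b\<in>Idl I. \<exists>r\<in>carrier R. a = b \<oplus> r \<otimes> x" by auto
next
  have id: "ideal (Idl (insert x I)) R" using assms by (simp add: genideal_ideal)
  have c: "insert x I \<subseteq> carrier R" using assms by blast
  have sub: "Idl I \<subseteq> Idl (insert x I)" "x \<in> Idl (insert x I)"
    using subset_Idl_subset[OF c] genideal_self[OF c] by auto
  assume "\<exists>b\<in>Idl I. \<exists>r\<in>carrier R. a = b \<oplus> r \<otimes> x"
  then show "a \<in> Idl (insert x I)"
    using sub ideal_add[OF id] ideal.I_l_closed[OF id] by blast
qed

lemma Idl_of_ideal: "ideal I R \<Longrightarrow> Idl I = I"
  by (meson additive_subgroup.a_subset equalityI genideal_minimal genideal_self ideal.axioms(1) subset_refl)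

text \<open>For a prime \<open>N\<close>, the saturated ideals are the contractions of the ideals of
  the localization at \<open>N\<close>. They stand for the latter, so that arguments at different
  primes can be mixed without changing the ring.\<close>

definition saturated :: "'a set \<Rightarrow> 'a set \<Rightarrow> bool" where
  "saturated N J \<longleftrightarrow> (\<forall>s \<in> carrier R - N. \<forall>a \<in> carrier R. s \<otimes> a \<in> J \<longrightarrow> a \<in> J)"

lemma saturatedD:
  "saturated N J \<Longrightarrow> s \<in> carrier R \<Longrightarrow> s \<notin> N \<Longrightarrow> a \<in> carrier R \<Longrightarrow> s \<otimes> a \<in> J \<Longrightarrow> a \<in> J"
  unfolding saturated_def by blast

lemma saturated_mono: "saturated Q J \<Longrightarrow> Q \<subseteq> N \<Longrightarrow> saturated N J"
  unfolding saturated_def by blast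

lemma saturated_prime: "primeideal P R \<Longrightarrow> P \<subseteq> N \<Longrightarrow> saturated N P"
  unfolding saturated_def using primeideal.I_prime by fast

text \<open>For an ideal \<open>C\<close>, this is the contraction of the ideal generated by
  \<open>C\<close> and \<open>x\<close> in the localization at \<open>N\<close>, hence the smallest
  saturated ideal above both.\<close>

definition sat_add :: "'a set \<Rightarrow> 'a set \<Rightarrow> 'a \<Rightarrow> 'a set" where
  "sat_add N C x = {a \<in> carrier R. \<exists>t \<in> carrier R - N. \<exists>c\<in>C. \<exists>r\<in>carrier R. t \<otimes> a = c \<oplus> r \<otimes> x}"

lemma sat_addE:
  assumes "a \<in> sat_add N C x"
  obtains t c r where "t \<in> carrier R" "t \<notin> N" "c \<in> C" "r \<in> carrier R" "t \<otimes> a = c \<oplus> r \<otimes> x" "a \<in> carrier R"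
  using assms unfolding sat_add_def by blast

lemma sat_addI:
  "\<lbrakk>a \<in> carrier R; t \<in> carrier R; t \<notin> N; c \<in> C; r \<in> carrier R; t \<otimes> a = c \<oplus> r \<otimes> x\<rbrakk> \<Longrightarrow> a \<in> sat_add N C x"
  unfolding sat_add_def by blast

lemma sat_add_mono: "C \<subseteq> D \<Longrightarrow> sat_add N C x \<subseteq> sat_add N D x"
  unfolding sat_add_def by blast

context
  fixes N C x assumes N: "primeideal N R" and C: "ideal C R" and x: "x \<in> carrier R"
begin

lemma sat_add_ideal: "ideal (sat_add N C x) R"
proof (rule ideal_from_closure)
  show "sat_add N C x \<subseteq> carrier R" unfolding sat_add_def by blast
  show "\<zero> \<in> sat_add N C x"
    by (rule sat_addI[of _ \<one> _ \<zero> _ \<zero>]) (use x ideal_zero[OF C] prime_one_notin[OF N] in auto)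
next
  fix a b assume "a \<in> sat_add N C x" "b \<in> sat_add N C x"
  then obtain t c r t' c' r' where
    1: "t \<in> carrier R" "t \<notin> N" "c \<in> C" "r \<in> carrier R" "t \<otimes> a = c \<oplus> r \<otimes> x" "a \<in> carrier R" and
    2: "t' \<in> carrier R" "t' \<notin> N" "c' \<in> C" "r' \<in> carrier R" "t' \<otimes> b = c' \<oplus> r' \<otimes> x" "b \<in> carrier R"
    by (elim sat_addE)
  have cc: "c \<in> carrier R" "c' \<in> carrier R" using 1 2 ideal.Icarr[OF C] by auto
  have "(t \<otimes> t') \<otimes> (a \<oplus> b) = t' \<otimes> (t \<otimes> a) \<oplus> t \<otimes> (t' \<otimes> b)" using 1(1,6) 2(1,6) by algebra
  also have "\<dots> = (t' \<otimes> c \<oplus> t \<otimes> c') \<oplus> (t' \<otimes> r \<oplus> t \<otimes> r') \<otimes> x"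
    unfolding 1(5) 2(5) using 1(1,4) 2(1,4) x cc by algebra
  finally show "a \<oplus> b \<in> sat_add N C x"
    using 1 2 prime_Compl_mult[OF N] ideal_add[OF C] ideal.I_l_closed[OF C]
    by (intro sat_addI[of _ "t \<otimes> t'" _ "t' \<otimes> c \<oplus> t \<otimes> c'" _ "t' \<otimes> r \<oplus> t \<otimes> r'"]) auto
next
  fix a s assume "a \<in> sat_add N C x" and s: "s \<in> carrier R"
  then obtain t c r where
    1: "t \<in> carrier R" "t \<notin> N" "c \<in> C" "r \<in> carrier R" "t \<otimes> a = c \<oplus> r \<otimes> x" "a \<in> carrier R"
    by (elim sat_addE)
  have cc: "c \<in> carrier R" using 1 ideal.Icarr[OF C] by auto
  have "t \<otimes> (s \<otimes> a) = s \<otimes> (t \<otimes> a)" using 1(1,6) s by algebra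
  also have "\<dots> = s \<otimes> c \<oplus> (s \<otimes> r) \<otimes> x" unfolding 1(5) using 1(1,4) x cc s by algebra
  finally show "s \<otimes> a \<in> sat_add N C x"
    using 1 s ideal.I_l_closed[OF C]
    by (intro sat_addI[of _ t _ "s \<otimes> c" _ "s \<otimes> r"]) auto
qed

lemma sat_add_saturated: "saturated N (sat_add N C x)"
  unfolding saturated_def
proof (intro ballI impI)
  fix s a assume s: "s \<in> carrier R - N" and a: "a \<in> carrier R" and "s \<otimes> a \<in> sat_add N C x"
  then obtain t c r where
    1: "t \<in> carrier R" "t \<notin> N" "c \<in> C" "r \<in> carrier R" "t \<otimes> (s \<otimes> a) = c \<oplus> r \<otimes> x"
    by (blast elim: sat_addE)
  then show "a \<in> sat_add N C x"
    using prime_Compl_mult[OF N _ s] s a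
    by (intro sat_addI[of _ "t \<otimes> s" _ c _ r]) (auto simp: m_assoc)
qed

lemma sat_add_sub: "C \<subseteq> sat_add N C x"
proof
  fix c assume c: "c \<in> C"
  show "c \<in> sat_add N C x"
    by (rule sat_addI[of _ \<one> _ c _ \<zero>]) (use x ideal.Icarr[OF C c] c prime_one_notin[OF N] in auto)
qed

lemma sat_add_mem: "x \<in> sat_add N C x"
  by (rule sat_addI[of _ \<one> _ \<zero> _ \<one>]) (use x ideal_zero[OF C] prime_one_notin[OF N] in auto)

end

end

section \<open>Noetherian induction, Nakayama's lemma and Krull's principal ideal theorem\<close>

context noetherian_cring
begin

text \<open>Ascending chains of ideals become stationary, so the union of a chain is one of its
  members and Zorn's lemma applies. Noetherian inductions below take a maximal counterexample from
  this lemma.\<close>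

lemma ideal_maximal_element:
  assumes "\<A> \<noteq> {}" "\<And>I. I \<in> \<A> \<Longrightarrow> ideal I R"
  obtains M where "M \<in> \<A>" "\<And>J. J \<in> \<A> \<Longrightarrow> M \<subseteq> J \<Longrightarrow> J = M"
proof -
  have "\<exists>M\<in>\<A>. \<forall>K\<in>\<A>. M \<subseteq> K \<longrightarrow> K = M"
  proof (rule subset_Zorn_nonempty[OF assms(1)])
    fix C assume C: "C \<noteq> {}" "subset.chain \<A> C"
    then have "subset.chain {I. ideal I R} C"
      using assms(2) unfolding pred_on.chain_def by auto
    then have "\<Union>C \<in> C" using ideal_chain_is_trivial[OF C(1)] by blast
    then show "\<Union>C \<in> \<A>" using C(2) unfolding pred_on.chain_def by auto
  qed
  then show ?thesis using that by blast
qed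

text \<open>The closure hypothesis is the usual \<open>A \<subseteq> B + N A\<close>, read after localizing at \<open>N\<close>.
  A saturated \<open>C \<supseteq> B\<close> maximal among those not containing \<open>A\<close> must contain \<open>N A\<close>, because
  adjoining \<open>n s\<close> to \<open>C\<close> does not capture \<open>s\<close>.\<close>

lemma nakayama:
  assumes N: "primeideal N R" and A: "A \<subseteq> carrier R"
    and closure: "\<And>C. \<lbrakk>ideal C R; saturated N C; B \<subseteq> C; \<And>n a. n \<in> N \<Longrightarrow> a \<in> A \<Longrightarrow> n \<otimes> a \<in> C\<rbrakk> \<Longrightarrow> A \<subseteq> C"
    and C0: "ideal C0 R" "saturated N C0" "B \<subseteq> C0"
  shows "A \<subseteq> C0"
proof (rule ccontr)
  let ?\<A> = "{C. ideal C R \<and> saturated N C \<and> B \<subseteq> C \<and> \<not> A \<subseteq> C}"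
  assume "\<not> A \<subseteq> C0"
  then have "?\<A> \<noteq> {}" using C0 by blast
  then obtain C where C: "C \<in> ?\<A>" and max: "\<And>J. J \<in> ?\<A> \<Longrightarrow> C \<subseteq> J \<Longrightarrow> J = C"
    by (rule ideal_maximal_element) auto
  have Cid: "ideal C R" and Cs: "saturated N C" using C by auto
  have Nid: "ideal N R" using N primeideal.axioms(1) by blast
  have "n \<otimes> s \<in> C" if n: "n \<in> N" and s: "s \<in> A" for n s
  proof -
    have nc: "n \<in> carrier R" "s \<in> carrier R" using n s ideal.Icarr[OF Nid] A by auto
    let ?D = "sat_add N C (n \<otimes> s)"
    note D = sat_add_ideal[OF N Cid, of "n \<otimes> s"] sat_add_saturated[OF N Cid, of "n \<otimes> s"]
      sat_add_sub[OF N Cid, of "n \<otimes> s"] sat_add_mem[OF N Cid, of "n \<otimes> s"]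
    show ?thesis
    proof (cases "A \<subseteq> ?D")
      case False
      then have "?D \<in> ?\<A>" using C D nc by auto
      then have "?D = C" using max D nc by auto
      then show ?thesis using D nc by auto
    next
      case True
      then have "s \<in> ?D" using s by blast
      then obtain t c r where
        1: "t \<in> carrier R" "t \<notin> N" "c \<in> C" "r \<in> carrier R" "t \<otimes> s = c \<oplus> r \<otimes> (n \<otimes> s)"
        by (rule sat_addE)
      have cc: "c \<in> carrier R" using 1 ideal.Icarr[OF Cid] by auto
      \<comment> \<open>Since \<open>n \<in> N\<close> and \<open>t \<notin> N\<close>, the factor
        \<open>t - r n\<close> is outside \<open>N\<close>, a unit at \<open>N\<close>. It cancels
        from the saturated ideal \<open>C\<close>, so \<open>s\<close> was in \<open>C\<close>
        already.\<close>
      have "(t \<ominus> r \<otimes> n) \<otimes> s = t \<otimes> s \<ominus> r \<otimes> (n \<otimes> s)" using 1(1,4) nc by algebra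
      also have "\<dots> = c" unfolding 1(5) using 1(4) nc cc by algebra
      finally have e: "(t \<ominus> r \<otimes> n) \<otimes> s \<in> C" using 1 by simp
      have "t \<ominus> r \<otimes> n \<notin> N"
      proof
        assume "t \<ominus> r \<otimes> n \<in> N"
        moreover have "r \<otimes> n \<in> N" using ideal.I_l_closed[OF Nid n] 1 by auto
        ultimately have "(t \<ominus> r \<otimes> n) \<oplus> r \<otimes> n \<in> N" using ideal_add[OF Nid] by auto
        moreover have "(t \<ominus> r \<otimes> n) \<oplus> r \<otimes> n = t" using 1(1,4) nc by algebra
        ultimately show False using 1 by simp
      qed
      then have "s \<in> C" using saturatedD[OF Cs _ _ _ e] 1 nc by auto
      then show ?thesis using ideal.I_l_closed[OF Cid] nc by auto
    qed
  qed
  then have "A \<subseteq> C" using closure[of C] C by blast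
  then show False using C by blast
qed

text \<open>Existence of an associated prime of \<open>R / I\<close>. Choose \<open>(I : s)\<close>
  maximal with \<open>s \<notin> I\<close>. If \<open>a b\<close> is in it and \<open>b\<close> is
  not, then \<open>(I : b s)\<close> contains it, hence equals it, and \<open>a\<close> belongs to
  it.\<close>

lemma exists_prime_colon:
  assumes I: "ideal I R" "I \<noteq> carrier R"
  obtains s where "s \<in> carrier R" "s \<notin> I" "primeideal {r \<in> carrier R. r \<otimes> s \<in> I} R"
proof -
  let ?K = "\<lambda>s. {r \<in> carrier R. r \<otimes> s \<in> I}"
  let ?\<A> = "?K ` (carrier R - I)"
  have "carrier R - I \<noteq> {}" using I ideal.Icarr[OF I(1)] by blast
  then have "?\<A> \<noteq> {}" by blast
  then obtain M where M: "M \<in> ?\<A>" and max: "\<And>J. J \<in> ?\<A> \<Longrightarrow> M \<subseteq> J \<Longrightarrow> J = M"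
    by (rule ideal_maximal_element) (use ideal_colon[OF I(1)] in auto)
  from M obtain s where s: "s \<in> carrier R" "s \<notin> I" and Ms: "M = ?K s" by blast
  have "primeideal (?K s) R"
  proof (rule primeidealI[OF ideal_colon[OF I(1) s(1)] is_cring])
    have "\<one> \<notin> ?K s" using s by auto
    then show "carrier R \<noteq> ?K s" by blast
  next
    fix a b assume ab: "a \<in> carrier R" "b \<in> carrier R" "a \<otimes> b \<in> ?K s"
    show "a \<in> ?K s \<or> b \<in> ?K s"
    proof (rule ccontr)
      assume n: "\<not> (a \<in> ?K s \<or> b \<in> ?K s)"
      then have bs: "b \<otimes> s \<in> carrier R - I" using ab s by auto
      have "?K s \<subseteq> ?K (b \<otimes> s)"
      proof
        fix r assume r: "r \<in> ?K s"
        then have "r \<otimes> (b \<otimes> s) = b \<otimes> (r \<otimes> s)" using ab(2) s by (simp add: m_lcomm)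
        then show "r \<in> ?K (b \<otimes> s)" using r ab ideal.I_l_closed[OF I(1)] by auto
      qed
      moreover have "?K (b \<otimes> s) \<in> ?\<A>" using bs by blast
      ultimately have "?K (b \<otimes> s) = ?K s" unfolding Ms[symmetric] by (rule max[rotated])
      moreover have "a \<in> ?K (b \<otimes> s)" using ab s by (simp add: m_assoc)
      ultimately show False using n by blast
    qed
  qed
  then show ?thesis using that s by blast
qed

text \<open>This is the Artinian property of \<open>R\<^sub>N / Z R\<^sub>N\<close>. For a maximal counterexample \<open>I\<close>
  to stabilization above \<open>I\<close>, an element \<open>s\<close> of the socle modulo \<open>I\<close> gives a larger
  ideal \<open>I + (s)\<close>, above which chains stabilize.\<close>

lemma descending_chain_above_minimal_prime:
  assumes N: "primeideal N R"
    and min: "\<And>N'. primeideal N' R \<Longrightarrow> Z \<subseteq> N' \<Longrightarrow> N' \<subseteq> N \<Longrightarrow> N' = N"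
    and J: "\<And>n. ideal (J n) R" "\<And>n. saturated N (J n)" "\<And>n. Z \<subseteq> J n" "antimono (J :: nat \<Rightarrow> 'a set)"
  shows "\<exists>n. \<forall>m\<ge>n. J m = J n"
proof (rule ccontr)
  assume neg: "\<not> (\<exists>n. \<forall>m\<ge>n. J m = J n)"
  let ?chain = "\<lambda>I J. (\<forall>n. ideal (J n) R \<and> saturated N (J n) \<and> I \<subseteq> J n) \<and> antimono (J :: nat \<Rightarrow> 'a set)"
  let ?stab = "\<lambda>J. \<exists>n::nat. \<forall>m\<ge>n. J m = (J n :: 'a set)"
  let ?\<A> = "{I. ideal I R \<and> saturated N I \<and> Z \<subseteq> I \<and> (\<exists>J. ?chain I J \<and> \<not> ?stab J)}"
  \<comment> \<open>Quantifying over all chains above \<open>I\<close> makes failure a property of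
    \<open>I\<close> alone; the given chain witnesses it for its own intersection.\<close>
  have "(\<Inter>n. J n) \<in> ?\<A>"
  proof -
    have "ideal (\<Inter>(range J)) R" by (rule i_Intersect) (use J in auto)
    moreover have "saturated N (\<Inter>(range J))" using J(2) unfolding saturated_def by blast
    moreover have "?chain (\<Inter>(range J)) J" using J by auto
    ultimately show ?thesis using J(3) neg by (intro CollectI conjI exI[of _ J]) auto
  qed
  then have "?\<A> \<noteq> {}" by blast
  then obtain I where I: "I \<in> ?\<A>" and max: "\<And>K. K \<in> ?\<A> \<Longrightarrow> I \<subseteq> K \<Longrightarrow> K = I"
    by (rule ideal_maximal_element) auto
  have Iid: "ideal I R" and Is: "saturated N I" and XI: "Z \<subseteq> I" using I by auto
  obtain G where G: "?chain I G" "\<not> ?stab G" using I by auto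
  have Gid: "\<And>n. ideal (G n) R" and Gs: "\<And>n. saturated N (G n)" and IG: "\<And>n. I \<subseteq> G n"
    and Ga: "\<And>m n. n \<le> m \<Longrightarrow> G m \<subseteq> G n" using G unfolding antimono_def by auto
  have "I \<noteq> carrier R"
  proof
    assume "I = carrier R"
    then have "G n = carrier R" for n using IG[of n] ideal.Icarr[OF Gid[of n]] by blast
    then have "?stab G" by simp
    then show False using G(2) by contradiction
  qed
  then obtain s where s: "s \<in> carrier R" "s \<notin> I" and pr: "primeideal {r \<in> carrier R. r \<otimes> s \<in> I} R"
    using exists_prime_colon[OF Iid] by blast
  \<comment> \<open>An associated prime of \<open>R / I\<close> contains \<open>Z\<close>, and it
    lies in \<open>N\<close> because \<open>I\<close> is saturated, so minimality leaves only
    \<open>N\<close>. Thus \<open>s\<close> spans a copy of the residue field of \<open>N\<close>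
    after localization.\<close>
  have "{r \<in> carrier R. r \<otimes> s \<in> I} = N"
  proof (rule min[OF pr])
    show "Z \<subseteq> {r \<in> carrier R. r \<otimes> s \<in> I}" using XI ideal.Icarr[OF Iid] ideal.I_r_closed[OF Iid] s by blast
    show "{r \<in> carrier R. r \<otimes> s \<in> I} \<subseteq> N" using saturatedD[OF Is] s by blast
  qed
  then have socle: "\<And>r. r \<in> N \<Longrightarrow> r \<otimes> s \<in> I" by blast
  let ?I = "sat_add N I s"
  have notA: "?I \<notin> ?\<A>"
  proof
    assume "?I \<in> ?\<A>"
    then have "?I = I" by (rule max) (rule sat_add_sub[OF N Iid s(1)])
    then show False using sat_add_mem[OF N Iid s(1)] s(2) by simp
  qed
  have I': "ideal ?I R" "saturated N ?I" "Z \<subseteq> ?I"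
    using sat_add_ideal[OF N Iid s(1)] sat_add_saturated[OF N Iid s(1)] sat_add_sub[OF N Iid s(1)] XI by auto
  have stab': "?stab K" if "?chain ?I K" for K
  proof (rule ccontr)
    assume "\<not> ?stab K"
    then have "?I \<in> ?\<A>" using I' that by (intro CollectI conjI exI[of _ K]) blast+
    then show False using notA by contradiction
  qed
  let ?G = "\<lambda>n. sat_add N (G n) s"
  have "antimono ?G" by (rule antimonoI) (intro sat_add_mono Ga)
  then have "?chain ?I ?G"
    using sat_add_ideal[OF N Gid s(1)] sat_add_saturated[OF N Gid s(1)] sat_add_mono[OF IG] by blast
  then have "?stab ?G" by (rule stab')
  then obtain n0 where n0: "\<And>m. m \<ge> n0 \<Longrightarrow> ?G m = ?G n0" by auto
  show False
  proof (cases "\<forall>n. s \<in> G n")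
    case True
    have "?I \<subseteq> G n" for n
    proof
      fix a assume "a \<in> ?I"
      then obtain t c r where 1: "t \<in> carrier R" "t \<notin> N" "c \<in> I" "r \<in> carrier R" "t \<otimes> a = c \<oplus> r \<otimes> s" "a \<in> carrier R"
        by (rule sat_addE)
      have "c \<oplus> r \<otimes> s \<in> G n"
        using 1 True IG ideal_add[OF Gid] ideal.I_l_closed[OF Gid] by blast
      then show "a \<in> G n" using saturatedD[OF Gs] 1 by metis
    qed
    then have "?stab G" using G(1) by (intro stab') auto
    then show False using G(2) by contradiction
  next
    case False
    then obtain n1 where n1: "s \<notin> G n1" by blast
    define M where "M = max n0 n1"
    have sM: "s \<notin> G M" using n1 Ga[of n1 M] M_def by auto
    \<comment> \<open>From here on \<open>s\<close> is outside the chain. As \<open>G m\<close> and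
      \<open>G M\<close> agree after adjoining \<open>s\<close>, an element \<open>a\<close> of
      \<open>G M\<close> has \<open>t a = c + r s\<close> with \<open>c \<in> G m\<close>. Then
      \<open>r s \<in> G M\<close>, so \<open>r \<in> N\<close>, and \<open>r s\<close> already lies
      in \<open>I\<close>.\<close>
    have "G m = G M" if m: "m \<ge> M" for m
    proof
      show "G m \<subseteq> G M" by (rule Ga[OF m])
      show "G M \<subseteq> G m"
      proof
        fix a assume a: "a \<in> G M"
        then have "a \<in> ?G M" using sat_add_sub[OF N Gid s(1)] by blast
        then have "a \<in> ?G m" using n0[of m] n0[of M] m M_def by auto
        then obtain t c r where 1: "t \<in> carrier R" "t \<notin> N" "c \<in> G m" "r \<in> carrier R" "t \<otimes> a = c \<oplus> r \<otimes> s" "a \<in> carrier R"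
          by (rule sat_addE)
        have "c \<oplus> r \<otimes> s \<in> G M" using 1(1,5) a ideal.I_l_closed[OF Gid] by metis
        then have rs: "r \<otimes> s \<in> G M" using ideal_add_cancel[OF Gid] 1(3,4) s(1) Ga[OF m] by blast
        have "r \<in> N"
        proof (rule ccontr)
          assume "r \<notin> N"
          then show False using saturatedD[OF Gs _ _ s(1) rs] 1(4) sM by blast
        qed
        then have "r \<otimes> s \<in> G m" using socle IG by blast
        then have "t \<otimes> a \<in> G m" using 1(3,5) ideal_add[OF Gid] by metis
        then show "a \<in> G m" using saturatedD[OF Gs] 1 by metis
      qed
    qed
    then have "?stab G" by blast
    then show False using G(2) by contradiction
  qed
qed

text \<open>Krull's principal ideal theorem, by the usual argument: otherwise \<open>N\<close> is minimal over
  \<open>P + (x)\<close>, and the symbolic powers of \<open>Q\<close> modulo \<open>P\<close> stabilize modulo \<open>x\<close>, hence stabilize,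
  hence vanish modulo \<open>P\<close>.\<close>

lemma exists_intermediate_prime_containing:
  assumes P: "primeideal P R" and Q: "primeideal Q R" and N: "primeideal N R"
    and PQ: "P \<subset> Q" and QN: "Q \<subset> N" and x: "x \<in> N"
  shows "\<exists>Q'. primeideal Q' R \<and> P \<subset> Q' \<and> Q' \<subset> N \<and> x \<in> Q'"
proof (cases "x \<in> Q")
  case True
  then show ?thesis using Q PQ QN by blast
next
  case False
  show ?thesis
  proof (rule ccontr)
    assume neg: "\<not> ?thesis"
    have Pid: "ideal P R" and Qid: "ideal Q R" and Nid: "ideal N R"
      using P Q N primeideal.axioms(1) by auto
    have xc: "x \<in> carrier R" using ideal.Icarr[OF Nid x] .
    have Pc: "P \<subseteq> carrier R" and Qc: "Q \<subseteq> carrier R" using ideal.Icarr[OF Pid] ideal.Icarr[OF Qid] by auto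
    have min: "N' = N" if "primeideal N' R" "insert x P \<subseteq> N'" "N' \<subseteq> N" for N'
    proof (rule ccontr)
      assume "N' \<noteq> N"
      moreover have "P \<noteq> N'" using that(2) False PQ by blast
      ultimately show False using neg that by blast
    qed
    \<comment> \<open>If \<open>A\<close> is a symbolic power of \<open>Q\<close> modulo
      \<open>P\<close>, this is the next one: the smallest \<open>Q\<close>-saturated ideal
      containing \<open>P\<close> and \<open>Q A\<close>.\<close>
    define next_power where "next_power = (\<lambda>A. \<Inter>{C. ideal C R \<and> saturated Q C \<and> P \<subseteq> C \<and> (\<forall>q\<in>Q. \<forall>r\<in>A. q \<otimes> r \<in> C)})"
    define S where "S = rec_nat (carrier R) (\<lambda>_. next_power)"
    have S0: "S 0 = carrier R" and SS: "S (Suc n) = next_power (S n)" for n by (simp_all add: S_def)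
    have carr_mem: "carrier R \<in> {C. ideal C R \<and> saturated Q C \<and> P \<subseteq> C \<and> (\<forall>q\<in>Q. \<forall>r\<in>A. q \<otimes> r \<in> C)}"
      if "A \<subseteq> carrier R" for A
      using oneideal that Pc Qc by (auto simp: saturated_def subset_iff)
    have hullid: "ideal (next_power A) R" if "A \<subseteq> carrier R" for A
      unfolding next_power_def by (rule i_Intersect) (use carr_mem[OF that] in auto)
    have hullsat: "saturated Q (next_power A)" for A unfolding next_power_def saturated_def by blast
    have hullP: "P \<subseteq> next_power A" for A unfolding next_power_def by blast
    have hullQ: "q \<otimes> r \<in> next_power A" if "q \<in> Q" "r \<in> A" for A q r using that unfolding next_power_def by blast
    have hullmin: "next_power A \<subseteq> C"
      if "ideal C R" "saturated Q C" "P \<subseteq> C" "\<And>q r. q \<in> Q \<Longrightarrow> r \<in> A \<Longrightarrow> q \<otimes> r \<in> C" for A C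
      using that unfolding next_power_def by blast
    have Sid: "ideal (S n) R" for n
    proof (induction n)
      case 0 then show ?case using S0 oneideal by simp
    next
      case (Suc n) then show ?case unfolding SS by (intro hullid) (use ideal.Icarr[OF Suc] in blast)
    qed
    have Ssat: "saturated Q (S n)" for n
      by (cases n) (auto simp: S0 SS hullsat, simp add: saturated_def)
    have SP: "P \<subseteq> S n" for n by (cases n) (use S0 SS hullP ideal.Icarr[OF Pid] in auto)
    have Sdec: "S (Suc n) \<subseteq> S n" for n
      unfolding SS using ideal.I_l_closed[OF Sid] ideal.Icarr[OF Qid]
      by (intro hullmin Sid Ssat SP) blast
    have "antimono S" by (rule antimonoI) (use Sdec lift_Suc_antimono_le in blast)
    let ?J = "\<lambda>n. sat_add N (S n) x"
    have "antimono ?J" using \<open>antimono S\<close> by (intro antimonoI sat_add_mono) (rule antimonoD)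
    then have "\<exists>n. \<forall>m\<ge>n. ?J m = ?J n"
      using sat_add_sub[OF N Sid xc] sat_add_mem[OF N Sid xc] SP
      by (intro descending_chain_above_minimal_prime[OF N min, where Z="insert x P"]
          sat_add_ideal[OF N Sid xc] sat_add_saturated[OF N Sid xc]) blast+
    then obtain n where n: "?J (Suc n) = ?J n" by (metis le_SucI order_refl)
    \<comment> \<open>Up to a factor outside \<open>N\<close>, an element of \<open>S n\<close> is
      \<open>c + r x\<close> with \<open>c \<in> S (Suc n)\<close>. As \<open>x \<notin> Q\<close>
      cancels from the \<open>Q\<close>-saturated \<open>S n\<close>, the coefficient
      \<open>r\<close> is in \<open>S n\<close>. So
      \<open>S n \<subseteq> S (Suc n) + x (S n)\<close> at \<open>N\<close>, and Nakayama at
      \<open>N\<close> applies.\<close>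
    have SeqSuc: "S n \<subseteq> S (Suc n)"
    proof (rule nakayama[OF N, where B="S (Suc n)"])
      show "S n \<subseteq> carrier R" using ideal.Icarr[OF Sid] by blast
      show "saturated N (S (Suc n))" using saturated_mono[OF Ssat] QN by blast
      fix C assume C: "ideal C R" "saturated N C" "S (Suc n) \<subseteq> C"
        and NS: "\<And>u a. u \<in> N \<Longrightarrow> a \<in> S n \<Longrightarrow> u \<otimes> a \<in> C"
      show "S n \<subseteq> C"
      proof
        fix a assume a: "a \<in> S n"
        have "a \<in> ?J (Suc n)" using a sat_add_sub[OF N Sid xc] n by blast
        then obtain t c r where 1: "t \<in> carrier R" "t \<notin> N" "c \<in> S (Suc n)" "r \<in> carrier R"
          "t \<otimes> a = c \<oplus> r \<otimes> x" "a \<in> carrier R" by (rule sat_addE)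
        have "c \<oplus> r \<otimes> x \<in> S n" using 1(1,5) a ideal.I_l_closed[OF Sid] by metis
        then have "r \<otimes> x \<in> S n" using ideal_add_cancel[OF Sid] 1(3,4) xc Sdec by blast
        then have "x \<otimes> r \<in> S n" using m_comm 1(4) xc by simp
        then have "r \<in> S n" using saturatedD[OF Ssat xc False] 1(4) by blast
        then have "x \<otimes> r \<in> C" using NS x by blast
        then have "r \<otimes> x \<in> C" using m_comm 1(4) xc by simp
        then have "t \<otimes> a \<in> C" using 1(3,5) C(3) ideal_add[OF C(1)] by auto
        then show "a \<in> C" using saturatedD[OF C(2)] 1 by blast
      qed
    qed (use Sid in auto)
    \<comment> \<open>Now Nakayama at \<open>Q\<close>: stabilization says that \<open>S n\<close>
      is generated by \<open>P\<close> and \<open>Q (S n)\<close> up to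
      \<open>Q\<close>-saturation.\<close>
    have "S n \<subseteq> P"
    proof (rule nakayama[OF Q, where B=P])
      show "S n \<subseteq> carrier R" using ideal.Icarr[OF Sid] by blast
      show "saturated Q P" using saturated_prime[OF P] PQ by blast
      fix C assume "ideal C R" "saturated Q C" "P \<subseteq> C" "\<And>u a. u \<in> Q \<Longrightarrow> a \<in> S n \<Longrightarrow> u \<otimes> a \<in> C"
      then have "S (Suc n) \<subseteq> C" unfolding SS by (rule hullmin)
      then show "S n \<subseteq> C" using SeqSuc by blast
    qed (use Pid in auto)
    moreover have "q [^] k \<in> S k" if q: "q \<in> Q" for q and k :: nat
    proof (induction k)
      case 0 then show ?case using S0 by simp
    next
      case (Suc k)
      have "q \<otimes> q [^] k \<in> S (Suc k)" unfolding SS by (rule hullQ[OF q Suc])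
      then show ?case using ideal.Icarr[OF Qid q] by (simp add: nat_pow_comm m_comm)
    qed
    ultimately have "Q \<subseteq> P" using prime_pow_mem[OF P] ideal.Icarr[OF Qid] by blast
    then show False using PQ by blast
  qed
qed

end

section \<open>Chains of primes, the height theorem and minimal primes\<close>

context cring
begin

text \<open>A witness that the height of \<open>N\<close> modulo \<open>I\<close> is at least
  \<open>n\<close>. The recursion removes the top prime, since the principal ideal theorem is used
  to exchange primes from the top down.\<close>

fun prime_chain :: "'a set \<Rightarrow> nat \<Rightarrow> 'a set \<Rightarrow> bool" where
  "prime_chain I 0 N \<longleftrightarrow> primeideal N R \<and> I \<subseteq> N"
| "prime_chain I (Suc n) N \<longleftrightarrow> primeideal N R \<and> (\<exists>N'. N' \<subset> N \<and> prime_chain I n N')"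

lemma prime_chain_prime: "prime_chain I n N \<Longrightarrow> primeideal N R"
  by (cases n) auto

lemma prime_chain_subset: "prime_chain I n N \<Longrightarrow> I \<subseteq> N"
  by (induction n arbitrary: N) auto

end

context noetherian_cring
begin

text \<open>Dividing by one element costs at most one step of the chain: the prime below the top is
  exchanged for one containing \<open>x\<close>, which is then the top of a shorter chain of the
  same kind.\<close>

lemma prime_chain_insert:
  "prime_chain I (Suc n) N \<Longrightarrow> x \<in> N \<Longrightarrow> prime_chain (insert x I) n N"
proof (induction n arbitrary: N)
  case 0
  then show ?case using prime_chain_subset[OF 0(1)] by auto
next
  case (Suc n)
  obtain Q P where *: "primeideal N R" "Q \<subset> N" "primeideal Q R" "P \<subset> Q" "prime_chain I n P"
    using Suc.prems(1) by auto
  obtain Q' where Q': "primeideal Q' R" "P \<subset> Q'" "Q' \<subset> N" "x \<in> Q'"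
    using exists_intermediate_prime_containing[OF prime_chain_prime[OF *(5)] *(3) *(1) *(4) *(2) Suc.prems(2)]
    by blast
  have "prime_chain I (Suc n) Q'" unfolding prime_chain.simps using Q' *(5) by blast
  then have "prime_chain (insert x I) n Q'" using Suc.IH Q' by blast
  then show ?case unfolding prime_chain.simps using Q' *(1) by blast
qed

lemma prime_chain_union:
  assumes "finite F" "F \<subseteq> N" "card F \<le> n" "prime_chain I n N"
  shows "prime_chain (F \<union> I) (n - card F) N"
  using assms
proof (induction F rule: finite_induct)
  case empty
  then show ?case by simp
next
  case (insert x F)
  have e: "n - card F = Suc (n - card (insert x F))" using insert.hyps insert.prems(2) by simp
  have "prime_chain (F \<union> I) (n - card F) N"
    by (rule insert.IH) (use insert.hyps insert.prems in auto)
  then have "prime_chain (insert x (F \<union> I)) (n - card (insert x F)) N"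
    unfolding e by (rule prime_chain_insert) (use insert.prems in simp)
  then show ?case by simp
qed

text \<open>Krull's height theorem. After inserting all of \<open>F\<close>, a longer chain would
  still have a prime strictly below \<open>N\<close>, and that prime would contain generators of
  \<open>N\<close>.\<close>

lemma prime_chain_length_le_generators:
  assumes "finite F" "F \<subseteq> carrier R" "I \<subseteq> carrier R" "N = Idl (F \<union> I)" "prime_chain I n N"
  shows "n \<le> card F"
proof (rule ccontr)
  assume "\<not> n \<le> card F"
  then have k: "n - card F = Suc (n - card F - 1)" (is "_ = Suc ?k") by linarith
  have c: "F \<union> I \<subseteq> carrier R" using assms(2,3) by simp
  have "F \<subseteq> N" unfolding assms(4) using genideal_self[OF c] by simp
  then have "prime_chain (F \<union> I) (n - card F) N"
    using \<open>\<not> n \<le> card F\<close> by (intro prime_chain_union assms) auto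
  then have "prime_chain (F \<union> I) (Suc ?k) N" using k by metis
  then obtain N' where N': "N' \<subset> N" "prime_chain (F \<union> I) ?k N'" unfolding prime_chain.simps by blast
  then have "Idl (F \<union> I) \<subseteq> N'"
    using prime_chain_subset[OF N'(2)] prime_chain_prime[OF N'(2)]
    by (intro genideal_minimal primeideal.axioms(1))
  then show False using N' assms(4) by blast
qed

text \<open>In a maximal counterexample \<open>I\<close> is not prime, so some
  \<open>a b \<in> I\<close> splits the primes above \<open>I\<close> into those containing
  \<open>a\<close> and those containing \<open>b\<close>. The members of \<open>F\<close> need not
  be minimal over \<open>I\<close>, so the two families can simply be united.\<close>

lemma finite_primes_below_ideal:
  assumes "ideal I R"
  shows "\<exists>F. finite F \<and> (\<forall>P\<in>F. primeideal P R \<and> I \<subseteq> P) \<and>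
     (\<forall>Q. primeideal Q R \<and> I \<subseteq> Q \<longrightarrow> (\<exists>P\<in>F. P \<subseteq> Q))"
proof (rule ccontr)
  let ?ok = "\<lambda>I F. finite F \<and> (\<forall>P\<in>F. primeideal P R \<and> I \<subseteq> P) \<and>
     (\<forall>Q. primeideal Q R \<and> I \<subseteq> Q \<longrightarrow> (\<exists>P\<in>F. P \<subseteq> Q))"
  let ?\<A> = "{I. ideal I R \<and> \<not> (\<exists>F. ?ok I F)}"
  assume "\<not> (\<exists>F. ?ok I F)"
  then have "I \<in> ?\<A>" using assms by simp
  then have "?\<A> \<noteq> {}" by blast
  then obtain I where I: "I \<in> ?\<A>" and max: "\<And>J. J \<in> ?\<A> \<Longrightarrow> I \<subseteq> J \<Longrightarrow> J = I"
    by (rule ideal_maximal_element) auto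
  have Iid: "ideal I R" and bad: "\<not> ?ok I F" for F using I by auto
  have Ic: "I \<subseteq> carrier R" using ideal.Icarr[OF Iid] by blast
  have "\<not> primeideal I R" using bad[of "{I}"] by auto
  moreover have "carrier R \<noteq> I"
  proof
    assume c: "carrier R = I"
    have "Q = carrier R" if "primeideal Q R" "I \<subseteq> Q" for Q
      using that c ideal.Icarr[OF primeideal.axioms(1)[OF that(1)]] by blast
    then have "?ok I {}" using primeideal.I_notcarr by blast
    then show False using bad by contradiction
  qed
  ultimately obtain a b where ab: "a \<in> carrier R" "b \<in> carrier R" "a \<otimes> b \<in> I" "a \<notin> I" "b \<notin> I"
    using primeidealI[OF Iid is_cring] by blast
  have ex: "\<exists>F. ?ok (Idl (insert a I)) F" if "a \<in> carrier R" "a \<notin> I" for a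
  proof (rule ccontr)
    assume "\<not> (\<exists>F. ?ok (Idl (insert a I)) F)"
    moreover have c: "insert a I \<subseteq> carrier R" using that Ic by blast
    ultimately have "Idl (insert a I) = I"
      by (intro max) (use genideal_ideal[OF c] genideal_self[OF c] in auto)
    then show False using genideal_self[OF c] that by blast
  qed
  have sub: "I \<subseteq> Idl (insert c I)" if "c \<in> carrier R" for c
    using genideal_self[of "insert c I"] that Ic by blast
  have cover: "\<exists>F. finite F \<and> (\<forall>P\<in>F. primeideal P R \<and> I \<subseteq> P) \<and>
      (\<forall>Q. primeideal Q R \<longrightarrow> I \<subseteq> Q \<longrightarrow> c \<in> Q \<longrightarrow> (\<exists>P\<in>F. P \<subseteq> Q))"
    if c: "c \<in> carrier R" "c \<notin> I" for c
  proof -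
    obtain F where F: "?ok (Idl (insert c I)) F" using ex[OF c] by (rule exE)
    have "Idl (insert c I) \<subseteq> Q" if "primeideal Q R" "I \<subseteq> Q" "c \<in> Q" for Q
      using that by (intro genideal_minimal primeideal.axioms(1)) auto
    then show ?thesis using F sub[OF c(1)] by (intro exI[of _ F]) auto
  qed
  obtain F where F: "finite F" "\<forall>P\<in>F. primeideal P R \<and> I \<subseteq> P"
    "\<And>Q. primeideal Q R \<Longrightarrow> I \<subseteq> Q \<Longrightarrow> a \<in> Q \<Longrightarrow> \<exists>P\<in>F. P \<subseteq> Q"
    using cover[OF ab(1,4)] by auto
  obtain G where G: "finite G" "\<forall>P\<in>G. primeideal P R \<and> I \<subseteq> P"
    "\<And>Q. primeideal Q R \<Longrightarrow> I \<subseteq> Q \<Longrightarrow> b \<in> Q \<Longrightarrow> \<exists>P\<in>G. P \<subseteq> Q"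
    using cover[OF ab(2,5)] by auto
  have "\<exists>P\<in>F \<union> G. P \<subseteq> Q" if Q: "primeideal Q R" "I \<subseteq> Q" for Q
  proof -
    have "a \<in> Q \<or> b \<in> Q" using primeideal.I_prime[OF Q(1) ab(1,2)] ab(3) Q(2) by auto
    then show ?thesis using F(3)[OF Q] G(3)[OF Q] by auto
  qed
  then have "?ok I (F \<union> G)" using F(1,2) G(1,2) by auto
  then show False using bad by contradiction
qed

text \<open>Every prime contains a member of one finite family of primes, so a minimal one among the
  members below \<open>Q\<close> is a minimal prime of \<open>R\<close>.\<close>

lemma exists_minimal_prime:
  assumes "primeideal Q R"
  obtains P where "minimal_prime R P" "P \<subseteq> Q"
proof -
  obtain F where F: "finite F" "\<And>P. P \<in> F \<Longrightarrow> primeideal P R"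
    "\<And>Q. primeideal Q R \<Longrightarrow> \<exists>P\<in>F. P \<subseteq> Q"
    using finite_primes_below_ideal[OF zeroideal] ideal_zero primeideal.axioms(1)
    by (metis empty_subsetI insert_subset)
  let ?G = "{P \<in> F. P \<subseteq> Q}"
  have "finite ?G" "?G \<noteq> {}" using F(1) F(3)[OF assms] by auto
  from finite_has_minimal[OF this]
  obtain P where P: "P \<in> ?G" "\<forall>P'\<in>?G. P' \<subseteq> P \<longrightarrow> P = P'" by (rule bexE)
  have "minimal_prime R P" unfolding minimal_prime_def
  proof (intro conjI allI impI)
    fix Q' assume Q': "primeideal Q' R \<and> Q' \<subseteq> P"
    then obtain P' where P': "P' \<in> F" "P' \<subseteq> Q'" using F(3) by metis
    then have "P' \<in> ?G" "P' \<subseteq> P" using P(1) Q' by auto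
    then have "P = P'" using P(2) by auto
    then show "Q' = P" using P' Q' by auto
  qed (use P F in auto)
  then show ?thesis using that P by blast
qed

end

section \<open>Regular local rings\<close>

context noetherian_cring
begin

lemma exists_maximalideal:
  assumes "ideal I R" "\<one> \<notin> I"
  obtains M where "maximalideal M R" "I \<subseteq> M"
proof -
  let ?\<A> = "{J. ideal J R \<and> \<one> \<notin> J \<and> I \<subseteq> J}"
  have "I \<in> ?\<A>" using assms by simp
  then have "?\<A> \<noteq> {}" by blast
  then obtain M where M: "M \<in> ?\<A>" and max: "\<And>J. J \<in> ?\<A> \<Longrightarrow> M \<subseteq> J \<Longrightarrow> J = M"
    by (rule ideal_maximal_element) auto
  have "maximalideal M R"
  proof (rule maximalidealI)
    show "ideal M R" using M by simp
    show "carrier R \<noteq> M" using M by auto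
    fix J assume J: "ideal J R" "M \<subseteq> J" "J \<subseteq> carrier R"
    show "J = M \<or> J = carrier R"
    proof (cases "\<one> \<in> J")
      case True
      then show ?thesis using ideal.one_imp_carrier[OF J(1)] by simp
    next
      case False
      then have "J \<in> ?\<A>" using J M by auto
      then show ?thesis using max J(2) by auto
    qed
  qed
  then show ?thesis using that M by simp
qed

end

locale local_noetherian_ring = noetherian_cring +
  fixes m
  assumes unique_maximal: "{I. maximalideal I R} = {m}"
begin

lemma maximal_m: "maximalideal m R" using unique_maximal by blast

lemma prime_m: "primeideal m R" by (rule maximalideal_prime[OF maximal_m])

lemma ideal_m: "ideal m R" by (rule primeideal.axioms(1)[OF prime_m])

lemma ideal_subset_m:
  assumes "ideal I R" "\<one> \<notin> I"
  shows "I \<subseteq> m"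
proof -
  obtain M where "maximalideal M R" "I \<subseteq> M" by (rule exists_maximalideal[OF assms])
  moreover then have "M \<in> {I. maximalideal I R}" by simp
  ultimately show ?thesis using unique_maximal by simp
qed

lemma inverse_outside_m:
  assumes "x \<in> carrier R" "x \<notin> m"
  obtains y where "y \<in> carrier R" "y \<otimes> x = \<one>"
proof -
  have "x \<in> PIdl x" by (rule cgenideal_self[OF assms(1)])
  then have "\<not> PIdl x \<subseteq> m" using assms(2) by auto
  then have "\<one> \<in> PIdl x" using ideal_subset_m[OF cgenideal_ideal[OF assms(1)]] by metis
  then show ?thesis using that unfolding cgenideal_def by auto
qed

text \<open>Elements outside \<open>m\<close> are units, so results about saturated ideals apply to
  all ideals at \<open>m\<close>.\<close>

lemma saturated_m:
  assumes "ideal J R"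
  shows "saturated m J"
  unfolding saturated_def
proof (intro ballI impI)
  fix s a assume s: "s \<in> carrier R - m" and a: "a \<in> carrier R" and sa: "s \<otimes> a \<in> J"
  obtain y where y: "y \<in> carrier R" "y \<otimes> s = \<one>" using inverse_outside_m s by blast
  have "a = y \<otimes> (s \<otimes> a)" using y s a by (simp flip: m_assoc)
  then show "a \<in> J" using ideal.I_l_closed[OF assms sa y(1)] by simp
qed

lemma nakayama_local:
  assumes "A \<subseteq> carrier R" "ideal B R"
    and "\<And>C. \<lbrakk>ideal C R; B \<subseteq> C; \<And>n a. n \<in> m \<Longrightarrow> a \<in> A \<Longrightarrow> n \<otimes> a \<in> C\<rbrakk> \<Longrightarrow> A \<subseteq> C"
  shows "A \<subseteq> B"
  by (rule nakayama[OF prime_m assms(1), where B=B])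
    (use assms saturated_m in auto)

text \<open>Suppose \<open>Idl I\<close> is not prime. For a member \<open>y\<close> of any generating set of \<open>m\<close> modulo \<open>I\<close> of the
  minimal size, \<open>Idl (insert y I)\<close> is prime by induction, and by Nakayama it is minimal over \<open>I\<close>.
  Applied to the infinitely many choices \<open>y + z ^ n\<close>, with only finitely many minimal primes
  available, this produces a minimal prime containing both \<open>y\<close> and \<open>z\<close>, so one generator was superfluous.\<close>

lemma primeideal_Idl_of_chain:
  assumes "I \<subseteq> carrier R" "finite F" "F \<subseteq> carrier R" "card F \<le> r" "m = Idl (F \<union> I)" "prime_chain I r m"
  shows "primeideal (Idl I) R"
  using assms
proof (induction r arbitrary: I F)
  case 0
  then have "F = {}" by simp
  then show ?case using 0 prime_m by simp
next
  case (Suc r)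
  note I = Suc.prems(1) and ch = Suc.prems(6)
  have Iid: "ideal (Idl I) R" by (rule genideal_ideal[OF I])
  show ?case
  proof (rule ccontr)
    assume np: "\<not> primeideal (Idl I) R"
    let ?valid = "\<lambda>F. finite F \<and> F \<subseteq> carrier R \<and> card F \<le> Suc r \<and> m = Idl (F \<union> I)"
    have min: "primeideal (Idl (insert y I)) R \<and>
        (\<forall>P. primeideal P R \<longrightarrow> I \<subseteq> P \<longrightarrow> P \<subseteq> Idl (insert y I) \<longrightarrow> P = Idl (insert y I))"
      if F: "?valid F" and y: "y \<in> F" for F y
    proof (intro conjI allI impI)
      have c: "F \<union> I \<subseteq> carrier R" and yc: "y \<in> carrier R" using F I y by auto
      have ym: "y \<in> m" using F genideal_self[OF c] y by auto
      let ?K = "Idl (insert y I)"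
      have Kc: "insert y I \<subseteq> carrier R" using I yc by simp
      have e: "(F - {y}) \<union> insert y I = F \<union> I" using y by blast
      show K: "primeideal ?K R"
      proof (rule Suc.IH[of _ "F - {y}"])
        show "prime_chain (insert y I) r m" by (rule prime_chain_insert[OF ch ym])
        show "card (F - {y}) \<le> r" using F y by auto
        show "m = Idl ((F - {y}) \<union> insert y I)" unfolding e using F by simp
      qed (use F Kc in auto)
      fix P assume P: "primeideal P R" "I \<subseteq> P" "P \<subseteq> ?K"
      have Pid: "ideal P R" by (rule primeideal.axioms(1)[OF P(1)])
      have "y \<in> P"
      proof (rule ccontr)
        assume yP: "y \<notin> P"
        \<comment> \<open>For \<open>q \<in> P\<close> written as \<open>b + t y\<close> with
          \<open>b \<in> Idl I\<close>, primality of \<open>P\<close> and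
          \<open>y \<notin> P\<close> give \<open>t \<in> P\<close>. So
          \<open>P \<subseteq> Idl I + y P\<close>, and Nakayama makes \<open>P\<close> equal to
          \<open>Idl I\<close>, which is not prime.\<close>
        have "P \<subseteq> Idl I"
        proof (rule nakayama_local)
          show "P \<subseteq> carrier R" using ideal.Icarr[OF Pid] by blast
          show "ideal (Idl I) R" by (rule Iid)
          fix C assume C: "ideal C R" "Idl I \<subseteq> C" "\<And>n a. n \<in> m \<Longrightarrow> a \<in> P \<Longrightarrow> n \<otimes> a \<in> C"
          show "P \<subseteq> C"
          proof
            fix q assume q: "q \<in> P"
            then have "q \<in> ?K" using P(3) by blast
            then obtain b t where bt: "b \<in> Idl I" "t \<in> carrier R" "q = b \<oplus> t \<otimes> y"
              using Idl_insert_iff[OF I yc] by blast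
            have "b \<in> P" using genideal_minimal[OF Pid P(2)] bt(1) by blast
            then have "t \<otimes> y \<in> P" using ideal_add_cancel[OF Pid] bt q yc by auto
            then have "t \<in> P" using primeideal.I_prime[OF P(1) bt(2) yc] yP by blast
            then have "y \<otimes> t \<in> C" using C(3) ym by blast
            then have "t \<otimes> y \<in> C" using m_comm[OF bt(2) yc] by simp
            then show "q \<in> C" using bt(1,3) C(2) ideal_add[OF C(1)] by blast
          qed
        qed
        moreover have "Idl I \<subseteq> P" by (rule genideal_minimal[OF Pid P(2)])
        ultimately have "Idl I = P" by blast
        then show False using np P(1) by simp
      qed
      then have "?K \<subseteq> P" using P(2) by (intro genideal_minimal[OF Pid]) simp
      then show "P = ?K" using P(3) by blast
    qed
    have Fv: "?valid F" using Suc.prems by simp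
    \<comment> \<open>The height theorem makes \<open>Suc r\<close> the minimal number of generators
      of \<open>m\<close> modulo \<open>I\<close>; the case of at least two generators ends by
      violating this.\<close>
    have len: "Suc r \<le> card G" if "finite G" "G \<subseteq> carrier R" "m = Idl (G \<union> I)" for G
      by (rule prime_chain_length_le_generators[OF that(1,2) I that(3) ch])
    have cF: "card F = Suc r" using len[of F] Fv by simp
    then obtain y where y: "y \<in> F" by fastforce
    show False
    proof (cases r)
      case 0
      \<comment> \<open>With one generator \<open>m\<close> itself would be minimal over
        \<open>I\<close>, while the chain provides a prime strictly below it.\<close>
      then have "F = {y}" using cF y Fv by (auto simp: card_Suc_eq)
      then have my: "m = Idl (insert y I)" using Fv by simp
      obtain N where "N \<subset> m" "primeideal N R" "I \<subseteq> N" using ch 0 by auto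
      then show False using min[OF Fv y] my by blast
    next
      case (Suc r')
      then have "card (F - {y}) \<noteq> 0" using cF y Fv by simp
      then have "F - {y} \<noteq> {}" using card.empty by metis
      then obtain z where z: "z \<in> F" "z \<noteq> y" by blast
      have yzc: "y \<in> carrier R" "z \<in> carrier R" using y z Fv by auto
      have zm: "z \<in> m" using Fv genideal_self[of "F \<union> I"] I z(1) by blast
      \<comment> \<open>Replacing \<open>y\<close> by \<open>y + z^n\<close> with
        \<open>n > 0\<close> gives another generating set of minimal size, because \<open>z\<close>
        is kept. So every \<open>?K n\<close> is a prime minimal over \<open>I\<close>, and two of
        them coincide.\<close>
      let ?w = "\<lambda>n::nat. y \<oplus> z [^] n"
      let ?K = "\<lambda>n. Idl (insert (?w n) I)"
      let ?F = "\<lambda>n. insert (?w n) (F - {y})"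
      have wc: "?w n \<in> carrier R" for n using yzc by simp
      have genm: "m = Idl (G \<union> I)"
        if G: "G \<subseteq> m" "y \<in> Idl (G \<union> I)" "F - {y} \<subseteq> Idl (G \<union> I)" for G
      proof
        have Gc: "G \<union> I \<subseteq> carrier R" using G(1) ideal.Icarr[OF ideal_m] I by auto
        have id: "ideal (Idl (G \<union> I)) R" by (rule genideal_ideal[OF Gc])
        have "F \<union> I \<subseteq> Idl (G \<union> I)" using G(2,3) genideal_self[OF Gc] by blast
        then show "m \<subseteq> Idl (G \<union> I)" using Fv genideal_minimal[OF id] by simp
        have "I \<subseteq> m" using prime_chain_subset[OF ch] .
        then show "Idl (G \<union> I) \<subseteq> m" using G(1) by (intro genideal_minimal[OF ideal_m]) simp
      qed
      have Fm: "F \<subseteq> m" using Fv genideal_self[of "F \<union> I"] I by blast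
      have wm: "?w n \<in> m" if "0 < n" for n
        using ideal_add[OF ideal_m] ideal_pow_mem[OF ideal_m zm that] Fm y by blast
      have Fn: "?valid (?F n)" if n: "0 < n" for n
      proof (intro conjI)
        show "finite (?F n)" using Fv by simp
        show c: "?F n \<subseteq> carrier R" using Fv wc by auto
        have "card (?F n) \<le> Suc (card (F - {y}))" by (rule card_insert_le_m1) auto
        then show "card (?F n) \<le> Suc r" using cF y Fv by simp
        have Fc: "?F n \<union> I \<subseteq> carrier R" using c I by simp
        have id: "ideal (Idl (?F n \<union> I)) R" by (rule genideal_ideal[OF Fc])
        note self = genideal_self[OF Fc]
        have "z \<in> Idl (?F n \<union> I)" "?w n \<in> Idl (?F n \<union> I)" using self z by auto
        then have "?w n \<ominus> z [^] n \<in> Idl (?F n \<union> I)"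
          using ideal_minus[OF id] ideal_pow_mem[OF id _ n] by blast
        moreover have "?w n \<ominus> z [^] n = y"
        proof -
          have "z [^] n \<in> carrier R" using yzc by simp
          then show ?thesis using yzc(1) by algebra
        qed
        ultimately have "y \<in> Idl (?F n \<union> I)" by simp
        then show "m = Idl (?F n \<union> I)"
          using wm[OF n] Fm self by (intro genm) auto
      qed
      have Kpr: "primeideal (?K n) R" if n: "0 < n" for n
        using min[OF Fn[OF n], of "?w n"] by simp
      have Kmin: "P = ?K n" if n: "0 < n" and P: "primeideal P R" "I \<subseteq> P" "P \<subseteq> ?K n" for n P
        using min[OF Fn[OF n], of "?w n"] P by simp
      obtain G where G: "finite G" "\<forall>P\<in>G. primeideal P R \<and> Idl I \<subseteq> P"
        "\<forall>Q. primeideal Q R \<and> Idl I \<subseteq> Q \<longrightarrow> (\<exists>P\<in>G. P \<subseteq> Q)"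
        using finite_primes_below_ideal[OF Iid] by blast
      have KG: "?K n \<in> G" if n: "0 < n" for n
      proof -
        have "Idl I \<subseteq> ?K n" using wc I by (intro subset_Idl_subset) auto
        then obtain P where P: "P \<in> G" "P \<subseteq> ?K n" using G(3)[rule_format, of "?K n"] Kpr[OF n] by auto
        have Pp: "primeideal P R" "Idl I \<subseteq> P" using G(2) P(1) by auto
        then have "I \<subseteq> P" using genideal_self[OF I] by blast
        then have "P = ?K n" using Pp(1) P(2) by (intro Kmin[OF n])
        then show ?thesis using P(1) by simp
      qed
      then have "?K ` {0<..} \<subseteq> G" by auto
      then have "finite (?K ` {0<..})" using G(1) by (rule finite_subset)
      then have "\<not> inj_on ?K {0<..}" using finite_imageD[of ?K "{0<..}"] infinite_Ioi[of "0::nat"] by metis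
      then obtain n k where nk: "0 < n" "n < k" "?K n = ?K k"
        unfolding inj_on_def by (metis greaterThan_iff nat_neq_iff)
      have Kid: "ideal (?K n) R" by (rule primeideal.axioms(1)[OF Kpr[OF nk(1)]])
      have wself: "?w i \<in> ?K i" for i using genideal_self[of "insert (?w i) I"] wc I by simp
      have w: "?w n \<in> ?K n" "?w k \<in> ?K n" using wself[of n] wself[of k] nk(3) by simp_all
      have Km: "?K n \<subseteq> m"
        using wm[OF nk(1)] prime_chain_subset[OF ch] by (intro genideal_minimal[OF ideal_m]) simp
      \<comment> \<open>The difference of the two elements lies in the common prime and is
        \<open>z^n\<close> times a factor outside it, so the prime contains \<open>z\<close>, and
        then \<open>y\<close>.\<close>
      have "?w n \<ominus> ?w k = z [^] n \<otimes> (\<one> \<ominus> z [^] (k - n))"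
      proof -
        have e: "z [^] k = z [^] n \<otimes> z [^] (k - n)" using nk(2) yzc by (simp add: nat_pow_mult)
        have "z [^] n \<in> carrier R" "z [^] (k - n) \<in> carrier R" using yzc by auto
        then show ?thesis unfolding e using yzc(1) by algebra
      qed
      then have "z [^] n \<otimes> (\<one> \<ominus> z [^] (k - n)) \<in> ?K n" using ideal_minus[OF Kid w] by simp
      moreover have "\<one> \<ominus> z [^] (k - n) \<notin> ?K n"
      proof
        assume "\<one> \<ominus> z [^] (k - n) \<in> ?K n"
        then have "\<one> \<ominus> z [^] (k - n) \<oplus> z [^] (k - n) \<in> m"
          using Km ideal_add[OF ideal_m] ideal_pow_mem[OF ideal_m zm] nk(2) by (meson subsetD zero_less_diff)
        moreover have "\<one> \<ominus> z [^] (k - n) \<oplus> z [^] (k - n) = \<one>"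
        proof -
          have "z [^] (k - n) \<in> carrier R" using yzc by simp
          then show ?thesis by algebra
        qed
        ultimately show False using prime_one_notin[OF prime_m] by simp
      qed
      ultimately have "z [^] n \<in> ?K n"
        using primeideal.I_prime[OF Kpr[OF nk(1)], of "z [^] n" "\<one> \<ominus> z [^] (k - n)"] yzc by auto
      then have zK: "z \<in> ?K n" by (rule prime_pow_mem[OF Kpr[OF nk(1)] yzc(2)])
      have "?w n \<ominus> z [^] n \<in> ?K n" using ideal_minus[OF Kid w(1) \<open>z [^] n \<in> ?K n\<close>] .
      moreover have "?w n \<ominus> z [^] n = y"
      proof -
        have "z [^] n \<in> carrier R" using yzc by simp
        then show ?thesis using yzc(1) by algebra
      qed
      ultimately have yK: "y \<in> ?K n" by simp
      \<comment> \<open>Both \<open>y\<close> and \<open>z\<close> are recovered from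
        \<open>?w n\<close> modulo \<open>I\<close>, so one element replaces two.\<close>
      let ?H = "insert (?w n) (F - {y, z})"
      have Hc: "?H \<union> I \<subseteq> carrier R" using Fv wc I by auto
      have KH: "?K n \<subseteq> Idl (?H \<union> I)" using Hc by (intro subset_Idl_subset) auto
      have "m = Idl (?H \<union> I)"
      proof (rule genm)
        show "?H \<subseteq> m" using wm[OF nk(1)] Fm by auto
        show "y \<in> Idl (?H \<union> I)" using yK KH by blast
        show "F - {y} \<subseteq> Idl (?H \<union> I)" using zK KH genideal_self[OF Hc] by blast
      qed
      then have "Suc r \<le> card ?H" using Fv Hc by (intro len) auto
      moreover have "card ?H \<le> Suc (card (F - {y, z}))" by (rule card_insert_le_m1) auto
      moreover have "card (F - {y, z}) = r - 1" using cF y z Fv by (simp add: card_Diff_subset)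
      ultimately show False using Suc by simp
    qed
  qed
qed

end

text \<open>\<open>chain_A\<close> bounds the height of \<open>m\<close> from below by the number of
  generators. This is regularity without the supremum in \<open>krull_dim\<close>, in a form that
  can be fed to the height theorem.\<close>

locale regular_parameters = local_noetherian_ring +
  fixes A
  assumes A_carrier: "A \<subseteq> carrier R" and finite_A: "finite A" and m_eq: "m = Idl A"
    and chain_A: "prime_chain {} (card A) m"
begin

lemma A_subset_m: "A \<subseteq> m"
  unfolding m_eq by (rule genideal_self[OF A_carrier])

text \<open>Modulo \<open>Y\<close> the remaining parameters generate \<open>m\<close>, and the
  chain loses at most \<open>card Y\<close> steps. So the quotient is again regular, and regular
  local rings are domains.\<close>

lemma primeideal_Idl_parameters:
  assumes "Y \<subseteq> A"
  shows "primeideal (Idl Y) R"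
proof (rule primeideal_Idl_of_chain[of _ "A - Y"])
  have fY: "finite Y" using assms finite_A finite_subset by blast
  have "prime_chain (Y \<union> {}) (card A - card Y) m"
    using assms A_subset_m card_mono[OF finite_A] by (intro prime_chain_union fY chain_A) auto
  then show "prime_chain Y (card A - card Y) m" by simp
  show "card (A - Y) \<le> card A - card Y" using card_Diff_subset[OF fY assms] by simp
  have "A - Y \<union> Y = A" using assms by blast
  then show "m = Idl (A - Y \<union> Y)" using m_eq by simp
qed (use assms A_carrier finite_A in auto)

text \<open>Otherwise the parameters other than \<open>a\<close> would generate \<open>m\<close>,
  and these are fewer than the length of \<open>chain_A\<close> allows.\<close>

lemma parameter_notin_Idl:
  assumes "Y \<subseteq> A" "a \<in> A" "a \<notin> Y"
  shows "a \<notin> Idl Y"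
proof
  assume a: "a \<in> Idl Y"
  let ?B = "A - {a}"
  have Bc: "?B \<subseteq> carrier R" using A_carrier by blast
  have "Idl Y \<subseteq> Idl ?B" using assms by (intro subset_Idl_subset[OF Bc]) blast
  then have "A \<subseteq> Idl ?B" using a genideal_self[OF Bc] by blast
  then have "m \<subseteq> Idl ?B" unfolding m_eq by (rule genideal_minimal[OF genideal_ideal[OF Bc]])
  moreover have "Idl ?B \<subseteq> m" unfolding m_eq by (rule subset_Idl_subset[OF A_carrier]) blast
  ultimately have "m = Idl (?B \<union> {})" by simp
  then have "card A \<le> card ?B"
    using finite_A Bc by (intro prime_chain_length_le_generators[OF _ _ _ _ chain_A]) auto
  moreover have "card ?B < card A" using assms(2) finite_A by (meson card_Diff1_less)
  ultimately show False by simp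
qed

text \<open>An exponent \<open>j + 1 > 1\<close> is lowered using the filtration
  \<open>(y\<^sup>j\<^sup>+\<^sup>1) \<subseteq> (y)\<close> with quotient isomorphic to the quotient by \<open>(y\<^sup>j)\<close>; with all exponents 1 the ideal is prime.\<close>

lemma parameter_nonzerodivisor:
  assumes "Y \<subseteq> A" "\<And>y. y \<in> Y \<Longrightarrow> 0 < k y" "a \<in> A" "a \<notin> Y" "r \<in> carrier R"
    and "a \<otimes> r \<in> Idl ((\<lambda>y. y [^] (k y :: nat)) ` Y)"
  shows "r \<in> Idl ((\<lambda>y. y [^] k y) ` Y)"
  using assms
proof (induction "sum k Y" arbitrary: Y k a r rule: less_induct)
  case less
  have Yc: "Y \<subseteq> carrier R" using less.prems(1) A_carrier by blast
  have fY: "finite Y" using less.prems(1) finite_A finite_subset by blast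
  have ac: "a \<in> carrier R" using less.prems(3) A_carrier by blast
  note rc = less.prems(5)
  show ?case
  proof (cases "\<forall>y\<in>Y. k y = 1")
    case True
    then have "(\<lambda>y. y [^] k y) ` Y = Y" using Yc by (force simp: image_iff)
    then have "a \<otimes> r \<in> Idl Y" "a \<notin> Idl Y"
      using less.prems parameter_notin_Idl by auto
    then have "r \<in> Idl Y" using primeideal.I_prime[OF primeideal_Idl_parameters[OF less.prems(1)] ac rc] by blast
    then show ?thesis using \<open>(\<lambda>y. y [^] k y) ` Y = Y\<close> by simp
  next
    case False
    then obtain z where z: "z \<in> Y" "k z \<noteq> 1" by blast
    then obtain j where j: "k z = Suc j" "0 < j"
      using less.prems(2)[OF z(1)] by (metis One_nat_def Suc_pred neq0_conv)
    have zc: "z \<in> carrier R" using z Yc by blast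
    let ?Z = "Y - {z}"
    let ?P = "\<lambda>k. (\<lambda>y. y [^] (k y :: nat)) ` Y"
    let ?J = "(\<lambda>y. y [^] k y) ` ?Z"
    have Jc: "?J \<subseteq> carrier R" using Yc by auto
    have P: "?P (k(z := i)) = insert (z [^] i) ?J" for i
    proof -
      have "?P (k(z := i)) = (\<lambda>y. y [^] ((k(z := i)) y)) ` insert z ?Z"
        using z(1) by (simp add: insert_absorb)
      also have "\<dots> = insert (z [^] i) ((\<lambda>y. y [^] ((k(z := i)) y)) ` ?Z)"
        by (simp only: image_insert fun_upd_same)
      also have "(\<lambda>y. y [^] ((k(z := i)) y)) ` ?Z = ?J" by (rule image_cong) auto
      finally show ?thesis .
    qed
    have "k(z := Suc j) = k" using j(1) by auto
    then have Pk: "?P k = insert (z [^] Suc j) ?J" using P[of "Suc j"] by metis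
    have Jid: "ideal (Idl ?J) R" by (rule genideal_ideal[OF Jc])
    have sumZ: "sum k Y = k z + sum k ?Z" using z(1) fY by (simp add: sum.remove)
    have sumu: "sum (k(z := i)) Y = i + sum k ?Z" for i
      using z(1) fY by (simp add: sum.remove)
    have zp: "z [^] i \<in> carrier R" for i :: nat using zc by simp
    obtain c s where cs: "c \<in> Idl ?J" "s \<in> carrier R" "a \<otimes> r = c \<oplus> s \<otimes> z [^] Suc j"
      using less.prems(6) unfolding Pk Idl_insert_iff[OF Jc zp] by blast
    have cc: "c \<in> carrier R" using ideal.Icarr[OF Jid cs(1)] .
    have "a \<otimes> r = c \<oplus> (s \<otimes> z [^] j) \<otimes> z [^] (1::nat)" using cs zc by (simp add: m_assoc)
    then have "a \<otimes> r \<in> Idl (?P (k(z := 1)))"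
      unfolding P Idl_insert_iff[OF Jc zp] using cs zp by blast
    have "r \<in> Idl (?P (k(z := 1)))"
    proof (rule less.hyps[of "k(z := 1)" Y a])
      show "sum (k(z := 1)) Y < sum k Y" unfolding sumu sumZ using j by simp
      show "0 < (k(z := 1)) y" if "y \<in> Y" for y using less.prems(2)[OF that] by simp
      show "a \<otimes> r \<in> Idl (?P (k(z := 1)))" by fact
    qed (fact less.prems)+
    then obtain c' s' where "c' \<in> Idl ?J" "s' \<in> carrier R" "r = c' \<oplus> s' \<otimes> z [^] (1::nat)"
      unfolding P Idl_insert_iff[OF Jc zp] by blast
    then have cs': "c' \<in> Idl ?J" "s' \<in> carrier R" "r = c' \<oplus> s' \<otimes> z" using zc by simp_all
    have c'c: "c' \<in> carrier R" using ideal.Icarr[OF Jid cs'(1)] .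
    \<comment> \<open>Substituting \<open>r = c' + s' z\<close> into
      \<open>a r = c + s z^(j+1)\<close> leaves a multiple of \<open>z\<close> in
      \<open>Idl ?J\<close>. The induction hypothesis cancels \<open>z\<close>, in the role of
      \<open>a\<close>, because \<open>?Z\<close> omits it. This puts \<open>a s'\<close> into the
      ideal with exponent \<open>j\<close> at \<open>z\<close>.\<close>
    have "z \<otimes> (a \<otimes> s' \<ominus> s \<otimes> z [^] j) = a \<otimes> r \<ominus> s \<otimes> z [^] Suc j \<ominus> a \<otimes> c'"
    proof -
      have e: "z [^] Suc j = z [^] j \<otimes> z" by simp
      show ?thesis unfolding e cs'(3) using zp[of j] zc ac c'c cs(2) cs'(2) by algebra
    qed
    also have "\<dots> = c \<ominus> a \<otimes> c'" unfolding cs(3) using cc c'c cs(2) zp[of "Suc j"] ac by algebra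
    also have "\<dots> \<in> Idl ?J"
      using ideal_minus[OF Jid cs(1)] ideal.I_l_closed[OF Jid cs'(1) ac] by blast
    finally have zJ: "z \<otimes> (a \<otimes> s' \<ominus> s \<otimes> z [^] j) \<in> Idl ?J" .
    have "a \<otimes> s' \<ominus> s \<otimes> z [^] j \<in> Idl ?J"
    proof (rule less.hyps[of k ?Z z])
      show "sum k ?Z < sum k Y" unfolding sumZ using j by simp
      show "a \<otimes> s' \<ominus> s \<otimes> z [^] j \<in> carrier R" using ac cs(2) cs'(2) zp by simp
      show "0 < k y" if "y \<in> ?Z" for y using less.prems(2) that by simp
    qed (use less.prems(1) z(1) zJ in auto)
    moreover have "a \<otimes> s' = (a \<otimes> s' \<ominus> s \<otimes> z [^] j) \<oplus> s \<otimes> z [^] j"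
      using ac cs(2) cs'(2) zp[of j] by algebra
    ultimately have "a \<otimes> s' \<in> Idl (?P (k(z := j)))"
      unfolding P Idl_insert_iff[OF Jc zp] using cs(2) by blast
    have "s' \<in> Idl (?P (k(z := j)))"
    proof (rule less.hyps[of "k(z := j)" Y a])
      show "sum (k(z := j)) Y < sum k Y" unfolding sumu sumZ using j by simp
      show "0 < (k(z := j)) y" if "y \<in> Y" for y using less.prems(2)[OF that] j by simp
      show "a \<otimes> s' \<in> Idl (?P (k(z := j)))" by fact
    qed (fact less.prems cs'(2))+
    then obtain c'' s'' where cs'': "c'' \<in> Idl ?J" "s'' \<in> carrier R" "s' = c'' \<oplus> s'' \<otimes> z [^] j"
      unfolding P Idl_insert_iff[OF Jc zp] by blast
    have c''c: "c'' \<in> carrier R" using ideal.Icarr[OF Jid cs''(1)] .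
    have "r = (c' \<oplus> z \<otimes> c'') \<oplus> s'' \<otimes> z [^] Suc j"
    proof -
      have e: "z [^] Suc j = z [^] j \<otimes> z" by simp
      show ?thesis unfolding cs'(3) cs''(3) e using zp[of j] zc c'c c''c cs''(2) by algebra
    qed
    moreover have "c' \<oplus> z \<otimes> c'' \<in> Idl ?J"
      using ideal_add[OF Jid cs'(1)] ideal.I_l_closed[OF Jid cs''(1) zc] by blast
    ultimately show ?thesis unfolding Pk Idl_insert_iff[OF Jc zp] using cs''(2) by blast
  qed
qed

end

text \<open>An infinite set of naturals has infinite supremum in \<open>enat\<close>, so a finite
  value is a maximum. Nonemptiness excludes the default value 0 of the empty supremum.\<close>

lemma Sup_enat_attained:
  assumes "Sup (enat ` S) = enat d" "S \<noteq> {}"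
  shows "d \<in> S"
proof -
  have ne: "enat ` S \<noteq> {}" using assms(2) by simp
  have fin: "finite (enat ` S)" using assms(1) ne unfolding Sup_enat_def by (auto split: if_splits)
  then have "Sup (enat ` S) = Max (enat ` S)" using ne by (simp add: Sup_enat_def)
  then have "enat d \<in> enat ` S" using Max_in[OF fin ne] assms(1) by simp
  then show ?thesis by auto
qed

lemma (in cring) prime_chain_top_mono:
  assumes "prime_chain I n N" "N \<subseteq> N'" "primeideal N' R"
  shows "prime_chain I n N'"
proof (cases n)
  case 0
  then show ?thesis using assms by auto
next
  case (Suc k)
  then obtain K where "K \<subset> N" "prime_chain I k K" using assms(1) unfolding Suc prime_chain.simps by blast
  then show ?thesis unfolding Suc prime_chain.simps using assms(2,3) by blast
qed

lemma regular_local_ring_parameters: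
  assumes "regular_local_ring R"
  shows "\<exists>m A. regular_parameters R m A"
proof -
  obtain m A where R: "cring R" "noetherian_ring R" and um: "{I. maximalideal I R} = {m}"
    and A: "A \<subseteq> carrier R" "finite A" "m = genideal R A" "enat (card A) = krull_dim R"
    using assms unfolding regular_local_ring_def by blast
  interpret local_noetherian_ring R m
    by (intro local_noetherian_ring.intro noetherian_cring.intro local_noetherian_ring_axioms.intro R um)
  define D where "D = {n. \<exists>P :: nat \<Rightarrow> 'a set. (\<forall>i\<le>n. primeideal (P i) R) \<and> (\<forall>i<n. P i \<subset> P (Suc i))}"
  have "krull_dim R = Sup (enat ` D)"
    unfolding krull_dim_def D_def setcompr_eq_image ..
  then have "Sup (enat ` D) = enat (card A)" using A(4) by simp
  moreover have "0 \<in> D"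
    unfolding D_def by (intro CollectI exI[of _ "\<lambda>_. m"] conjI) (simp_all add: prime_m)
  then have "D \<noteq> {}" by blast
  ultimately have "card A \<in> D" by (rule Sup_enat_attained)
  then obtain P :: "nat \<Rightarrow> 'a set" where P: "\<forall>i\<le>card A. primeideal (P i) R" "\<forall>i<card A. P i \<subset> P (Suc i)"
    unfolding D_def mem_Collect_eq by (elim exE conjE)
  have "prime_chain {} i (P i)" if "i \<le> card A" for i
    using that
  proof (induction i)
    case 0 then show ?case using P(1) by simp
  next
    case (Suc i)
    then have "prime_chain {} i (P i)" "P i \<subset> P (Suc i)" "primeideal (P (Suc i)) R" using P by auto
    then show ?case unfolding prime_chain.simps by blast
  qed
  then have "prime_chain {} (card A) (P (card A))" by simp
  \<comment> \<open>The chain that attains the dimension is not known to end in \<open>m\<close>;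
    enlarging its top to \<open>m\<close> keeps the inclusions strict.\<close>
  moreover have "P (card A) \<subseteq> m"
    using P(1) prime_one_notin by (intro ideal_subset_m primeideal.axioms(1)) auto
  ultimately have "prime_chain {} (card A) m" using prime_chain_top_mono prime_m by blast
  then have "regular_parameters R m A"
    by (intro regular_parameters.intro regular_parameters_axioms.intro local_noetherian_ring_axioms A)
  then show ?thesis by blast
qed

section \<open>The Frobenius morphism\<close>

context cring
begin

lemma binomial_expansion:
  fixes n :: nat
  assumes a: "a \<in> carrier R" and b: "b \<in> carrier R"
  shows "(a \<oplus> b) [^] n = (\<Oplus>k\<in>{..n}. add_pow R (n choose k) (a [^] k \<otimes> b [^] (n - k)))"
proof (induction n)
  case 0
  have "(\<Oplus>k\<in>{..0}. add_pow R (0 choose k) (a [^] k \<otimes> b [^] (0 - k)))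
      = add_pow R (0 choose 0) (a [^] (0::nat) \<otimes> b [^] (0 - 0 :: nat))"
    by (rule finsum_0[where f="\<lambda>k. add_pow R (0 choose k) (a [^] k \<otimes> b [^] (0 - k))"]) (use a b in auto)
  then show ?case by simp
next
  case (Suc n)
  let ?T = "\<lambda>n k. add_pow R (n choose k) (a [^] k \<otimes> b [^] (n - k))"
  let ?U = "\<lambda>k. add_pow R (n choose k) (a [^] k \<otimes> b [^] (Suc n - k))"
  have c: "?T n k \<in> carrier R" "?U k \<in> carrier R" for n k using a b by auto
  have aT: "a \<otimes> ?T n k = add_pow R (n choose k) (a [^] Suc k \<otimes> b [^] (n - k))" for k
  proof -
    have "a \<otimes> ?T n k = add_pow R (n choose k) (a \<otimes> (a [^] k \<otimes> b [^] (n - k)))"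
      using a b by (simp only: add_pow_rdistr m_closed nat_pow_closed)
    also have "a \<otimes> (a [^] k \<otimes> b [^] (n - k)) = a [^] Suc k \<otimes> b [^] (n - k)"
      using a b by (simp only: nat_pow_Suc2 m_assoc nat_pow_closed)
    finally show ?thesis .
  qed
  have bT: "b \<otimes> ?T n k = ?U k" if "k \<le> n" for k
  proof -
    have "b \<otimes> ?T n k = add_pow R (n choose k) (b \<otimes> (a [^] k \<otimes> b [^] (n - k)))"
      using a b by (simp only: add_pow_rdistr m_closed nat_pow_closed)
    also have "b \<otimes> (a [^] k \<otimes> b [^] (n - k)) = a [^] k \<otimes> (b \<otimes> b [^] (n - k))"
      using a b by (simp only: m_lcomm nat_pow_closed)
    also have "b \<otimes> b [^] (n - k) = b [^] (Suc n - k)"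
      using b that by (simp only: Suc_diff_le nat_pow_Suc2)
    finally show ?thesis .
  qed
  have TS: "?T (Suc n) (Suc k) = a \<otimes> ?T n k \<oplus> ?U (Suc k)" for k
    unfolding aT binomial_Suc_Suc diff_Suc_Suc
    using a b by (simp only: add.nat_pow_mult m_closed nat_pow_closed)
  have "(a \<oplus> b) [^] Suc n = (a \<oplus> b) \<otimes> (\<Oplus>k\<in>{..n}. ?T n k)"
    unfolding nat_pow_Suc2[OF a_closed[OF a b]] Suc.IH by simp
  also have "\<dots> = (\<Oplus>k\<in>{..n}. a \<otimes> ?T n k) \<oplus> (\<Oplus>k\<in>{..n}. b \<otimes> ?T n k)"
  proof -
    have "(\<Oplus>k\<in>{..n}. ?T n k) \<in> carrier R" using c by (intro finsum_closed) auto
    then have "(a \<oplus> b) \<otimes> (\<Oplus>k\<in>{..n}. ?T n k)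
        = a \<otimes> (\<Oplus>k\<in>{..n}. ?T n k) \<oplus> b \<otimes> (\<Oplus>k\<in>{..n}. ?T n k)"
      using a b by (intro l_distr)
    also have "a \<otimes> (\<Oplus>k\<in>{..n}. ?T n k) = (\<Oplus>k\<in>{..n}. a \<otimes> ?T n k)"
      using a c by (intro finsum_rdistr) auto
    also have "b \<otimes> (\<Oplus>k\<in>{..n}. ?T n k) = (\<Oplus>k\<in>{..n}. b \<otimes> ?T n k)"
      using b c by (intro finsum_rdistr) auto
    finally show ?thesis .
  qed
  also have "(\<Oplus>k\<in>{..n}. b \<otimes> ?T n k) = (\<Oplus>k\<in>{..n}. ?U k)"
    using bT c by (intro finsum_cong') auto
  also have "\<dots> = (\<Oplus>k\<in>{..Suc n}. ?U k)"
  proof -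
    have "?U (Suc n) = \<zero>" by (simp add: binomial_eq_0)
    moreover have "(\<Oplus>k\<in>{..Suc n}. ?U k) = ?U (Suc n) \<oplus> (\<Oplus>k\<in>{..n}. ?U k)"
      by (rule finsum_Suc[where f="?U"]) (use c in blast)
    moreover have "(\<Oplus>k\<in>{..n}. ?U k) \<in> carrier R" using c by (intro finsum_closed) auto
    ultimately show ?thesis by simp
  qed
  also have "\<dots> = (\<Oplus>k\<in>{..n}. ?U (Suc k)) \<oplus> ?U 0"
    by (rule finsum_Suc2[where f="?U"]) (use c in blast)
  also have "(\<Oplus>k\<in>{..n}. a \<otimes> ?T n k) \<oplus> ((\<Oplus>k\<in>{..n}. ?U (Suc k)) \<oplus> ?U 0)
      = (\<Oplus>k\<in>{..n}. a \<otimes> ?T n k \<oplus> ?U (Suc k)) \<oplus> ?U 0"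
  proof -
    have 1: "(\<lambda>k. a \<otimes> ?T n k) \<in> {..n} \<rightarrow> carrier R" "(\<lambda>k. ?U (Suc k)) \<in> {..n} \<rightarrow> carrier R"
      by (intro Pi_I m_closed a c)+
    show ?thesis
      unfolding finsum_addf[OF 1] by (rule a_assoc[symmetric]) (intro finsum_closed 1 c)+
  qed
  also have "\<dots> = (\<Oplus>k\<in>{..n}. ?T (Suc n) (Suc k)) \<oplus> ?T (Suc n) 0"
    unfolding TS by (simp only: binomial_n_0 diff_zero)
  also have "\<dots> = (\<Oplus>k\<in>{..Suc n}. ?T (Suc n) k)"
    by (rule finsum_Suc2[symmetric, where f="?T (Suc n)"]) (use c in blast)
  finally show ?case .
qed

end

text \<open>\<open>char_p\<close> asks for \<open>p 1 = 0\<close>, a condition that ring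
  homomorphisms transport, in particular the one to a localization.\<close>

locale noetherian_char_p_ring = noetherian_cring +
  fixes p :: nat
  assumes prime_p: "Factorial_Ring.prime p" and char_p: "add_pow R p \<one> = \<zero>"
begin

lemma p_gt_1: "1 < p" using prime_p prime_gt_1_nat by blast

lemma add_pow_multiple_p:
  assumes "x \<in> carrier R" "p dvd n"
  shows "add_pow R n x = \<zero>"
proof -
  obtain k where n: "n = p * k" using assms(2) by auto
  have "add_pow R p x = add_pow R p \<one> \<otimes> x" using assms(1) by (simp add: add_pow_ldistr)
  then have "add_pow R p x = \<zero>" using char_p assms(1) by simp
  then show ?thesis unfolding n using assms(1) by (simp flip: add.nat_pow_pow)
qed

lemma frobenius_add:
  assumes a: "a \<in> carrier R" and b: "b \<in> carrier R"
  shows "(a \<oplus> b) [^] p = a [^] p \<oplus> b [^] p"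
proof -
  let ?T = "\<lambda>k. add_pow R (p choose k) (a [^] k \<otimes> b [^] (p - k))"
  have c: "?T k \<in> carrier R" for k using a b by auto
  obtain q where q: "p = Suc (Suc q)" using less_imp_Suc_add[OF p_gt_1] by auto
  have z: "?T k = \<zero>" if "0 < k" "k < p" for k
    by (rule add_pow_multiple_p) (use that a b prime_p dvd_choose_prime[of k p] in auto)
  have "(\<Oplus>k\<in>{..Suc (Suc q)}. f k) = f (Suc (Suc q)) \<oplus> f 0"
    if f: "\<And>k. f k \<in> carrier R" "\<And>k. 0 < k \<Longrightarrow> k < Suc (Suc q) \<Longrightarrow> f k = \<zero>" for f
  proof -
    have "(\<Oplus>k\<in>{..q}. f (Suc k)) = \<zero>" using f(2) by (intro add.finprod_one_eqI) auto
    moreover have "(\<Oplus>k\<in>{..Suc q}. f k) = (\<Oplus>k\<in>{..q}. f (Suc k)) \<oplus> f 0"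
      using f(1) by (intro finsum_Suc2) blast
    moreover have "(\<Oplus>k\<in>{..Suc (Suc q)}. f k) = f (Suc (Suc q)) \<oplus> (\<Oplus>k\<in>{..Suc q}. f k)"
      using f(1) by (intro finsum_Suc) blast
    ultimately show ?thesis using f(1) by simp
  qed
  from this[of ?T, folded q, OF c z] have "(\<Oplus>k\<in>{..p}. ?T k) = ?T p \<oplus> ?T 0" .
  also have "\<dots> = a [^] p \<oplus> b [^] p" using a b by simp
  finally show ?thesis unfolding binomial_expansion[OF a b] .
qed

lemma frobenius_zero: "\<zero> [^] p = \<zero>"
  using p_gt_1 by (simp add: nat_pow_zero)

lemma ideal_frobenius_preimage:
  assumes "ideal I R"
  shows "ideal {v \<in> carrier R. v [^] p \<in> I} R"
proof (rule ideal_from_closure)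
  show "\<zero> \<in> {v \<in> carrier R. v [^] p \<in> I}" using ideal_zero[OF assms] frobenius_zero by simp
qed (use assms in \<open>auto simp: frobenius_add ideal_add nat_pow_distrib ideal.I_l_closed\<close>)

text \<open>Linear combinations in \<open>R\<close> viewed as a module over itself through
  Frobenius. The vectors form an indexed family because distinct generators may have the same image
  in a localization.\<close>

definition p_comb :: "'i set \<Rightarrow> ('i \<Rightarrow> 'a) \<Rightarrow> ('i \<Rightarrow> 'a) \<Rightarrow> 'a" where
  "p_comb L x c = (\<Oplus>l\<in>L. c l [^] p \<otimes> x l)"

definition p_generates :: "'i set \<Rightarrow> ('i \<Rightarrow> 'a) \<Rightarrow> bool" where
  "p_generates L x \<longleftrightarrow> (\<forall>s\<in>carrier R. \<exists>c\<in>L \<rightarrow> carrier R. s = p_comb L x c)"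

context
  fixes L :: "'i set" and x :: "'i \<Rightarrow> 'a"
  assumes x: "x \<in> L \<rightarrow> carrier R"
begin

lemma p_comb_closed: "c \<in> L \<rightarrow> carrier R \<Longrightarrow> p_comb L x c \<in> carrier R"
  unfolding p_comb_def using x by (intro finsum_closed) (auto simp: Pi_iff)

lemma p_comb_add:
  assumes "c \<in> L \<rightarrow> carrier R" "d \<in> L \<rightarrow> carrier R"
  shows "p_comb L x (\<lambda>l. c l \<oplus> d l) = p_comb L x c \<oplus> p_comb L x d"
proof -
  have "p_comb L x (\<lambda>l. c l \<oplus> d l) = (\<Oplus>l\<in>L. c l [^] p \<otimes> x l \<oplus> d l [^] p \<otimes> x l)"
    unfolding p_comb_def
    using assms x by (intro finsum_cong') (auto simp: Pi_iff frobenius_add l_distr)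
  also have "\<dots> = p_comb L x c \<oplus> p_comb L x d"
    unfolding p_comb_def using assms x by (intro finsum_addf) (auto simp: Pi_iff)
  finally show ?thesis .
qed

lemma p_comb_smult:
  assumes "c \<in> L \<rightarrow> carrier R" "u \<in> carrier R" "finite L"
  shows "p_comb L x (\<lambda>l. u \<otimes> c l) = u [^] p \<otimes> p_comb L x c"
proof -
  have "p_comb L x (\<lambda>l. u \<otimes> c l) = (\<Oplus>l\<in>L. u [^] p \<otimes> (c l [^] p \<otimes> x l))"
    unfolding p_comb_def
    using assms x by (intro finsum_cong') (auto simp: Pi_iff nat_pow_distrib m_assoc)
  also have "\<dots> = u [^] p \<otimes> p_comb L x c"
    unfolding p_comb_def using assms x by (intro finsum_rdistr[symmetric]) (auto simp: Pi_iff)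
  finally show ?thesis .
qed

lemma p_comb_minus:
  assumes "c \<in> L \<rightarrow> carrier R" "d \<in> L \<rightarrow> carrier R"
  shows "p_comb L x (\<lambda>l. c l \<ominus> d l) = p_comb L x c \<ominus> p_comb L x d"
proof -
  have cd: "(\<lambda>l. c l \<ominus> d l) \<in> L \<rightarrow> carrier R" using assms by (auto simp: Pi_iff)
  have "p_comb L x (\<lambda>l. (c l \<ominus> d l) \<oplus> d l) = p_comb L x c"
    unfolding p_comb_def
  proof (rule finsum_cong')
    fix l assume "l \<in> L"
    then have "c l \<in> carrier R" "d l \<in> carrier R" using assms by (auto simp: Pi_iff)
    then have "(c l \<ominus> d l) \<oplus> d l = c l" by algebra
    then show "((c l \<ominus> d l) \<oplus> d l) [^] p \<otimes> x l = c l [^] p \<otimes> x l" by simp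
  qed (use assms x in \<open>auto simp: Pi_iff\<close>)
  then have "p_comb L x (\<lambda>l. c l \<ominus> d l) \<oplus> p_comb L x d = p_comb L x c"
    using p_comb_add[OF cd assms(2)] by simp
  then have "p_comb L x c \<ominus> p_comb L x d = (p_comb L x (\<lambda>l. c l \<ominus> d l) \<oplus> p_comb L x d) \<ominus> p_comb L x d"
    by simp
  also have "\<dots> = p_comb L x (\<lambda>l. c l \<ominus> d l)"
    using p_comb_closed[OF cd] p_comb_closed[OF assms(2)]
    by (simp add: a_minus_def a_assoc r_neg)
  finally show ?thesis by simp
qed

lemma p_comb_cong:
  assumes "\<And>l. l \<in> L \<Longrightarrow> c l = d l" "d \<in> L \<rightarrow> carrier R"
  shows "p_comb L x c = p_comb L x d"
  unfolding p_comb_def using assms x by (intro finsum_cong') (auto simp: Pi_iff)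

lemma p_comb_in_ideal:
  assumes I: "ideal I R" and c: "\<And>l. l \<in> L \<Longrightarrow> c l [^] p \<in> I"
  shows "p_comb L x c \<in> I"
  unfolding p_comb_def
  using c x by (intro ideal_finsum[OF I]) (auto simp: Pi_iff intro!: ideal.I_r_closed[OF I])

text \<open>If \<open>t\<close> is the combination with coefficients \<open>b\<close>, then
  \<open>u^p t\<close> is the one with coefficients \<open>u b\<close>. So an element of the
  Frobenius power of \<open>J\<close> has some coefficient vector in \<open>J\<close>; before
  independence is known, other vectors of the same element may lie outside.\<close>

lemma p_comb_coefficients:
  assumes gen: "p_generates L x" and L: "finite L"
    and J: "ideal J R" and w: "w \<in> Idl ((\<lambda>u. u [^] p) ` J)"
  obtains c where "c \<in> L \<rightarrow> J" "w = p_comb L x c"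
proof -
  let ?K = "{w. \<exists>c\<in>L \<rightarrow> J. w = p_comb L x c}"
  have Jc: "c \<in> L \<rightarrow> carrier R" if "c \<in> L \<rightarrow> J" for c
    using that ideal.Icarr[OF J] by (auto simp: Pi_iff)
  have K0: "\<zero> \<in> ?K"
  proof -
    have "p_comb L x (\<lambda>_. \<zero>) = \<zero>"
      unfolding p_comb_def using x by (intro add.finprod_one_eqI) (auto simp: frobenius_zero Pi_iff)
    then show ?thesis using ideal_zero[OF J] by (intro CollectI bexI[of _ "\<lambda>_. \<zero>"]) auto
  qed
  have Kadd: "a \<oplus> b \<in> ?K" if ab: "a \<in> ?K" "b \<in> ?K" for a b
  proof -
    obtain c d where cd: "c \<in> L \<rightarrow> J" "a = p_comb L x c" "d \<in> L \<rightarrow> J" "b = p_comb L x d"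
      using ab by auto
    then have "a \<oplus> b = p_comb L x (\<lambda>l. c l \<oplus> d l)" using p_comb_add[OF Jc Jc] by simp
    moreover have "(\<lambda>l. c l \<oplus> d l) \<in> L \<rightarrow> J" using cd ideal_add[OF J] by (auto simp: Pi_iff)
    ultimately show ?thesis by blast
  qed
  have Kpow: "u [^] p \<otimes> t \<in> ?K" if u: "u \<in> J" and t: "t \<in> carrier R" for u t
  proof -
    obtain b where b: "b \<in> L \<rightarrow> carrier R" "t = p_comb L x b"
      using gen t unfolding p_generates_def by blast
    have uc: "u \<in> carrier R" using ideal.Icarr[OF J u] .
    have "u [^] p \<otimes> t = p_comb L x (\<lambda>l. u \<otimes> b l)" using p_comb_smult[OF b(1) uc L] b(2) by simp
    moreover have "(\<lambda>l. u \<otimes> b l) \<in> L \<rightarrow> J" using b(1) ideal.I_r_closed[OF J u] by (auto simp: Pi_iff)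
    ultimately show ?thesis by blast
  qed
  have Kc: "?K \<subseteq> carrier R" using p_comb_closed Jc by auto
  have Ksum: "(\<Oplus>l\<in>L'. f l) \<in> ?K" if "finite L'" "\<And>l. l \<in> L' \<Longrightarrow> f l \<in> ?K" for f and L' :: "'i set"
    using that
  proof (induction L' rule: finite_induct)
    case empty
    show ?case unfolding finsum_empty by (rule K0)
  next
    case (insert i F)
    then have "f \<in> F \<rightarrow> carrier R" "f i \<in> carrier R" using Kc by auto
    then have "(\<Oplus>l\<in>insert i F. f l) = f i \<oplus> (\<Oplus>l\<in>F. f l)"
      using insert.hyps by (intro finsum_insert)
    also have "\<dots> \<in> ?K" using insert by (intro Kadd) auto
    finally show ?case .
  qed
  have "ideal ?K R"
  proof (rule ideal_from_closure[OF Kc K0 Kadd])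
    fix a s assume "a \<in> ?K" and s: "s \<in> carrier R"
    then obtain c where c: "c \<in> L \<rightarrow> J" "a = p_comb L x c" by blast
    have "s \<otimes> a = (\<Oplus>l\<in>L. s \<otimes> (c l [^] p \<otimes> x l))"
      unfolding c(2) p_comb_def using L s Jc[OF c(1)] x by (intro finsum_rdistr) (auto simp: Pi_iff)
    also have "\<dots> = (\<Oplus>l\<in>L. c l [^] p \<otimes> (s \<otimes> x l))"
      using s Jc[OF c(1)] x by (intro finsum_cong') (auto simp: Pi_iff m_lcomm)
    also have "\<dots> \<in> ?K" using c(1) s x by (intro Ksum[OF L] Kpow) (auto simp: Pi_iff)
    finally show "s \<otimes> a \<in> ?K" .
  qed
  moreover have "(\<lambda>u. u [^] p) ` J \<subseteq> ?K"
  proof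
    fix v assume "v \<in> (\<lambda>u. u [^] p) ` J"
    then obtain u where u: "u \<in> J" "v = u [^] p" by blast
    then show "v \<in> ?K" using Kpow[OF u(1), of \<one>] ideal.Icarr[OF J u(1)] by simp
  qed
  ultimately have "Idl ((\<lambda>u. u [^] p) ` J) \<subseteq> ?K" by (rule genideal_minimal)
  then show ?thesis using w that by blast
qed

end

end

section \<open>Freeness of Frobenius over a regular local ring\<close>

locale regular_char_p_parameters = regular_parameters R m A + noetherian_char_p_ring R p
  for R (structure) and m A p
begin

lemma pow_p_mem_Idl:
  assumes "Y \<subseteq> carrier R" "v \<in> Idl Y"
  shows "v [^] p \<in> Idl ((\<lambda>y. y [^] p) ` Y)"
proof -
  let ?I = "Idl ((\<lambda>y. y [^] p) ` Y)"
  have c: "(\<lambda>y. y [^] p) ` Y \<subseteq> carrier R" using assms(1) by auto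
  have "Idl Y \<subseteq> {v \<in> carrier R. v [^] p \<in> ?I}"
    using assms(1) genideal_self[OF c]
    by (intro genideal_minimal ideal_frobenius_preimage genideal_ideal c) auto
  then show ?thesis using assms(2) by blast
qed

lemma parameter_power_nonzerodivisor:
  assumes "Y \<subseteq> A" "a \<in> A" "a \<notin> Y" "r \<in> carrier R" "a [^] (j::nat) \<otimes> r \<in> Idl ((\<lambda>y. y [^] p) ` Y)"
  shows "r \<in> Idl ((\<lambda>y. y [^] p) ` Y)"
  using assms(5)
proof (induction j)
  case 0
  then show ?case using assms(4) by simp
next
  case (Suc j)
  have ac: "a \<in> carrier R" using assms(2) A_carrier by blast
  have "a [^] Suc j \<otimes> r = a \<otimes> (a [^] j \<otimes> r)"
    using ac assms(4) by (simp only: nat_pow_Suc2 m_assoc nat_pow_closed)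
  then have "a \<otimes> (a [^] j \<otimes> r) \<in> Idl ((\<lambda>y. y [^] p) ` Y)" using Suc.prems by simp
  then have "a [^] j \<otimes> r \<in> Idl ((\<lambda>y. y [^] p) ` Y)"
    by (rule parameter_nonzerodivisor[where k="\<lambda>_. p", OF assms(1) _ assms(2,3), rotated 2])
      (use p_gt_1 ac assms(4) in auto)
  then show ?case by (rule Suc.IH)
qed

text \<open>Descent from all of \<open>A\<close> to the empty set, one parameter \<open>a\<close> at a time: the coefficients of
  the relations modulo \<open>Y\<close> form an ideal \<open>K\<close> with \<open>K \<subseteq> Idl Y + a K\<close>.\<close>

lemma p_comb_descent:
  assumes L: "finite L" and x: "x \<in> L \<rightarrow> carrier R"
    and top: "\<And>c l. c \<in> L \<rightarrow> carrier R \<Longrightarrow> p_comb L x c \<in> Idl ((\<lambda>y. y [^] p) ` A) \<Longrightarrow> l \<in> L \<Longrightarrow> c l \<in> m"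
    and "Y \<subseteq> A" "c \<in> L \<rightarrow> carrier R" "p_comb L x c \<in> Idl ((\<lambda>y. y [^] p) ` Y)" "l \<in> L"
  shows "c l \<in> Idl Y"
  using assms(4-)
proof (induction "card (A - Y)" arbitrary: Y c l)
  case 0
  then have "Y = A" using finite_A by auto
  then show ?case using top 0 m_eq by simp
next
  case (Suc n)
  then have "A - Y \<noteq> {}" by (metis card.empty nat.distinct(1))
  then obtain a where a: "a \<in> A" "a \<notin> Y" by blast
  have ac: "a \<in> carrier R" and am: "a \<in> m" using a A_carrier A_subset_m by auto
  have Yc: "Y \<subseteq> carrier R" using Suc.prems(1) A_carrier by blast
  let ?I = "Idl ((\<lambda>y. y [^] p) ` Y)"
  have Ic: "(\<lambda>y. y [^] p) ` Y \<subseteq> carrier R" using Yc by auto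
  have Iid: "ideal ?I R" by (rule genideal_ideal[OF Ic])
  let ?K = "{c l | c. c \<in> L \<rightarrow> carrier R \<and> p_comb L x c \<in> ?I}"
  have "?K \<subseteq> Idl Y"
  proof (rule nakayama_local)
    show "?K \<subseteq> carrier R" using Suc.prems(4) by auto
    show "ideal (Idl Y) R" by (rule genideal_ideal[OF Yc])
    fix C assume C: "ideal C R" "Idl Y \<subseteq> C" "\<And>u k. u \<in> m \<Longrightarrow> k \<in> ?K \<Longrightarrow> u \<otimes> k \<in> C"
    show "?K \<subseteq> C"
    proof
      fix k assume "k \<in> ?K"
      then obtain c where c: "k = c l" "c \<in> L \<rightarrow> carrier R" "p_comb L x c \<in> ?I" by blast
      have "?I \<subseteq> Idl ((\<lambda>y. y [^] p) ` insert a Y)"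
        using Ic ac by (intro subset_Idl_subset) auto
      then have ci: "p_comb L x c \<in> Idl ((\<lambda>y. y [^] p) ` insert a Y)" using c(3) by blast
      have "n = card (A - insert a Y)" using Suc.hyps(2) a by (simp add: card_Diff_insert)
      then have ca: "c i \<in> Idl (insert a Y)" if "i \<in> L" for i
        by (rule Suc.hyps(1)[of "insert a Y" c i, OF _ _ c(2) ci that]) (use Suc.prems(1) a(1) in auto)
      have "\<forall>i\<in>L. \<exists>b t. b \<in> Idl Y \<and> t \<in> carrier R \<and> c i = b \<oplus> t \<otimes> a"
      proof
        fix i assume "i \<in> L"
        then show "\<exists>b t. b \<in> Idl Y \<and> t \<in> carrier R \<and> c i = b \<oplus> t \<otimes> a"
          using ca[of i] unfolding Idl_insert_iff[OF Yc ac] by blast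
      qed
      from bchoice[OF this] obtain b
        where "\<forall>i\<in>L. \<exists>t. b i \<in> Idl Y \<and> t \<in> carrier R \<and> c i = b i \<oplus> t \<otimes> a" ..
      from bchoice[OF this] obtain t
        where bt0: "\<forall>i\<in>L. b i \<in> Idl Y \<and> t i \<in> carrier R \<and> c i = b i \<oplus> t i \<otimes> a" ..
      then have bt: "\<And>i. i \<in> L \<Longrightarrow> b i \<in> Idl Y" "\<And>i. i \<in> L \<Longrightarrow> t i \<in> carrier R"
        "\<And>i. i \<in> L \<Longrightarrow> c i = b i \<oplus> t i \<otimes> a" by simp_all
      have bc: "b \<in> L \<rightarrow> carrier R" and tc: "t \<in> L \<rightarrow> carrier R"
        using bt ideal.Icarr[OF genideal_ideal[OF Yc]] by auto
      have atc: "(\<lambda>i. a \<otimes> t i) \<in> L \<rightarrow> carrier R" using tc ac by (auto simp: Pi_iff)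
      \<comment> \<open>Splitting all the coefficients, not only the \<open>l\<close>-th, turns
        \<open>c\<close> into a relation for \<open>t\<close>: the part with coefficients in
        \<open>Idl Y\<close> falls into \<open>?I\<close>, and \<open>a^p\<close> cancels modulo
        \<open>?I\<close>. Hence \<open>t l\<close> is in \<open>?K\<close> again.\<close>
      have "p_comb L x c = p_comb L x (\<lambda>i. b i \<oplus> a \<otimes> t i)"
        using bt bc atc ac by (intro p_comb_cong[OF x]) (auto simp: Pi_iff m_comm)
      also have "\<dots> = p_comb L x b \<oplus> a [^] p \<otimes> p_comb L x t"
        by (simp only: p_comb_add[OF x bc atc] p_comb_smult[OF x tc ac L])
      finally have "p_comb L x b \<oplus> a [^] p \<otimes> p_comb L x t \<in> ?I" using c(3) by simp
      moreover have "p_comb L x b \<in> ?I"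
        by (rule p_comb_in_ideal[OF x Iid]) (rule pow_p_mem_Idl[OF Yc bt(1)])
      ultimately have "a [^] p \<otimes> p_comb L x t \<in> ?I"
        by (rule ideal_add_cancel[OF Iid]) (use ac p_comb_closed[OF x tc] in simp)
      then have "p_comb L x t \<in> ?I"
        by (rule parameter_power_nonzerodivisor[OF Suc.prems(1) a p_comb_closed[OF x tc]])
      then have "t l \<in> ?K" using tc by blast
      then have "a \<otimes> t l \<in> C" by (rule C(3)[OF am])
      then have "t l \<otimes> a \<in> C" using m_comm ac bt(2)[OF Suc.prems(4)] by simp
      then show "k \<in> C"
        unfolding c(1) bt(3)[OF Suc.prems(4)] using bt(1)[OF Suc.prems(4)] C(2) ideal_add[OF C(1)] by blast
    qed
  qed
  then show ?case using Suc.prems by blast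
qed

text \<open>Kunz's theorem, in the direction regular \<open>\<Longrightarrow>\<close> flat, for finite Frobenius.\<close>

theorem frobenius_free:
  assumes L: "finite L" and x: "x \<in> L \<rightarrow> carrier R" and gen: "p_generates L x"
  shows "\<exists>B\<subseteq>L. p_generates B x \<and>
     (\<forall>c\<in>B \<rightarrow> carrier R. p_comb B x c = \<zero> \<longrightarrow> (\<forall>l\<in>B. c l = \<zero>))"
proof -
  \<comment> \<open>A generating subfamily of least size is a basis: minimality forces the
    coefficients of every relation modulo the \<open>p\<close>-th powers of the parameters into
    \<open>m\<close>, which starts the descent.\<close>
  obtain B where B: "B \<subseteq> L \<and> p_generates B x"
    and least: "\<And>B'. B' \<subseteq> L \<and> p_generates B' x \<Longrightarrow> card B \<le> card B'"
    using ex_has_least_nat[of "\<lambda>B. B \<subseteq> L \<and> p_generates B x" L card] gen by blast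
  have fB: "finite B" and xB: "x \<in> B \<rightarrow> carrier R" using B L x finite_subset by auto
  have top: "c l \<in> m"
    if c: "c \<in> B \<rightarrow> carrier R" and w: "p_comb B x c \<in> Idl ((\<lambda>y. y [^] p) ` A)" and l: "l \<in> B" for c l
  proof (rule ccontr)
    assume clm: "c l \<notin> m"
    have "(\<lambda>y. y [^] p) ` m \<subseteq> carrier R" using ideal.Icarr[OF ideal_m] by auto
    then have "Idl ((\<lambda>y. y [^] p) ` A) \<subseteq> Idl ((\<lambda>y. y [^] p) ` m)"
      using A_subset_m by (intro subset_Idl_subset) auto
    then have "p_comb B x c \<in> Idl ((\<lambda>y. y [^] p) ` m)" using w by blast
    then obtain v where v: "v \<in> B \<rightarrow> m" "p_comb B x c = p_comb B x v"
      using p_comb_coefficients[OF xB _ fB ideal_m] B by blast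
    have vc: "v \<in> B \<rightarrow> carrier R" using v(1) ideal.Icarr[OF ideal_m] by auto
    \<comment> \<open>The same element has coefficients \<open>v\<close> in \<open>m\<close>, so the
      difference is a relation with a unit at \<open>l\<close>. Dividing by that unit makes the
      generator \<open>x l\<close> redundant.\<close>
    let ?e = "\<lambda>i. c i \<ominus> v i"
    have ec: "?e \<in> B \<rightarrow> carrier R" using c vc by (auto simp: Pi_iff)
    have e0: "p_comb B x ?e = \<zero>"
      using p_comb_minus[OF xB c vc] v(2) p_comb_closed[OF xB vc] by (simp add: a_minus_def r_neg)
    have elc: "?e l \<in> carrier R" using ec l by auto
    have clc: "c l \<in> carrier R" "v l \<in> carrier R" "v l \<in> m" using c vc v l by auto
    have "?e l \<notin> m"
    proof
      assume "?e l \<in> m"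
      then have "?e l \<oplus> v l \<in> m" using clc(3) by (rule ideal_add[OF ideal_m])
      moreover have "?e l \<oplus> v l = c l" using clc(1,2) by algebra
      ultimately show False using clm by simp
    qed
    then obtain y where y: "y \<in> carrier R" "y \<otimes> ?e l = \<one>" by (rule inverse_outside_m[OF elc])
    let ?d = "\<lambda>i. y \<otimes> ?e i"
    have dc: "?d \<in> B \<rightarrow> carrier R" using ec y by (auto simp: Pi_iff)
    have d0: "p_comb B x ?d = \<zero>" using p_comb_smult[OF xB ec y(1) fB] e0 y(1) by simp
    let ?B = "B - {l}"
    have xB': "x \<in> ?B \<rightarrow> carrier R" using xB by blast
    have "p_generates ?B x"
      unfolding p_generates_def
    proof
      fix s assume "s \<in> carrier R"
      then obtain c' where c': "c' \<in> B \<rightarrow> carrier R" "s = p_comb B x c'"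
        using B unfolding p_generates_def by blast
      have c'l: "c' l \<in> carrier R" using c'(1) l by auto
      have cdc: "(\<lambda>i. c' l \<otimes> ?d i) \<in> B \<rightarrow> carrier R" using dc c'l by (auto simp: Pi_iff)
      let ?g = "\<lambda>i. c' i \<ominus> c' l \<otimes> ?d i"
      have gc: "?g \<in> B \<rightarrow> carrier R" using c'(1) cdc by (auto simp: Pi_iff)
      have "p_comb B x ?g = p_comb B x c' \<ominus> p_comb B x (\<lambda>i. c' l \<otimes> ?d i)"
        by (rule p_comb_minus[OF xB c'(1) cdc])
      also have "p_comb B x (\<lambda>i. c' l \<otimes> ?d i) = \<zero>"
        using p_comb_smult[OF xB dc c'l fB] d0 c'l by simp
      finally have "s = p_comb B x ?g" using c' p_comb_closed[OF xB c'(1)] by (simp add: a_minus_def)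
      also have "B = insert l ?B" using l by blast
      also have "p_comb (insert l ?B) x ?g = ?g l [^] p \<otimes> x l \<oplus> p_comb ?B x ?g"
        unfolding p_comb_def using fB gc xB l by (intro finsum_insert) (auto simp: Pi_iff)
      also have "?g l = \<zero>" using y(2) c'l by (simp add: a_minus_def r_neg)
      also have "\<zero> [^] p \<otimes> x l \<oplus> p_comb ?B x ?g = p_comb ?B x ?g"
      proof -
        have "?g \<in> ?B \<rightarrow> carrier R" using gc by blast
        then have "p_comb ?B x ?g \<in> carrier R" by (rule p_comb_closed[OF xB'])
        then show ?thesis using xB l by (simp add: frobenius_zero Pi_iff)
      qed
      finally have "s = p_comb ?B x ?g" .
      moreover have "?g \<in> ?B \<rightarrow> carrier R" using gc by blast
      ultimately show "\<exists>c\<in>?B \<rightarrow> carrier R. s = p_comb ?B x c" by blast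
    qed
    then have "card B \<le> card ?B" using B by (intro least) blast
    then show False using card_Diff1_less[OF fB l] by simp
  qed
  have "c l = \<zero>" if c: "c \<in> B \<rightarrow> carrier R" "p_comb B x c = \<zero>" and l: "l \<in> B" for c l
  proof -
    have e: "ideal (Idl {}) R" by (rule genideal_ideal) simp
    have "p_comb B x c \<in> Idl ((\<lambda>y. y [^] p) ` {})" using c(2) ideal_zero[OF e] by simp
    then have "c l \<in> Idl {}"
      by (rule p_comb_descent[of B x "{}" c l, rotated 5]) (fact fB xB c(1) l | rule top | simp)+
    moreover have "Idl {} \<subseteq> {\<zero>}" by (rule genideal_minimal[OF zeroideal]) simp
    ultimately show ?thesis by blast
  qed
  then show ?thesis using B by blast
qed

end

section \<open>Localization\<close>

context
  fixes R (structure) and P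
  assumes P: "primeideal P R"
begin

interpretation cring R using P primeideal.axioms(2) by blast

lemma frac_class_self: "a \<in> carrier R \<Longrightarrow> s \<in> carrier R - P \<Longrightarrow> (a, s) \<in> frac_class R P a s"
  unfolding frac_class_def using prime_one_notin[OF P] by blast

lemma frac_classE:
  assumes "(b, t) \<in> frac_class R P a s"
  obtains v where "b \<in> carrier R" "t \<in> carrier R - P" "v \<in> carrier R - P"
    "v \<otimes> (a \<otimes> t) = v \<otimes> (b \<otimes> s)"
  using assms unfolding frac_class_def by auto

lemma frac_class_subset:
  assumes a: "a \<in> carrier R" "s \<in> carrier R - P" "b \<in> carrier R" "t \<in> carrier R - P"
    and v: "v \<in> carrier R - P" "v \<otimes> (a \<otimes> t) = v \<otimes> (b \<otimes> s)"
  shows "frac_class R P a s \<subseteq> frac_class R P b t"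
proof
  fix z assume zin: "z \<in> frac_class R P a s"
  obtain c w where z: "z = (c, w)" by (cases z)
  obtain u where c: "c \<in> carrier R" "w \<in> carrier R - P"
    and u: "u \<in> carrier R - P" "u \<otimes> (a \<otimes> w) = u \<otimes> (c \<otimes> s)"
    using zin unfolding z by (rule frac_classE)
  have cc: "s \<in> carrier R" "t \<in> carrier R" "v \<in> carrier R" "w \<in> carrier R" "u \<in> carrier R"
    using a c u v by auto
  \<comment> \<open>Transitivity of equality of fractions through \<open>a / s\<close>: the middle
    denominator \<open>s\<close> joins the witnesses \<open>v\<close> and \<open>u\<close>.\<close>
  have "(v \<otimes> u \<otimes> s) \<otimes> (b \<otimes> w) = (u \<otimes> w) \<otimes> (v \<otimes> (b \<otimes> s))" using cc a(1,3) c(1) by algebra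
  also have "\<dots> = (v \<otimes> t) \<otimes> (u \<otimes> (a \<otimes> w))" unfolding v(2)[symmetric] using cc a(1,3) c(1) by algebra
  also have "\<dots> = (v \<otimes> u \<otimes> s) \<otimes> (c \<otimes> t)" unfolding u(2) using cc a(1,3) c(1) by algebra
  finally have "(v \<otimes> u \<otimes> s) \<otimes> (b \<otimes> w) = (v \<otimes> u \<otimes> s) \<otimes> (c \<otimes> t)" .
  moreover have "v \<otimes> u \<otimes> s \<in> carrier R - P" by (intro prime_Compl_mult[OF P] v u a)
  ultimately show "z \<in> frac_class R P b t" unfolding frac_class_def z using c by blast
qed

lemma frac_class_eq_iff:
  assumes a: "a \<in> carrier R" "s \<in> carrier R - P" "b \<in> carrier R" "t \<in> carrier R - P"
  shows "frac_class R P a s = frac_class R P b t \<longleftrightarrow>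
    (\<exists>v\<in>carrier R - P. v \<otimes> (a \<otimes> t) = v \<otimes> (b \<otimes> s))"
proof
  assume "frac_class R P a s = frac_class R P b t"
  then have "(b, t) \<in> frac_class R P a s" using frac_class_self a by simp
  then show "\<exists>v\<in>carrier R - P. v \<otimes> (a \<otimes> t) = v \<otimes> (b \<otimes> s)" unfolding frac_class_def by blast
next
  assume "\<exists>v\<in>carrier R - P. v \<otimes> (a \<otimes> t) = v \<otimes> (b \<otimes> s)"
  then obtain v where v: "v \<in> carrier R - P" "v \<otimes> (a \<otimes> t) = v \<otimes> (b \<otimes> s)" by blast
  show "frac_class R P a s = frac_class R P b t"
    using frac_class_subset[OF a v] frac_class_subset[OF a(3,4,1,2) v(1) v(2)[symmetric]] by (rule equalityI)
qed

lemma frac_class_mult: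
  assumes a: "a \<in> carrier R" "s \<in> carrier R - P" "b \<in> carrier R" "t \<in> carrier R - P"
  shows "frac_class R P a s \<otimes>\<^bsub>localization R P\<^esub> frac_class R P b t = frac_class R P (a \<otimes> b) (s \<otimes> t)"
proof -
  have "frac_class R P (a' \<otimes> b') (s' \<otimes> t') = frac_class R P (a \<otimes> b) (s \<otimes> t)"
    if in1: "(a', s') \<in> frac_class R P a s" and in2: "(b', t') \<in> frac_class R P b t" for a' s' b' t'
  proof -
    obtain v where v: "v \<in> carrier R - P" "v \<otimes> (a \<otimes> s') = v \<otimes> (a' \<otimes> s)"
      and ca: "a' \<in> carrier R" "s' \<in> carrier R - P" using in1 by (rule frac_classE)
    obtain w where w: "w \<in> carrier R - P" "w \<otimes> (b \<otimes> t') = w \<otimes> (b' \<otimes> t)"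
      and cb: "b' \<in> carrier R" "t' \<in> carrier R - P" using in2 by (rule frac_classE)
    note c = ca cb
    have cc: "s \<in> carrier R" "t \<in> carrier R" "s' \<in> carrier R" "t' \<in> carrier R" "v \<in> carrier R" "w \<in> carrier R"
      using a c v w by auto
    have "(v \<otimes> w) \<otimes> ((a' \<otimes> b') \<otimes> (s \<otimes> t)) = (v \<otimes> (a' \<otimes> s)) \<otimes> (w \<otimes> (b' \<otimes> t))"
      using cc a(1,3) c(1,3) by algebra
    also have "\<dots> = (v \<otimes> w) \<otimes> ((a \<otimes> b) \<otimes> (s' \<otimes> t'))"
      unfolding v(2)[symmetric] w(2)[symmetric] using cc a(1,3) c(1,3) by algebra
    finally show ?thesis
      using a c prime_Compl_mult[OF P v(1) w(1)] prime_Compl_mult[OF P a(2,4)] prime_Compl_mult[OF P c(2,4)]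
      by (subst frac_class_eq_iff) auto
  qed
  then have "(\<Union>(a', s') \<in> frac_class R P a s. \<Union>(b', t') \<in> frac_class R P b t. frac_class R P (a' \<otimes> b') (s' \<otimes> t'))
      = frac_class R P (a \<otimes> b) (s \<otimes> t)"
    using frac_class_self[OF a(1,2)] frac_class_self[OF a(3,4)] by blast
  then show ?thesis unfolding localization_def by simp
qed

lemma frac_class_add:
  assumes a: "a \<in> carrier R" "s \<in> carrier R - P" "b \<in> carrier R" "t \<in> carrier R - P"
  shows "frac_class R P a s \<oplus>\<^bsub>localization R P\<^esub> frac_class R P b t
    = frac_class R P (a \<otimes> t \<oplus> b \<otimes> s) (s \<otimes> t)"
proof -
  have "frac_class R P (a' \<otimes> t' \<oplus> b' \<otimes> s') (s' \<otimes> t') = frac_class R P (a \<otimes> t \<oplus> b \<otimes> s) (s \<otimes> t)"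
    if in1: "(a', s') \<in> frac_class R P a s" and in2: "(b', t') \<in> frac_class R P b t" for a' s' b' t'
  proof -
    obtain v where v: "v \<in> carrier R - P" "v \<otimes> (a \<otimes> s') = v \<otimes> (a' \<otimes> s)"
      and ca: "a' \<in> carrier R" "s' \<in> carrier R - P" using in1 by (rule frac_classE)
    obtain w where w: "w \<in> carrier R - P" "w \<otimes> (b \<otimes> t') = w \<otimes> (b' \<otimes> t)"
      and cb: "b' \<in> carrier R" "t' \<in> carrier R - P" using in2 by (rule frac_classE)
    note c = ca cb
    have cc: "s \<in> carrier R" "t \<in> carrier R" "s' \<in> carrier R" "t' \<in> carrier R" "v \<in> carrier R" "w \<in> carrier R"
      using a c v w by auto
    have "(v \<otimes> w) \<otimes> ((a' \<otimes> t' \<oplus> b' \<otimes> s') \<otimes> (s \<otimes> t))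
        = (w \<otimes> t \<otimes> t') \<otimes> (v \<otimes> (a' \<otimes> s)) \<oplus> (v \<otimes> s \<otimes> s') \<otimes> (w \<otimes> (b' \<otimes> t))"
      using cc a(1,3) c(1,3) by algebra
    also have "\<dots> = (v \<otimes> w) \<otimes> ((a \<otimes> t \<oplus> b \<otimes> s) \<otimes> (s' \<otimes> t'))"
      unfolding v(2)[symmetric] w(2)[symmetric] using cc a(1,3) c(1,3) by algebra
    finally show ?thesis
      using a c cc prime_Compl_mult[OF P v(1) w(1)] prime_Compl_mult[OF P a(2,4)] prime_Compl_mult[OF P c(2,4)]
      by (subst frac_class_eq_iff) auto
  qed
  then have "(\<Union>(a', s') \<in> frac_class R P a s. \<Union>(b', t') \<in> frac_class R P b t.
      frac_class R P (a' \<otimes> t' \<oplus> b' \<otimes> s') (s' \<otimes> t')) = frac_class R P (a \<otimes> t \<oplus> b \<otimes> s) (s \<otimes> t)"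
    using frac_class_self[OF a(1,2)] frac_class_self[OF a(3,4)] by blast
  then show ?thesis unfolding localization_def by simp
qed

lemma one_Compl: "\<one> \<in> carrier R - P" using prime_one_notin[OF P] by simp

lemma frac_class_closed:
  "a \<in> carrier R \<Longrightarrow> s \<in> carrier R - P \<Longrightarrow> frac_class R P a s \<in> carrier (localization R P)"
  unfolding localization_def by auto

lemma localization_hom: "(\<lambda>a. frac_class R P a \<one>) \<in> ring_hom R (localization R P)"
proof (rule ring_hom_memI)
  fix a b assume "a \<in> carrier R" "b \<in> carrier R"
  then show "frac_class R P (a \<otimes> b) \<one> = frac_class R P a \<one> \<otimes>\<^bsub>localization R P\<^esub> frac_class R P b \<one>"
    "frac_class R P (a \<oplus> b) \<one> = frac_class R P a \<one> \<oplus>\<^bsub>localization R P\<^esub> frac_class R P b \<one>"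
    using one_Compl by (simp_all add: frac_class_mult frac_class_add)
qed (use one_Compl frac_class_closed in \<open>auto simp: localization_def\<close>)

lemma localization_hom_eq_iff:
  assumes "a \<in> carrier R" "b \<in> carrier R"
  shows "frac_class R P a \<one> = frac_class R P b \<one> \<longleftrightarrow> (\<exists>v\<in>carrier R - P. v \<otimes> a = v \<otimes> b)"
  using frac_class_eq_iff[OF assms(1) one_Compl assms(2) one_Compl] assms by simp

lemma localization_denominator:
  assumes "z \<in> carrier (localization R P)"
  obtains a s where "a \<in> carrier R" "s \<in> carrier R - P"
    "z \<otimes>\<^bsub>localization R P\<^esub> frac_class R P s \<one> = frac_class R P a \<one>"
proof -
  obtain a s where as: "z = frac_class R P a s" "a \<in> carrier R" "s \<in> carrier R - P"
    using assms unfolding localization_def by auto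
  have "z \<otimes>\<^bsub>localization R P\<^esub> frac_class R P s \<one> = frac_class R P (a \<otimes> s) s"
    unfolding as(1) using as one_Compl by (simp add: frac_class_mult)
  also have "\<dots> = frac_class R P a \<one>"
    using as one_Compl by (subst frac_class_eq_iff) auto
  finally show ?thesis using that as by blast
qed

lemma localization_inverse:
  assumes s: "s \<in> carrier R - P"
  shows "frac_class R P \<one> s \<otimes>\<^bsub>localization R P\<^esub> frac_class R P s \<one> = \<one>\<^bsub>localization R P\<^esub>"
proof -
  have "frac_class R P \<one> s \<otimes>\<^bsub>localization R P\<^esub> frac_class R P s \<one> = frac_class R P s s"
    using s one_Compl by (simp add: frac_class_mult)
  also have "\<dots> = frac_class R P \<one> \<one>"
    using s one_Compl by (subst frac_class_eq_iff) auto
  finally show ?thesis unfolding localization_def by simp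
qed

end

text \<open>Clears finitely many denominators by a single element outside \<open>N\<close>:
  \<open>mult\<close> says that a valid denominator may be enlarged, so a product serves every
  \<open>l\<close>.\<close>

lemma (in cring) common_multiplier:
  assumes N: "primeideal N R" and B: "finite B"
    and ex: "\<And>l. l \<in> B \<Longrightarrow> \<exists>t\<in>carrier R - N. Q l t"
    and mult: "\<And>l t u. l \<in> B \<Longrightarrow> t \<in> carrier R - N \<Longrightarrow> u \<in> carrier R - N \<Longrightarrow> Q l t \<Longrightarrow> Q l (u \<otimes> t)"
  shows "\<exists>t\<in>carrier R - N. \<forall>l\<in>B. Q l t"
  using B ex mult
proof (induction B rule: finite_induct)
  case empty
  then show ?case using prime_one_notin[OF N] by auto
next
  case (insert i F)
  have "\<exists>t\<in>carrier R - N. \<forall>l\<in>F. Q l t"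
    by (rule insert.IH) (use insert.prems in auto)
  then obtain t where t: "t \<in> carrier R - N" "\<And>l. l \<in> F \<Longrightarrow> Q l t" by blast
  obtain u where u: "u \<in> carrier R - N" "Q i u" using insert.prems(1) by blast
  have "Q l (t \<otimes> u)" if "l \<in> insert i F" for l
  proof (cases "l = i")
    case True
    then show ?thesis using insert.prems(2)[OF _ u(1) t(1) u(2)] by simp
  next
    case False
    then have "l \<in> F" using that by simp
    then have "Q l (u \<otimes> t)" by (intro insert.prems(2)[OF that t(1) u(1)] t(2))
    then show ?thesis using m_comm t(1) u(1) by simp
  qed
  then show ?case using prime_Compl_mult[OF N t(1) u(1)] by blast
qed

section \<open>Cartier maps\<close>

text \<open>The members of \<open>cartier_maps q\<close> are the \<open>R\<close>-linear maps from \<open>R\<close>, as a module via the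
  \<open>q\<close>-th power map, to \<open>R\<close>.\<close>

definition (in cring) cartier_maps :: "nat \<Rightarrow> ('a \<Rightarrow> 'a) set" where
  "cartier_maps q = {\<phi> \<in> carrier R \<rightarrow> carrier R.
     (\<forall>x\<in>carrier R. \<forall>y\<in>carrier R. \<phi> (x \<oplus> y) = \<phi> x \<oplus> \<phi> y) \<and>
     (\<forall>a\<in>carrier R. \<forall>x\<in>carrier R. \<phi> (a [^] q \<otimes> x) = a \<otimes> \<phi> x)}"

text \<open>Over a regular F-finite ring this holds for all powers \<open>q\<close> of \<open>p\<close>. It encodes that \<open>R\<close> is a
  projective module via the \<open>q\<close>-th power map.\<close>

definition (in cring) cartier_detects :: "nat \<Rightarrow> bool" where
  "cartier_detects q \<longleftrightarrow> (\<forall>x\<in>carrier R. \<forall>J. ideal J R \<longrightarrow>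
     (\<forall>\<phi>\<in>cartier_maps q. \<phi> x \<in> J) \<longrightarrow> x \<in> frobenius_power R q J)"

section \<open>From local bases of Frobenius to Cartier maps on the whole ring\<close>

context noetherian_char_p_ring
begin

text \<open>The free basis over the localization, with denominators cleared. Scalars act through
  \<open>p\<close>-th powers, so the denominator in the first part is \<open>s^p\<close>. In the
  second part coefficients vanish only up to a factor outside \<open>N\<close>, since
  \<open>R\<close> need not embed into the localization.\<close>

lemma local_p_basis:
  assumes reg: "regular_ring R" and N: "primeideal N R"
    and F: "finite F" "F \<subseteq> carrier R" and gen: "p_generates F (\<lambda>x. x)"
  shows "\<exists>B\<subseteq>F. (\<forall>i\<in>F. \<exists>s\<in>carrier R - N. \<exists>b\<in>B \<rightarrow> carrier R. s [^] p \<otimes> i = p_comb B (\<lambda>x. x) b) \<and>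
    (\<forall>c\<in>B \<rightarrow> carrier R. p_comb B (\<lambda>x. x) c = \<zero> \<longrightarrow> (\<forall>l\<in>B. \<exists>v\<in>carrier R - N. v \<otimes> c l = \<zero>))"
proof -
  let ?S = "localization R N"
  define h where "h = (\<lambda>a. frac_class R N a \<one>)"
  have "regular_local_ring ?S" using reg N unfolding regular_ring_def by blast
  then obtain m A where "regular_parameters ?S m A" using regular_local_ring_parameters by blast
  then interpret S: regular_parameters ?S m A .
  have hom: "h \<in> ring_hom R ?S" unfolding h_def by (rule localization_hom[OF N])
  interpret h: ring_hom_cring R ?S h
    by (intro ring_hom_cring.intro ring_hom_cring_axioms.intro is_cring S.is_cring hom)
  have h_pow: "h (a [^] n) = h a [^]\<^bsub>?S\<^esub> n" if "a \<in> carrier R" for a and n :: nat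
    using that by (induction n) simp_all
  have "h (add_pow R n \<one>) = add_pow ?S n \<one>\<^bsub>?S\<^esub>" for n :: nat
    by (induction n) simp_all
  then have "add_pow ?S p \<one>\<^bsub>?S\<^esub> = \<zero>\<^bsub>?S\<^esub>" using char_p by (metis h.hom_zero)
  then interpret S: regular_char_p_parameters ?S m A p
    by (intro regular_char_p_parameters.intro noetherian_char_p_ring.intro
        noetherian_char_p_ring_axioms.intro prime_p S.regular_parameters_axioms S.noetherian_cring_axioms)
  have h_comb: "h (p_comb B (\<lambda>x. x) c) = S.p_comb B h (\<lambda>l. h (c l))"
    if B: "B \<subseteq> carrier R" and c: "c \<in> B \<rightarrow> carrier R" for B c
  proof -
    have cl: "(\<lambda>l. c l [^] p \<otimes> l) \<in> B \<rightarrow> carrier R" using B c by (auto simp: Pi_iff)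
    have "h (p_comb B (\<lambda>x. x) c) = (\<Oplus>\<^bsub>?S\<^esub>l\<in>B. (h \<circ> (\<lambda>l. c l [^] p \<otimes> l)) l)"
      unfolding p_comb_def h.hom_finsum[OF cl] comp_def ..
    also have "\<dots> = S.p_comb B h (\<lambda>l. h (c l))"
      unfolding S.p_comb_def using B c by (intro S.finsum_cong') (auto simp: Pi_iff h_pow subset_iff)
    finally show ?thesis .
  qed
  have hF: "h \<in> F \<rightarrow> carrier ?S" using F(2) by auto
  have eq: "\<exists>v\<in>carrier R - N. v \<otimes> a = v \<otimes> b" if "h a = h b" "a \<in> carrier R" "b \<in> carrier R" for a b
    using that localization_hom_eq_iff[OF N, of a b] unfolding h_def by blast
  obtain q where q: "p = Suc q" using p_gt_1 by (cases p) auto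
  have "S.p_generates F h"
    unfolding S.p_generates_def
  proof
    fix z assume z: "z \<in> carrier ?S"
    obtain a s where as: "a \<in> carrier R" "s \<in> carrier R - N" "z \<otimes>\<^bsub>?S\<^esub> h s = h a"
      using localization_denominator[OF N z] unfolding h_def by blast
    let ?u = "frac_class R N \<one> s"
    have u: "?u \<in> carrier ?S" "?u \<otimes>\<^bsub>?S\<^esub> h s = \<one>\<^bsub>?S\<^esub>"
      using frac_class_closed[OF N one_closed as(2)] localization_inverse[OF N as(2)] unfolding h_def by auto
    have hs: "h s \<in> carrier ?S" using as(2) by simp
    \<comment> \<open>The fraction \<open>a / s\<close> is rewritten as \<open>(1 / s)^p\<close>
      times \<open>s^(p-1) a\<close>, so that its denominator can be absorbed into the
      coefficients.\<close>
    obtain c where c: "c \<in> F \<rightarrow> carrier R" "s [^] q \<otimes> a = p_comb F (\<lambda>x. x) c"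
      using gen as unfolding p_generates_def by (metis DiffD1 m_closed nat_pow_closed)
    have hc: "(\<lambda>l. h (c l)) \<in> F \<rightarrow> carrier ?S" using c(1) by (auto simp: Pi_iff)
    have "h (s [^] q \<otimes> a) = h s [^]\<^bsub>?S\<^esub> q \<otimes>\<^bsub>?S\<^esub> (z \<otimes>\<^bsub>?S\<^esub> h s)"
      using as h_pow by simp
    also have "\<dots> = h s [^]\<^bsub>?S\<^esub> p \<otimes>\<^bsub>?S\<^esub> z"
      unfolding q using hs z by (simp add: S.m_comm S.m_lcomm S.m_assoc)
    finally have "?u [^]\<^bsub>?S\<^esub> p \<otimes>\<^bsub>?S\<^esub> h (s [^] q \<otimes> a) = (?u \<otimes>\<^bsub>?S\<^esub> h s) [^]\<^bsub>?S\<^esub> p \<otimes>\<^bsub>?S\<^esub> z"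
      using u(1) hs z by (simp add: S.m_assoc S.nat_pow_distrib)
    then have "z = ?u [^]\<^bsub>?S\<^esub> p \<otimes>\<^bsub>?S\<^esub> h (s [^] q \<otimes> a)" using u(2) z by simp
    also have "\<dots> = ?u [^]\<^bsub>?S\<^esub> p \<otimes>\<^bsub>?S\<^esub> S.p_comb F h (\<lambda>l. h (c l))"
      unfolding c(2) h_comb[OF F(2) c(1)] ..
    also have "\<dots> = S.p_comb F h (\<lambda>l. ?u \<otimes>\<^bsub>?S\<^esub> h (c l))"
      by (rule S.p_comb_smult[OF hF hc u(1) F(1), symmetric])
    finally have "z = S.p_comb F h (\<lambda>l. ?u \<otimes>\<^bsub>?S\<^esub> h (c l))" .
    moreover have "(\<lambda>l. ?u \<otimes>\<^bsub>?S\<^esub> h (c l)) \<in> F \<rightarrow> carrier ?S" using hc u(1) by (auto simp: Pi_iff)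
    ultimately show "\<exists>c\<in>F \<rightarrow> carrier ?S. z = S.p_comb F h c" by blast
  qed
  from S.frobenius_free[OF F(1) hF this]
  obtain B where B: "B \<subseteq> F" "S.p_generates B h"
    and ind: "\<forall>c\<in>B \<rightarrow> carrier ?S. S.p_comb B h c = \<zero>\<^bsub>?S\<^esub> \<longrightarrow> (\<forall>l\<in>B. c l = \<zero>\<^bsub>?S\<^esub>)"
    by (elim exE conjE)
  have fB: "finite B" and Bc: "B \<subseteq> carrier R" using B(1) F finite_subset by auto
  have hB: "h \<in> B \<rightarrow> carrier ?S" and idB: "(\<lambda>x. x) \<in> B \<rightarrow> carrier R" using Bc by auto
  have "\<exists>s\<in>carrier R - N. \<exists>b\<in>B \<rightarrow> carrier R. s [^] p \<otimes> i = p_comb B (\<lambda>x. x) b" if i: "i \<in> F" for i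
  proof -
    have ic: "i \<in> carrier R" using i F(2) by blast
    then have "h i \<in> carrier ?S" by simp
    then obtain d where d: "d \<in> B \<rightarrow> carrier ?S" "h i = S.p_comb B h d"
      using B(2) unfolding S.p_generates_def by blast
    let ?Q = "\<lambda>l t. \<exists>a\<in>carrier R. d l \<otimes>\<^bsub>?S\<^esub> h t = h a"
    have "\<exists>t\<in>carrier R - N. \<forall>l\<in>B. ?Q l t"
    proof (rule common_multiplier[OF N fB])
      fix l assume "l \<in> B"
      then have dl: "d l \<in> carrier ?S" using d(1) by blast
      show "\<exists>t\<in>carrier R - N. ?Q l t"
        using localization_denominator[OF N dl] unfolding h_def by metis
      fix t u assume t: "t \<in> carrier R - N" and u: "u \<in> carrier R - N" and "?Q l t"
      then obtain a where a: "a \<in> carrier R" "d l \<otimes>\<^bsub>?S\<^esub> h t = h a" by blast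
      have "d l \<otimes>\<^bsub>?S\<^esub> h (u \<otimes> t) = h u \<otimes>\<^bsub>?S\<^esub> (d l \<otimes>\<^bsub>?S\<^esub> h t)"
        using t u dl by (simp add: S.m_lcomm)
      also have "\<dots> = h (u \<otimes> a)" unfolding a(2) using a(1) u by simp
      finally show "?Q l (u \<otimes> t)" using a(1) u by blast
    qed
    then obtain s where s: "s \<in> carrier R - N" "\<forall>l\<in>B. \<exists>a. a \<in> carrier R \<and> d l \<otimes>\<^bsub>?S\<^esub> h s = h a"
      by blast
    from bchoice[OF s(2)] obtain b where b: "\<forall>l\<in>B. b l \<in> carrier R \<and> d l \<otimes>\<^bsub>?S\<^esub> h s = h (b l)" ..
    have sc: "s \<in> carrier R" using s(1) by simp
    have bc: "b \<in> B \<rightarrow> carrier R" using b by simp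
    have hbc: "(\<lambda>l. h (b l)) \<in> B \<rightarrow> carrier ?S" using bc by (auto simp: Pi_iff)
    have "h (s [^] p \<otimes> i) = h s [^]\<^bsub>?S\<^esub> p \<otimes>\<^bsub>?S\<^esub> S.p_comb B h d"
      using sc ic d(2) h_pow by simp
    also have "\<dots> = S.p_comb B h (\<lambda>l. h s \<otimes>\<^bsub>?S\<^esub> d l)"
      by (rule S.p_comb_smult[OF hB d(1) _ fB, symmetric]) (use sc in simp)
    also have "\<dots> = S.p_comb B h (\<lambda>l. h (b l))"
    proof (rule S.p_comb_cong[OF hB _ hbc])
      fix l assume l: "l \<in> B"
      then have "d l \<in> carrier ?S" "h s \<in> carrier ?S" using d(1) sc by auto
      then have "h s \<otimes>\<^bsub>?S\<^esub> d l = d l \<otimes>\<^bsub>?S\<^esub> h s" by (rule S.m_comm[rotated])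
      then show "h s \<otimes>\<^bsub>?S\<^esub> d l = h (b l)" using b l by simp
    qed
    also have "\<dots> = h (p_comb B (\<lambda>x. x) b)" by (rule h_comb[OF Bc bc, symmetric])
    finally have "h (s [^] p \<otimes> i) = h (p_comb B (\<lambda>x. x) b)" .
    then obtain v where v: "v \<in> carrier R - N" "v \<otimes> (s [^] p \<otimes> i) = v \<otimes> p_comb B (\<lambda>x. x) b"
      using eq p_comb_closed[OF idB bc] sc ic by (metis m_closed nat_pow_closed)
    have vc: "v \<in> carrier R" using v(1) by simp
    \<comment> \<open>An equation in the localization holds in \<open>R\<close> after multiplication
      by some \<open>v \<notin> N\<close>. The extra factor \<open>v^(p-1)\<close> completes a
      \<open>p\<close>-th power, which the coefficients absorb.\<close>
    have "(v \<otimes> s) [^] p \<otimes> i = v [^] q \<otimes> (v \<otimes> (s [^] p \<otimes> i))"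
      unfolding q using vc sc ic by (simp add: nat_pow_distrib m_assoc m_lcomm)
    also have "\<dots> = v [^] p \<otimes> p_comb B (\<lambda>x. x) b"
      unfolding v(2) using q vc p_comb_closed[OF idB bc] by (simp add: m_assoc)
    also have "\<dots> = p_comb B (\<lambda>x. x) (\<lambda>l. v \<otimes> b l)"
      by (rule p_comb_smult[OF idB bc vc fB, symmetric])
    finally have "(v \<otimes> s) [^] p \<otimes> i = p_comb B (\<lambda>x. x) (\<lambda>l. v \<otimes> b l)" .
    moreover have "(\<lambda>l. v \<otimes> b l) \<in> B \<rightarrow> carrier R" using vc bc by (auto simp: Pi_iff)
    ultimately show ?thesis using prime_Compl_mult[OF N v(1) s(1)] by blast
  qed
  moreover have "\<exists>v\<in>carrier R - N. v \<otimes> c l = \<zero>"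
    if c: "c \<in> B \<rightarrow> carrier R" "p_comb B (\<lambda>x. x) c = \<zero>" and l: "l \<in> B" for c l
  proof -
    have 0: "S.p_comb B h (\<lambda>l. h (c l)) = \<zero>\<^bsub>?S\<^esub>" using h_comb[OF Bc c(1)] c(2) by simp
    have 1: "(\<lambda>l. h (c l)) \<in> B \<rightarrow> carrier ?S" using c(1) by (auto simp: Pi_iff)
    have "\<forall>l\<in>B. h (c l) = \<zero>\<^bsub>?S\<^esub>" using ind[rule_format, OF 1 0] by blast
    then have "h (c l) = h \<zero>" using l h.hom_zero by simp
    then obtain v where "v \<in> carrier R - N" "v \<otimes> c l = v \<otimes> \<zero>" using eq c(1) l by blast
    then show ?thesis by auto
  qed
  ultimately show ?thesis using B(1) by blast
qed

lemma p_comb_finsum: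
  assumes x: "x \<in> B \<rightarrow> carrier R" and F: "finite F"
    and f: "\<And>i. i \<in> F \<Longrightarrow> f i \<in> B \<rightarrow> carrier R"
  shows "p_comb B x (\<lambda>l. \<Oplus>i\<in>F. f i l) = (\<Oplus>i\<in>F. p_comb B x (f i))"
  using F f
proof (induction F rule: finite_induct)
  case empty
  show ?case
    unfolding finsum_empty p_comb_def
    using x by (intro add.finprod_one_eqI) (auto simp: frobenius_zero Pi_iff)
next
  case (insert j F)
  have fj: "f j \<in> B \<rightarrow> carrier R" and fF: "\<And>i. i \<in> F \<Longrightarrow> f i \<in> B \<rightarrow> carrier R"
    using insert.prems by auto
  have sF: "(\<lambda>l. \<Oplus>i\<in>F. f i l) \<in> B \<rightarrow> carrier R"
    using fF by (intro Pi_I finsum_closed) auto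
  have "p_comb B x (\<lambda>l. \<Oplus>i\<in>insert j F. f i l) = p_comb B x (\<lambda>l. f j l \<oplus> (\<Oplus>i\<in>F. f i l))"
  proof (rule p_comb_cong[OF x])
    fix l assume "l \<in> B"
    then show "(\<Oplus>i\<in>insert j F. f i l) = f j l \<oplus> (\<Oplus>i\<in>F. f i l)"
      using insert.hyps fj fF by (intro finsum_insert) auto
  qed (use fj sF in \<open>auto simp: Pi_iff\<close>)
  also have "\<dots> = p_comb B x (f j) \<oplus> p_comb B x (\<lambda>l. \<Oplus>i\<in>F. f i l)"
    by (rule p_comb_add[OF x fj sF])
  also have "p_comb B x (\<lambda>l. \<Oplus>i\<in>F. f i l) = (\<Oplus>i\<in>F. p_comb B x (f i))"
    by (rule insert.IH[OF fF])
  also have "p_comb B x (f j) \<oplus> (\<Oplus>i\<in>F. p_comb B x (f i)) = (\<Oplus>i\<in>insert j F. p_comb B x (f i))"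
    using insert.hyps p_comb_closed[OF x fj] p_comb_closed[OF x fF]
    by (intro finsum_insert[symmetric]) auto
  finally show ?case .
qed

text \<open>The ideal is finitely generated, so a product of finitely many multipliers annihilates
  all of it.\<close>

lemma locally_zero_ideal_annihilated:
  assumes N: "primeideal N R" and I: "ideal I R"
    and ex: "\<And>a. a \<in> I \<Longrightarrow> \<exists>v\<in>carrier R - N. v \<otimes> a = \<zero>"
  shows "\<exists>v\<in>carrier R - N. \<forall>a\<in>I. v \<otimes> a = \<zero>"
proof -
  obtain F where F: "F \<subseteq> carrier R" "finite F" "I = Idl F" using finetely_gen[OF I] by blast
  have "\<exists>v\<in>carrier R - N. \<forall>a\<in>F. v \<otimes> a = \<zero>"
  proof (rule common_multiplier[OF N F(2)])
    fix l assume l: "l \<in> F"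
    then show "\<exists>v\<in>carrier R - N. v \<otimes> l = \<zero>" using ex genideal_self[OF F(1)] F(3) by blast
    fix t u assume "t \<in> carrier R - N" "u \<in> carrier R - N" "t \<otimes> l = \<zero>"
    then show "u \<otimes> t \<otimes> l = \<zero>" using l F(1) by (auto simp: m_assoc)
  qed
  then obtain v where v: "v \<in> carrier R - N" "\<forall>a\<in>F. v \<otimes> a = \<zero>" by blast
  then have vc: "v \<in> carrier R" by simp
  have "ideal {a \<in> carrier R. a \<otimes> v \<in> {\<zero>}} R" by (rule ideal_colon[OF zeroideal vc])
  moreover have "F \<subseteq> {a \<in> carrier R. a \<otimes> v \<in> {\<zero>}}" using v(2) F(1) m_comm[OF _ vc] by auto
  ultimately have "I \<subseteq> {a \<in> carrier R. a \<otimes> v \<in> {\<zero>}}" unfolding F(3) by (rule genideal_minimal)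
  then have "v \<otimes> a = \<zero>" if "a \<in> I" for a using that m_comm[OF vc] by auto
  then show ?thesis using v(1) by blast
qed

lemma frobenius_power_ideal:
  assumes "ideal J R"
  shows "ideal (frobenius_power R q J) R"
  unfolding frobenius_power_def
  using ideal.Icarr[OF assms] by (intro genideal_ideal) auto

lemma frobenius_power_mem:
  assumes "ideal J R" "u \<in> J"
  shows "u [^] q \<in> frobenius_power R q J"
proof -
  have "(\<lambda>u. u [^] q) ` J \<subseteq> carrier R" using ideal.Icarr[OF assms(1)] by auto
  then show ?thesis unfolding frobenius_power_def using genideal_self assms(2) by blast
qed

lemma frobenius_power_minimal:
  assumes "ideal I R" "\<And>u. u \<in> J \<Longrightarrow> u [^] q \<in> I"
  shows "frobenius_power R q J \<subseteq> I"
  unfolding frobenius_power_def using assms by (intro genideal_minimal) auto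

lemma frobenius_power_mono:
  assumes "ideal I R" "J \<subseteq> I"
  shows "frobenius_power R q J \<subseteq> frobenius_power R q I"
  using assms frobenius_power_mem
  by (intro frobenius_power_minimal frobenius_power_ideal) auto

text \<open>Near a given prime \<open>N\<close>, multiplying by a suitable \<open>t \<notin> N\<close> turns the coefficient functions of
  the local basis into Cartier maps, so \<open>x\<close> lies in \<open>J\<^bsup>[p]\<^esup>\<close> locally at every maximal ideal.\<close>

lemma cartier_detects_p:
  assumes reg: "regular_ring R" and F: "finite F" "F \<subseteq> carrier R" and gen: "p_generates F (\<lambda>x. x)"
  shows "cartier_detects p"
  unfolding cartier_detects_def
proof (intro ballI allI impI)
  fix x J assume x: "x \<in> carrier R" and J: "ideal J R" and \<phi>J: "\<forall>\<phi>\<in>cartier_maps p. \<phi> x \<in> J"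
  let ?I = "frobenius_power R p J"
  have Iid: "ideal ?I R" by (rule frobenius_power_ideal[OF J])
  \<comment> \<open>The elements \<open>a\<close> with \<open>a^p x \<in> J^[p]\<close> form an
    ideal because Frobenius is additive. It measures where \<open>x\<close> lies in
    \<open>J^[p]\<close> locally, and the aim is to show that no maximal ideal contains it.\<close>
  let ?D = "{a \<in> carrier R. a [^] p \<in> {r \<in> carrier R. r \<otimes> x \<in> ?I}}"
  have Did: "ideal ?D R" by (rule ideal_frobenius_preimage[OF ideal_colon[OF Iid x]])
  have idF: "(\<lambda>x. x) \<in> F \<rightarrow> carrier R" using F(2) by auto
  have "\<one> \<in> ?D"
  proof (rule ccontr)
    assume "\<one> \<notin> ?D"
    then obtain N where "maximalideal N R" and DN: "?D \<subseteq> N" by (rule exists_maximalideal[OF Did])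
    then have N: "primeideal N R" by (intro maximalideal_prime)
    obtain B where B: "B \<subseteq> F"
      and loc: "\<And>i. i \<in> F \<Longrightarrow> \<exists>s\<in>carrier R - N. \<exists>b\<in>B \<rightarrow> carrier R. s [^] p \<otimes> i = p_comb B (\<lambda>x. x) b"
      and ind: "\<And>c l. c \<in> B \<rightarrow> carrier R \<Longrightarrow> p_comb B (\<lambda>x. x) c = \<zero> \<Longrightarrow> l \<in> B \<Longrightarrow>
        \<exists>v\<in>carrier R - N. v \<otimes> c l = \<zero>"
      using local_p_basis[OF reg N F gen] by blast
    have fB: "finite B" and Bc: "B \<subseteq> carrier R" using B F finite_subset by auto
    have idB: "(\<lambda>x. x) \<in> B \<rightarrow> carrier R" using Bc by auto
    have "\<exists>s\<in>carrier R - N. \<forall>i\<in>F. \<exists>b\<in>B \<rightarrow> carrier R. s [^] p \<otimes> i = p_comb B (\<lambda>x. x) b"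
    proof (rule common_multiplier[OF N F(1) loc])
      fix i t u assume i: "i \<in> F" and t: "t \<in> carrier R - N" and u: "u \<in> carrier R - N"
        and "\<exists>b\<in>B \<rightarrow> carrier R. t [^] p \<otimes> i = p_comb B (\<lambda>x. x) b"
      then obtain b where b: "b \<in> B \<rightarrow> carrier R" "t [^] p \<otimes> i = p_comb B (\<lambda>x. x) b" by blast
      have c: "i \<in> carrier R" "t \<in> carrier R" "u \<in> carrier R" using i t u F(2) by auto
      have "(u \<otimes> t) [^] p \<otimes> i = u [^] p \<otimes> (t [^] p \<otimes> i)"
        using c by (simp add: nat_pow_distrib m_assoc)
      also have "\<dots> = p_comb B (\<lambda>x. x) (\<lambda>l. u \<otimes> b l)"
        unfolding b(2) by (rule p_comb_smult[OF idB b(1) c(3) fB, symmetric])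
      finally have "(u \<otimes> t) [^] p \<otimes> i = p_comb B (\<lambda>x. x) (\<lambda>l. u \<otimes> b l)" .
      moreover have "(\<lambda>l. u \<otimes> b l) \<in> B \<rightarrow> carrier R" using b(1) c(3) by (auto simp: Pi_iff)
      ultimately show "\<exists>b\<in>B \<rightarrow> carrier R. (u \<otimes> t) [^] p \<otimes> i = p_comb B (\<lambda>x. x) b" by blast
    qed
    then obtain s where s: "s \<in> carrier R - N"
      "\<forall>i\<in>F. \<exists>b. b \<in> B \<rightarrow> carrier R \<and> s [^] p \<otimes> i = p_comb B (\<lambda>x. x) b" by blast
    have sc: "s \<in> carrier R" using s(1) by simp
    from bchoice[OF s(2)] obtain b
      where b: "\<forall>i\<in>F. b i \<in> B \<rightarrow> carrier R \<and> s [^] p \<otimes> i = p_comb B (\<lambda>x. x) (b i)" ..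
    have bc: "b i l \<in> carrier R" if "i \<in> F" "l \<in> B" for i l using b that by blast
    \<comment> \<open>\<open>\<beta> c l\<close> is the \<open>l\<close>-th coefficient, over
      \<open>B\<close>, of \<open>s^p\<close> times the combination of \<open>c\<close> over
      \<open>F\<close>. It depends on the representation \<open>c\<close>, so it is not yet a
      function of the element of \<open>R\<close>.\<close>
    define \<beta> where "\<beta> = (\<lambda>c l. \<Oplus>i\<in>F. c i \<otimes> b i l)"
    have \<beta>c: "\<beta> c l \<in> carrier R" if "c \<in> F \<rightarrow> carrier R" "l \<in> B" for c l
      unfolding \<beta>_def using that bc by (intro finsum_closed) (auto simp: Pi_iff)
    have \<beta>_add: "\<beta> (\<lambda>i. c i \<oplus> d i) l = \<beta> c l \<oplus> \<beta> d l"
      if c: "c \<in> F \<rightarrow> carrier R" and d: "d \<in> F \<rightarrow> carrier R" and l: "l \<in> B" for c d l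
    proof -
      have "\<beta> (\<lambda>i. c i \<oplus> d i) l = (\<Oplus>i\<in>F. c i \<otimes> b i l \<oplus> d i \<otimes> b i l)"
        unfolding \<beta>_def using c d l bc by (intro finsum_cong') (auto simp: Pi_iff l_distr)
      also have "\<dots> = \<beta> c l \<oplus> \<beta> d l"
        unfolding \<beta>_def using c d l bc by (intro finsum_addf) (auto simp: Pi_iff)
      finally show ?thesis .
    qed
    have \<beta>_smult: "\<beta> (\<lambda>i. r \<otimes> c i) l = r \<otimes> \<beta> c l"
      if c: "c \<in> F \<rightarrow> carrier R" and r: "r \<in> carrier R" and l: "l \<in> B" for c r l
    proof -
      have "\<beta> (\<lambda>i. r \<otimes> c i) l = (\<Oplus>i\<in>F. r \<otimes> (c i \<otimes> b i l))"
        unfolding \<beta>_def using c r l bc by (intro finsum_cong') (auto simp: Pi_iff m_assoc)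
      also have "\<dots> = r \<otimes> \<beta> c l"
        unfolding \<beta>_def using c r l bc F(1) by (intro finsum_rdistr[symmetric]) (auto simp: Pi_iff)
      finally show ?thesis .
    qed
    have \<beta>_comb: "p_comb B (\<lambda>x. x) (\<beta> c) = s [^] p \<otimes> p_comb F (\<lambda>x. x) c"
      if c: "c \<in> F \<rightarrow> carrier R" for c
    proof -
      have cb: "(\<lambda>l. c i \<otimes> b i l) \<in> B \<rightarrow> carrier R" if "i \<in> F" for i
        using that c bc by (auto simp: Pi_iff)
      have "p_comb B (\<lambda>x. x) (\<beta> c) = (\<Oplus>i\<in>F. p_comb B (\<lambda>x. x) (\<lambda>l. c i \<otimes> b i l))"
        unfolding \<beta>_def by (rule p_comb_finsum[OF idB F(1) cb])
      also have "\<dots> = (\<Oplus>i\<in>F. s [^] p \<otimes> (c i [^] p \<otimes> i))"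
      proof (rule finsum_cong')
        fix i assume i: "i \<in> F"
        then have ic: "c i \<in> carrier R" "i \<in> carrier R" using c F(2) by auto
        have "b i \<in> B \<rightarrow> carrier R" using b i by blast
        then have "p_comb B (\<lambda>x. x) (\<lambda>l. c i \<otimes> b i l) = c i [^] p \<otimes> (s [^] p \<otimes> i)"
          using p_comb_smult[OF idB _ ic(1) fB] b i by simp
        then show "p_comb B (\<lambda>x. x) (\<lambda>l. c i \<otimes> b i l) = s [^] p \<otimes> (c i [^] p \<otimes> i)"
          using ic sc by (simp add: m_lcomm)
      qed (use c F(2) sc in auto)
      also have "\<dots> = s [^] p \<otimes> p_comb F (\<lambda>x. x) c"
        unfolding p_comb_def using c F sc by (intro finsum_rdistr[symmetric]) auto
      finally show ?thesis .
    qed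
    \<comment> \<open>The ambiguity of the \<open>l\<close>-th coefficient is an ideal that vanishes
      at \<open>N\<close> by independence of \<open>B\<close>. A multiplier
      \<open>t \<notin> N\<close> killing it for all \<open>l\<close> makes \<open>t \<beta>\<close>
      independent of the representation.\<close>
    let ?K = "\<lambda>l. {\<beta> c l | c. c \<in> F \<rightarrow> carrier R \<and> p_comb F (\<lambda>x. x) c = \<zero>}"
    have "\<exists>t\<in>carrier R - N. \<forall>l\<in>B. \<forall>k\<in>?K l. t \<otimes> k = \<zero>"
    proof (rule common_multiplier[OF N fB])
      fix l assume l: "l \<in> B"
      have "ideal (?K l) R"
      proof (rule ideal_from_closure)
        show "?K l \<subseteq> carrier R" using \<beta>c l by auto
        have "p_comb F (\<lambda>x. x) (\<lambda>_. \<zero>) = \<zero>"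
          unfolding p_comb_def using F(2) by (intro add.finprod_one_eqI) (auto simp: frobenius_zero)
        moreover have "\<beta> (\<lambda>_. \<zero>) l = \<zero>"
          unfolding \<beta>_def using bc l by (intro add.finprod_one_eqI) auto
        ultimately show "\<zero> \<in> ?K l" by (intro CollectI exI[of _ "\<lambda>_. \<zero>"]) auto
      next
        fix k k' assume "k \<in> ?K l" "k' \<in> ?K l"
        then obtain c d where cd: "k = \<beta> c l" "c \<in> F \<rightarrow> carrier R" "p_comb F (\<lambda>x. x) c = \<zero>"
          "k' = \<beta> d l" "d \<in> F \<rightarrow> carrier R" "p_comb F (\<lambda>x. x) d = \<zero>" by blast
        have "(\<lambda>i. c i \<oplus> d i) \<in> F \<rightarrow> carrier R" using cd by (auto simp: Pi_iff)
        then show "k \<oplus> k' \<in> ?K l"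
          using cd p_comb_add[OF idF cd(2,5)] \<beta>_add[OF cd(2,5) l]
          by (intro CollectI exI[of _ "\<lambda>i. c i \<oplus> d i"]) simp
      next
        fix k r assume "k \<in> ?K l" and r: "r \<in> carrier R"
        then obtain c where c: "k = \<beta> c l" "c \<in> F \<rightarrow> carrier R" "p_comb F (\<lambda>x. x) c = \<zero>" by blast
        have "(\<lambda>i. r \<otimes> c i) \<in> F \<rightarrow> carrier R" using c r by (auto simp: Pi_iff)
        then show "r \<otimes> k \<in> ?K l"
          using c r p_comb_smult[OF idF c(2) r F(1)] \<beta>_smult[OF c(2) r l]
          by (intro CollectI exI[of _ "\<lambda>i. r \<otimes> c i"]) simp
      qed
      moreover have "\<exists>v\<in>carrier R - N. v \<otimes> k = \<zero>" if "k \<in> ?K l" for k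
      proof -
        obtain c where c: "k = \<beta> c l" "c \<in> F \<rightarrow> carrier R" "p_comb F (\<lambda>x. x) c = \<zero>" using \<open>k \<in> ?K l\<close> by blast
        have "\<beta> c \<in> B \<rightarrow> carrier R" using \<beta>c[OF c(2)] by blast
        moreover have "p_comb B (\<lambda>x. x) (\<beta> c) = \<zero>" using \<beta>_comb[OF c(2)] c(3) sc by simp
        ultimately show ?thesis unfolding c(1) by (rule ind[OF _ _ l])
      qed
      ultimately show "\<exists>t\<in>carrier R - N. \<forall>k\<in>?K l. t \<otimes> k = \<zero>"
        by (rule locally_zero_ideal_annihilated[OF N])
      fix t u assume tu: "t \<in> carrier R - N" "u \<in> carrier R - N" "\<forall>k\<in>?K l. t \<otimes> k = \<zero>"
      have "u \<otimes> t \<otimes> k = \<zero>" if "k \<in> ?K l" for k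
      proof -
        have "k \<in> carrier R" using that \<beta>c l by auto
        then have "u \<otimes> t \<otimes> k = u \<otimes> (t \<otimes> k)" using tu by (simp add: m_assoc)
        then show ?thesis using tu that by simp
      qed
      then show "\<forall>k\<in>?K l. u \<otimes> t \<otimes> k = \<zero>" by blast
    qed
    then obtain t where t: "t \<in> carrier R - N" and tK: "\<forall>l\<in>B. \<forall>k\<in>?K l. t \<otimes> k = \<zero>" by blast
    have tc: "t \<in> carrier R" using t by simp
    have t\<beta>_eq: "t \<otimes> \<beta> c l = t \<otimes> \<beta> d l"
      if c: "c \<in> F \<rightarrow> carrier R" and d: "d \<in> F \<rightarrow> carrier R" and l: "l \<in> B"
        and cd: "p_comb F (\<lambda>x. x) c = p_comb F (\<lambda>x. x) d" for c d l
    proof -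
      let ?e = "\<lambda>i. c i \<ominus> d i"
      have e: "?e \<in> F \<rightarrow> carrier R" using c d by (auto simp: Pi_iff)
      have "p_comb F (\<lambda>x. x) ?e = \<zero>"
        using p_comb_minus[OF idF c d] cd p_comb_closed[OF idF d] by (simp add: a_minus_def r_neg)
      then have "\<beta> ?e l \<in> ?K l" using e by blast
      then have te: "t \<otimes> \<beta> ?e l = \<zero>" using tK l by blast
      have "\<beta> c l = \<beta> (\<lambda>i. ?e i \<oplus> d i) l"
        unfolding \<beta>_def
      proof (rule finsum_cong')
        fix i assume "i \<in> F"
        then have "c i \<in> carrier R" "d i \<in> carrier R" using c d by auto
        then have "(c i \<ominus> d i) \<oplus> d i = c i" by algebra
        then show "c i \<otimes> b i l = ((c i \<ominus> d i) \<oplus> d i) \<otimes> b i l" by simp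
      qed (use e d bc l in \<open>auto simp: Pi_iff\<close>)
      then have "\<beta> c l = \<beta> ?e l \<oplus> \<beta> d l" using \<beta>_add[OF e d l] by simp
      then have "t \<otimes> \<beta> c l = t \<otimes> \<beta> ?e l \<oplus> t \<otimes> \<beta> d l"
        using r_distr[OF \<beta>c[OF e l] \<beta>c[OF d l] tc] by simp
      then show ?thesis using te \<beta>c[OF d l] tc by simp
    qed
    define rep where "rep = (\<lambda>y. SOME c. c \<in> F \<rightarrow> carrier R \<and> y = p_comb F (\<lambda>x. x) c)"
    have rep: "rep y \<in> F \<rightarrow> carrier R \<and> y = p_comb F (\<lambda>x. x) (rep y)" if y: "y \<in> carrier R" for y
    proof -
      have "\<exists>c. c \<in> F \<rightarrow> carrier R \<and> y = p_comb F (\<lambda>x. x) c"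
        using gen y unfolding p_generates_def by blast
      then show ?thesis unfolding rep_def by (rule someI_ex)
    qed
    have t\<beta>_rep: "t \<otimes> \<beta> (rep y) l = t \<otimes> \<beta> c l"
      if "c \<in> F \<rightarrow> carrier R" "y = p_comb F (\<lambda>x. x) c" "l \<in> B" for y c l
    proof -
      have "y \<in> carrier R" using p_comb_closed[OF idF that(1)] that(2) by simp
      then show ?thesis using rep[of y] that by (intro t\<beta>_eq) auto
    qed
    let ?\<phi> = "\<lambda>l y. t \<otimes> \<beta> (rep y) l"
    have \<phi>: "?\<phi> l \<in> cartier_maps p" if l: "l \<in> B" for l
      unfolding cartier_maps_def
    proof (intro CollectI conjI ballI)
      show "?\<phi> l \<in> carrier R \<rightarrow> carrier R" using rep \<beta>c l tc by auto
    next
      fix y z assume yz: "y \<in> carrier R" "z \<in> carrier R"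
      note ry = conjunct1[OF rep[OF yz(1)]] conjunct2[OF rep[OF yz(1)]]
      note rz = conjunct1[OF rep[OF yz(2)]] conjunct2[OF rep[OF yz(2)]]
      have "(\<lambda>i. rep y i \<oplus> rep z i) \<in> F \<rightarrow> carrier R" using ry(1) rz(1) by (auto simp: Pi_iff)
      moreover have "y \<oplus> z = p_comb F (\<lambda>x. x) (\<lambda>i. rep y i \<oplus> rep z i)"
        using p_comb_add[OF idF ry(1) rz(1)] ry(2) rz(2) by simp
      ultimately have "?\<phi> l (y \<oplus> z) = t \<otimes> \<beta> (\<lambda>i. rep y i \<oplus> rep z i) l" by (rule t\<beta>_rep[OF _ _ l])
      also have "\<dots> = ?\<phi> l y \<oplus> ?\<phi> l z"
        unfolding \<beta>_add[OF ry(1) rz(1) l] by (rule r_distr[OF \<beta>c[OF ry(1) l] \<beta>c[OF rz(1) l] tc])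
      finally show "?\<phi> l (y \<oplus> z) = ?\<phi> l y \<oplus> ?\<phi> l z" .
    next
      fix a y assume ay: "a \<in> carrier R" "y \<in> carrier R"
      note ry = conjunct1[OF rep[OF ay(2)]] conjunct2[OF rep[OF ay(2)]]
      have "(\<lambda>i. a \<otimes> rep y i) \<in> F \<rightarrow> carrier R" using ry(1) ay(1) by (auto simp: Pi_iff)
      moreover have "a [^] p \<otimes> y = p_comb F (\<lambda>x. x) (\<lambda>i. a \<otimes> rep y i)"
        using p_comb_smult[OF idF ry(1) ay(1) F(1)] ry(2) by simp
      ultimately have "?\<phi> l (a [^] p \<otimes> y) = t \<otimes> \<beta> (\<lambda>i. a \<otimes> rep y i) l" by (rule t\<beta>_rep[OF _ _ l])
      also have "\<dots> = a \<otimes> ?\<phi> l y"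
        unfolding \<beta>_smult[OF ry(1) ay(1) l] by (rule m_lcomm[OF tc ay(1) \<beta>c[OF ry(1) l]])
      finally show "?\<phi> l (a [^] p \<otimes> y) = a \<otimes> ?\<phi> l y" .
    qed
    note rx = conjunct1[OF rep[OF x]] conjunct2[OF rep[OF x]]
    have \<beta>x: "\<beta> (rep x) \<in> B \<rightarrow> carrier R" using \<beta>c[OF rx(1)] by blast
    \<comment> \<open>The coefficients are values at \<open>x\<close> of Cartier maps, hence in
      \<open>J\<close>. The combination equals \<open>(t s)^p x\<close>, which puts
      \<open>t s\<close> into \<open>?D\<close> although it is outside \<open>N\<close>.\<close>
    have "p_comb B (\<lambda>x. x) (\<lambda>l. t \<otimes> \<beta> (rep x) l) \<in> ?I"
      by (rule p_comb_in_ideal[OF idB Iid], rule frobenius_power_mem[OF J], rule bspec[OF \<phi>J \<phi>])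
    moreover have "p_comb B (\<lambda>x. x) (\<lambda>l. t \<otimes> \<beta> (rep x) l) = (t \<otimes> s) [^] p \<otimes> x"
      using p_comb_smult[OF idB \<beta>x tc fB] \<beta>_comb[OF rx(1)] rx(2) tc sc x
      by (simp add: nat_pow_distrib m_assoc)
    ultimately have "t \<otimes> s \<in> ?D" using tc sc by simp
    then show False using DN prime_Compl_mult[OF N t s(1)] by blast
  qed
  then show "x \<in> ?I" using x by simp
qed

end

section \<open>Frobenius powers, colon ideals and Frobenius roots\<close>

context cring
begin

lemma cartier_mapsD:
  assumes "\<phi> \<in> cartier_maps q"
  shows "x \<in> carrier R \<Longrightarrow> \<phi> x \<in> carrier R"
    and "x \<in> carrier R \<Longrightarrow> y \<in> carrier R \<Longrightarrow> \<phi> (x \<oplus> y) = \<phi> x \<oplus> \<phi> y"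
    and "a \<in> carrier R \<Longrightarrow> x \<in> carrier R \<Longrightarrow> \<phi> (a [^] q \<otimes> x) = a \<otimes> \<phi> x"
  using assms unfolding cartier_maps_def by auto

lemma id_cartier_map: "(\<lambda>x. x) \<in> cartier_maps 1"
  unfolding cartier_maps_def by simp

lemma cartier_maps_comp:
  assumes \<phi>: "\<phi> \<in> cartier_maps q" and \<psi>: "\<psi> \<in> cartier_maps q'"
  shows "(\<lambda>x. \<phi> (\<psi> x)) \<in> cartier_maps (q * q')"
  unfolding cartier_maps_def
proof (intro CollectI conjI ballI)
  fix a x assume "a \<in> carrier R" "x \<in> carrier R"
  then show "\<phi> (\<psi> (a [^] (q * q') \<otimes> x)) = a \<otimes> \<phi> (\<psi> x)"
    using cartier_mapsD[OF \<phi>] cartier_mapsD[OF \<psi>] by (simp flip: nat_pow_pow)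
qed (use cartier_mapsD[OF \<phi>] cartier_mapsD[OF \<psi>] in auto)

lemma cartier_detectsD:
  assumes "cartier_detects q" "ideal J R" "x \<in> carrier R" "\<And>\<phi>. \<phi> \<in> cartier_maps q \<Longrightarrow> \<phi> x \<in> J"
  shows "x \<in> frobenius_power R q J"
  using assms unfolding cartier_detects_def by blast

end

context noetherian_char_p_ring
begin

text \<open>The converse of detection, which holds for every Cartier map because
  \<open>\<phi> (r u^q) = u (\<phi> r)\<close>.\<close>

lemma cartier_map_frobenius_power:
  assumes \<phi>: "\<phi> \<in> cartier_maps q" and J: "ideal J R" and x: "x \<in> frobenius_power R q J"
  shows "\<phi> x \<in> J"
proof -
  note \<phi>D = cartier_mapsD[OF \<phi>]
  \<comment> \<open>\<open>\<phi>\<close> is linear only over \<open>q\<close>-th powers, so the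
    condition is imposed on all multiples of \<open>x\<close> in order to define an ideal.\<close>
  let ?K = "{x \<in> carrier R. \<forall>r\<in>carrier R. \<phi> (r \<otimes> x) \<in> J}"
  have "\<phi> (\<zero> \<oplus> \<zero>) = \<phi> \<zero> \<oplus> \<phi> \<zero>" using \<phi>D(2) by blast
  then have \<phi>0: "\<phi> \<zero> = \<zero>" using \<phi>D(1)[OF zero_closed] by simp
  have "ideal ?K R"
  proof (rule ideal_from_closure)
    show "\<zero> \<in> ?K" using \<phi>0 ideal_zero[OF J] by simp
    fix a b assume "a \<in> ?K" "b \<in> ?K"
    then show "a \<oplus> b \<in> ?K" using \<phi>D(2) ideal_add[OF J] by (simp add: r_distr)
  next
    fix a r assume a: "a \<in> ?K" and r: "r \<in> carrier R"
    have "\<phi> (s \<otimes> (r \<otimes> a)) \<in> J" if "s \<in> carrier R" for s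
      using a r that by (simp flip: m_assoc)
    then show "r \<otimes> a \<in> ?K" using a r by simp
  qed auto
  moreover have "u [^] q \<in> ?K" if u: "u \<in> J" for u
  proof -
    have uc: "u \<in> carrier R" by (rule ideal.Icarr[OF J u])
    have "\<phi> (r \<otimes> u [^] q) \<in> J" if r: "r \<in> carrier R" for r
    proof -
      have "\<phi> (r \<otimes> u [^] q) = u \<otimes> \<phi> r" using m_comm[OF r, of "u [^] q"] \<phi>D(3)[OF uc r] uc by simp
      then show ?thesis using ideal.I_r_closed[OF J u \<phi>D(1)[OF r]] by simp
    qed
    then show ?thesis using uc by simp
  qed
  ultimately have "x \<in> ?K" using frobenius_power_minimal x by blast
  then have "\<phi> (\<one> \<otimes> x) \<in> J" "x \<in> carrier R" by blast+
  then show ?thesis by simp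
qed

lemma frobenius_power_frobenius_power:
  assumes J: "ideal J R"
  shows "frobenius_power R p (frobenius_power R q J) \<subseteq> frobenius_power R (q * p) J"
proof (rule frobenius_power_minimal)
  let ?I = "frobenius_power R (q * p) J"
  show Iid: "ideal ?I R" by (rule frobenius_power_ideal[OF J])
  have "frobenius_power R q J \<subseteq> {v \<in> carrier R. v [^] p \<in> ?I}"
  proof (rule frobenius_power_minimal[OF ideal_frobenius_preimage[OF Iid]])
    fix u assume u: "u \<in> J"
    then have "u \<in> carrier R" using ideal.Icarr[OF J] by blast
    then show "u [^] q \<in> {v \<in> carrier R. v [^] p \<in> ?I}"
      using frobenius_power_mem[OF J u, of "q * p"] by (simp add: nat_pow_pow)
  qed
  then show "u [^] p \<in> ?I" if "u \<in> frobenius_power R q J" for u using that by blast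
qed

lemma frobenius_power_mult_subset:
  assumes J: "ideal J R"
  shows "frobenius_power R (q * q') J \<subseteq> frobenius_power R q' (frobenius_power R q J)"
proof (rule frobenius_power_minimal)
  show "ideal (frobenius_power R q' (frobenius_power R q J)) R"
    by (intro frobenius_power_ideal J)
  fix u assume u: "u \<in> J"
  then have "u \<in> carrier R" using ideal.Icarr[OF J] by blast
  then show "u [^] (q * q') \<in> frobenius_power R q' (frobenius_power R q J)"
    using frobenius_power_mem[OF frobenius_power_ideal[OF J] frobenius_power_mem[OF J u, of q], of q']
    by (simp add: nat_pow_pow)
qed

lemma frobenius_power_one:
  assumes J: "ideal J R"
  shows "frobenius_power R 1 J = J"
proof -
  have "(\<lambda>u. u [^] (1::nat)) ` J = (\<lambda>u. u) ` J"
    using ideal.Icarr[OF J] by (intro image_cong) auto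
  then show ?thesis unfolding frobenius_power_def using Idl_of_ideal[OF J] by simp
qed

text \<open>Composing a Cartier map for \<open>p\<close> with one for \<open>p^e\<close> gives one
  for \<open>p^(e+1)\<close>, so membership can be detected in two stages.\<close>

lemma cartier_detects_power:
  assumes "cartier_detects p"
  shows "cartier_detects (p ^ e)"
proof (induction e)
  case 0
  show ?case
    unfolding cartier_detects_def
  proof (intro ballI allI impI)
    fix x J assume "ideal J R" "\<forall>\<phi>\<in>cartier_maps (p ^ 0). \<phi> x \<in> J"
    then show "x \<in> frobenius_power R (p ^ 0) J"
      using id_cartier_map frobenius_power_one by auto
  qed
next
  case (Suc e)
  let ?q = "p ^ e"
  show ?case
    unfolding cartier_detects_def
  proof (intro ballI allI impI)
    fix x J assume x: "x \<in> carrier R" and J: "ideal J R" and *: "\<forall>\<phi>\<in>cartier_maps (p ^ Suc e). \<phi> x \<in> J"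
    have "x \<in> frobenius_power R p (frobenius_power R ?q J)"
    proof (rule cartier_detectsD[OF assms frobenius_power_ideal[OF J] x])
      fix \<psi> assume \<psi>: "\<psi> \<in> cartier_maps p"
      show "\<psi> x \<in> frobenius_power R ?q J"
      proof (rule cartier_detectsD[OF Suc.IH J cartier_mapsD(1)[OF \<psi> x]])
        fix \<phi> assume "\<phi> \<in> cartier_maps ?q"
        then have "(\<lambda>x. \<phi> (\<psi> x)) \<in> cartier_maps (?q * p)" using \<psi> by (rule cartier_maps_comp)
        then show "\<phi> (\<psi> x) \<in> J" using bspec[OF *, of "\<lambda>x. \<phi> (\<psi> x)"] by (simp add: mult.commute)
      qed
    qed
    then show "x \<in> frobenius_power R (p ^ Suc e) J"
      using frobenius_power_frobenius_power[OF J, of ?q] by (auto simp: mult.commute)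
  qed
qed

text \<open>The nontrivial inclusion in \<open>(I^[q] : h^q) = (I : h)^[q]\<close>, the place where
  flatness of Frobenius acts: a Cartier map sends \<open>x h^q\<close> to
  \<open>h (\<phi> x)\<close>.\<close>

lemma frobenius_power_colon:
  assumes "cartier_detects q" and I: "ideal I R" and x: "x \<in> carrier R" and h: "h \<in> carrier R"
    and xh: "x \<otimes> h [^] q \<in> frobenius_power R q I"
  shows "x \<in> frobenius_power R q {r \<in> carrier R. r \<otimes> h \<in> I}"
proof (rule cartier_detectsD[OF assms(1) ideal_colon[OF I h] x])
  fix \<phi> assume \<phi>: "\<phi> \<in> cartier_maps q"
  have "\<phi> (x \<otimes> h [^] q) \<in> I" by (rule cartier_map_frobenius_power[OF \<phi> I xh])
  also have "\<phi> (x \<otimes> h [^] q) = \<phi> x \<otimes> h"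
    using m_comm[OF x, of "h [^] q"] cartier_mapsD(3)[OF \<phi> h x] m_comm[OF cartier_mapsD(1)[OF \<phi> x] h] h
    by simp
  finally show "\<phi> x \<in> {r \<in> carrier R. r \<otimes> h \<in> I}" using cartier_mapsD(1)[OF \<phi> x] by simp
qed

text \<open>The root is generated by all the values \<open>\<phi> b\<close> with
  \<open>b \<in> B\<close>, since \<open>B \<subseteq> J^[q]\<close> means exactly that these values
  lie in \<open>J\<close>.\<close>

lemma frobenius_root_least:
  assumes det: "cartier_detects q" and B: "B \<subseteq> carrier R"
  shows "ideal (frobenius_root R q B) R \<and> B \<subseteq> frobenius_power R q (frobenius_root R q B) \<and>
    (\<forall>I. ideal I R \<and> B \<subseteq> frobenius_power R q I \<longrightarrow> frobenius_root R q B \<subseteq> I)"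
  unfolding frobenius_root_def
proof (rule theI')
  let ?P = "\<lambda>J. ideal J R \<and> B \<subseteq> frobenius_power R q J \<and>
     (\<forall>I. ideal I R \<and> B \<subseteq> frobenius_power R q I \<longrightarrow> J \<subseteq> I)"
  let ?G = "{\<phi> b | \<phi> b. \<phi> \<in> cartier_maps q \<and> b \<in> B}"
  have G: "?G \<subseteq> carrier R" using cartier_mapsD(1) B by blast
  have Gid: "ideal (Idl ?G) R" by (rule genideal_ideal[OF G])
  have "B \<subseteq> frobenius_power R q (Idl ?G)"
  proof
    fix b assume b: "b \<in> B"
    show "b \<in> frobenius_power R q (Idl ?G)"
    proof (rule cartier_detectsD[OF det Gid])
      show "\<phi> b \<in> Idl ?G" if "\<phi> \<in> cartier_maps q" for \<phi> using genideal_self[OF G] that b by blast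
    qed (use B b in auto)
  qed
  moreover have "Idl ?G \<subseteq> I" if "ideal I R" "B \<subseteq> frobenius_power R q I" for I
  proof (rule genideal_minimal[OF that(1)])
    show "?G \<subseteq> I" using cartier_map_frobenius_power[OF _ that(1)] that(2) by auto
  qed
  ultimately have P: "?P (Idl ?G)" using Gid by simp
  then show "\<exists>!J. ?P J"
  proof (rule ex1I)
    fix J assume J: "?P J"
    show "J = Idl ?G"
    proof
      show "J \<subseteq> Idl ?G" using J P by blast
      show "Idl ?G \<subseteq> J" using J P by blast
    qed
  qed
qed

lemma frobenius_root_subset_iff:
  assumes det: "cartier_detects q" and B: "B \<subseteq> carrier R" and I: "ideal I R"
  shows "frobenius_root R q B \<subseteq> I \<longleftrightarrow> B \<subseteq> frobenius_power R q I"
proof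
  note root = frobenius_root_least[OF det B]
  show "B \<subseteq> frobenius_power R q I" if "frobenius_root R q B \<subseteq> I"
    using frobenius_power_mono[OF I that, of q] root by blast
  show "frobenius_root R q B \<subseteq> I" if "B \<subseteq> frobenius_power R q I" using root I that by blast
qed

end

section \<open>The ideal \<open>\<tau>\<close>\<close>

context cring
begin

lemma carrier_ideals_set: "I \<in> carrier (ideals_set R) \<longleftrightarrow> ideal I R"
  unfolding ideals_set_def by simp

lemma mult_ideals_set: "I \<otimes>\<^bsub>ideals_set R\<^esub> J = I \<cdot> J"
  unfolding ideals_set_def by simp

lemma monoid_ideals_set: "monoid (ideals_set R)"
  using ideals_set_is_comm_monoid by (rule comm_monoid.axioms(1))

lemma ideal_power_ideal:
  assumes "ideal I R"
  shows "ideal (I [^]\<^bsub>ideals_set R\<^esub> (n::nat)) R"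
  using monoid.nat_pow_closed[OF monoid_ideals_set] assms unfolding carrier_ideals_set .

lemma ideal_power_mem:
  assumes "ideal I R" "h \<in> I"
  shows "h [^] n \<in> I [^]\<^bsub>ideals_set R\<^esub> (n::nat)"
proof (induction n)
  case 0
  have "I [^]\<^bsub>ideals_set R\<^esub> (0::nat) = carrier R"
    unfolding monoid.nat_pow_0[OF monoid_ideals_set] ideals_set_def by simp
  then show ?case by simp
next
  case (Suc n)
  have "h [^] n \<otimes> h \<in> (I [^]\<^bsub>ideals_set R\<^esub> n) \<cdot> I" by (rule ideal_prod.prod[OF Suc assms(2)])
  then show ?case unfolding monoid.nat_pow_Suc[OF monoid_ideals_set] mult_ideals_set nat_pow_Suc .
qed

lemma ideal_power_power_mem:
  assumes "ideal I R" "h \<in> I [^]\<^bsub>ideals_set R\<^esub> (k::nat)"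
  shows "h [^] n \<in> I [^]\<^bsub>ideals_set R\<^esub> (k * n)"
proof -
  have "(I [^]\<^bsub>ideals_set R\<^esub> k) [^]\<^bsub>ideals_set R\<^esub> n = I [^]\<^bsub>ideals_set R\<^esub> (k * n)"
    by (rule monoid.nat_pow_pow[OF monoid_ideals_set]) (simp only: carrier_ideals_set assms(1))
  then show ?thesis using ideal_power_mem[OF ideal_power_ideal[OF assms(1)] assms(2), of n] by metis
qed

lemma ideal_power_antimono:
  assumes I: "ideal I R" and "i \<le> j"
  shows "I [^]\<^bsub>ideals_set R\<^esub> (j::nat) \<subseteq> I [^]\<^bsub>ideals_set R\<^esub> i"
proof -
  have "I [^]\<^bsub>ideals_set R\<^esub> i \<otimes>\<^bsub>ideals_set R\<^esub> I [^]\<^bsub>ideals_set R\<^esub> (j - i) = I [^]\<^bsub>ideals_set R\<^esub> (i + (j - i))"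
    by (rule monoid.nat_pow_mult[OF monoid_ideals_set]) (simp only: carrier_ideals_set I)
  then have "I [^]\<^bsub>ideals_set R\<^esub> j = (I [^]\<^bsub>ideals_set R\<^esub> i) \<cdot> (I [^]\<^bsub>ideals_set R\<^esub> (j - i))"
    unfolding mult_ideals_set using assms(2) by simp
  then show ?thesis using ideal_prod_inter[OF ideal_power_ideal[OF I] ideal_power_ideal[OF I], of i "j - i"] by blast
qed

text \<open>The ceiling of \<open>c p^(e+k)\<close> is at most \<open>p^k\<close> times the ceiling
  of \<open>c p^e\<close>, and powers of an ideal decrease.\<close>

lemma scaled_ideal_power_mem:
  assumes I: "ideal I R" and h: "h \<in> scaled_ideal_power R p I c e"
  shows "h [^] (p ^ k) \<in> scaled_ideal_power R p I c (e + k)"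
proof -
  define n where "n = nat \<lceil>c * real p ^ e\<rceil>"
  have "c * real p ^ e \<le> real n" unfolding n_def by linarith
  then have "c * real p ^ e * real p ^ k \<le> real n * real p ^ k" by (intro mult_right_mono) auto
  then have "c * real p ^ (e + k) \<le> of_int (int (n * p ^ k))" by (simp add: power_add mult.assoc)
  then have "\<lceil>c * real p ^ (e + k)\<rceil> \<le> int (n * p ^ k)" by (rule ceiling_le)
  then have "nat \<lceil>c * real p ^ (e + k)\<rceil> \<le> n * p ^ k" by linarith
  then show ?thesis
    using ideal_power_power_mem[OF I h[unfolded scaled_ideal_power_def], of "p ^ k"] ideal_power_antimono[OF I]
    unfolding scaled_ideal_power_def n_def by blast
qed

lemma scaled_ideal_power_ideal: "ideal I R \<Longrightarrow> ideal (scaled_ideal_power R p I c e) R"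
  unfolding scaled_ideal_power_def by (rule ideal_power_ideal)

end

locale cartier_ring = noetherian_char_p_ring R p for R (structure) and p +
  fixes \<aa> :: "'a set" and c :: real
  assumes detects_p: "cartier_detects p" and ideal_\<aa>: "ideal \<aa> R"
begin

abbreviation "\<aa>_pow e \<equiv> scaled_ideal_power R p \<aa> c e"

lemma detects: "cartier_detects (p ^ e)"
  by (rule cartier_detects_power[OF detects_p])

lemma \<aa>_pow_subset: "\<aa>_pow e \<subseteq> carrier R"
  using ideal.Icarr[OF scaled_ideal_power_ideal[OF ideal_\<aa>]] by blast

lemma frobenius_root_ideal: "ideal (frobenius_root R (p ^ e) (\<aa>_pow e)) R"
  using frobenius_root_least[OF detects \<aa>_pow_subset] by blast

lemma tau_subset_iff:
  assumes "ideal J R"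
  shows "tau R p \<aa> c \<subseteq> J \<longleftrightarrow> (\<forall>e>0. \<aa>_pow e \<subseteq> frobenius_power R (p ^ e) J)"
  unfolding tau_def using frobenius_root_subset_iff[OF detects \<aa>_pow_subset assms] by (auto simp: UN_subset_iff)

text \<open>Let \<open>I\<close> be the next root and \<open>q = p^e\<close>. For
  \<open>h \<in> \<aa>_pow e\<close> the element \<open>h^p\<close> is in
  \<open>\<aa>_pow (Suc e)\<close>, hence in \<open>(I^[q])^[p]\<close>. The colon formula puts 1
  into \<open>(I^[q] : h)^[p]\<close>, and so into \<open>(I^[q] : h)\<close>.\<close>

lemma frobenius_root_Suc:
  "frobenius_root R (p ^ e) (\<aa>_pow e) \<subseteq> frobenius_root R (p ^ Suc e) (\<aa>_pow (Suc e))"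
proof -
  let ?I = "frobenius_root R (p ^ Suc e) (\<aa>_pow (Suc e))"
  have Iid: "ideal ?I R" by (rule frobenius_root_ideal)
  have "\<aa>_pow e \<subseteq> frobenius_power R (p ^ e) ?I"
  proof
    fix h assume h: "h \<in> \<aa>_pow e"
    have hc: "h \<in> carrier R" using h \<aa>_pow_subset by blast
    let ?C = "{r \<in> carrier R. r \<otimes> h \<in> frobenius_power R (p ^ e) ?I}"
    have id: "ideal (frobenius_power R (p ^ e) ?I) R" by (rule frobenius_power_ideal[OF Iid])
    have Cid: "ideal ?C R" by (rule ideal_colon[OF id hc])
    have "h [^] p \<in> \<aa>_pow (Suc e)" using scaled_ideal_power_mem[OF ideal_\<aa> h, of 1] by simp
    then have "h [^] p \<in> frobenius_power R (p ^ Suc e) ?I"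
      using frobenius_root_least[OF detects \<aa>_pow_subset] by blast
    then have "h [^] p \<in> frobenius_power R p (frobenius_power R (p ^ e) ?I)"
      using frobenius_power_mult_subset[OF Iid, of "p ^ e" p] by (auto simp: mult.commute)
    then have "\<one> \<in> frobenius_power R p ?C" using hc by (intro frobenius_power_colon detects_p id) auto
    moreover have "frobenius_power R p ?C \<subseteq> ?C"
      using ideal_pow_mem[OF Cid] p_gt_1 by (intro frobenius_power_minimal[OF Cid]) auto
    ultimately have "\<one> \<in> ?C" by blast
    then show "h \<in> frobenius_power R (p ^ e) ?I" using hc by simp
  qed
  then show ?thesis using frobenius_root_subset_iff[OF detects \<aa>_pow_subset Iid] by blast
qed

lemma tau_ideal: "ideal (tau R p \<aa> c) R"
proof -
  let ?J = "\<lambda>e. frobenius_root R (p ^ e) (\<aa>_pow e)"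
  have mono: "?J i \<subseteq> ?J j" if "i \<le> j" for i j
    using lift_Suc_mono_le[of ?J, OF frobenius_root_Suc that] .
  note id = frobenius_root_ideal
  show ?thesis
    unfolding tau_def
  proof (rule ideal_from_closure)
    show "(\<Union>e\<in>{0<..}. ?J e) \<subseteq> carrier R" using ideal.Icarr[OF id] by blast
    show "\<zero> \<in> (\<Union>e\<in>{0<..}. ?J e)" using ideal_zero[OF id, of 1] by (intro UN_I[of 1]) auto
    fix a b assume "a \<in> (\<Union>e\<in>{0<..}. ?J e)" "b \<in> (\<Union>e\<in>{0<..}. ?J e)"
    then obtain i j where ij: "0 < i" "a \<in> ?J i" "0 < j" "b \<in> ?J j" by auto
    then have "a \<in> ?J (max i j)" "b \<in> ?J (max i j)" using mono[of i "max i j"] mono[of j "max i j"] by auto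
    then have "a \<oplus> b \<in> ?J (max i j)" by (rule ideal_add[OF id])
    then show "a \<oplus> b \<in> (\<Union>e\<in>{0<..}. ?J e)" using ij by (intro UN_I[of "max i j"]) auto
  next
    fix a r assume "a \<in> (\<Union>e\<in>{0<..}. ?J e)" "r \<in> carrier R"
    then show "r \<otimes> a \<in> (\<Union>e\<in>{0<..}. ?J e)" using ideal.I_l_closed[OF id] by blast
  qed
qed

text \<open>The intersection \<open>V\<close> of the ideals \<open>N\<^bsup>[p^e]\<^esup>\<close> is stable under Cartier maps, hence
  \<open>V = V\<^bsup>[p]\<^esup> \<subseteq> N V\<close>; this replaces Krull's intersection theorem.\<close>

lemma Inter_frobenius_powers_locally_zero:
  assumes N: "primeideal N R" and v: "\<And>e. v \<in> frobenius_power R (p ^ e) N"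
  shows "\<exists>t\<in>carrier R - N. t \<otimes> v = \<zero>"
proof -
  have Nid: "ideal N R" by (rule primeideal.axioms(1)[OF N])
  let ?V = "\<Inter>e. frobenius_power R (p ^ e) N"
  have Vid: "ideal ?V R" by (rule i_Intersect) (auto intro: frobenius_power_ideal[OF Nid])
  have VN: "?V \<subseteq> N"
  proof -
    have "frobenius_power R (p ^ 0) N = N" using frobenius_power_one[OF Nid] by simp
    then show ?thesis by blast
  qed
  have Vp: "?V \<subseteq> frobenius_power R p ?V"
  proof
    fix w assume w: "w \<in> ?V"
    show "w \<in> frobenius_power R p ?V"
    proof (rule cartier_detectsD[OF detects_p Vid ideal.Icarr[OF Vid w]])
      fix \<phi> assume \<phi>: "\<phi> \<in> cartier_maps p"
      have "\<phi> w \<in> frobenius_power R (p ^ e) N" for e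
      proof (rule cartier_map_frobenius_power[OF \<phi> frobenius_power_ideal[OF Nid]])
        have "w \<in> frobenius_power R (p ^ Suc e) N" using w by blast
        then show "w \<in> frobenius_power R p (frobenius_power R (p ^ e) N)"
          using frobenius_power_mult_subset[OF Nid, of "p ^ e" p] by (auto simp: mult.commute)
      qed
      then show "\<phi> w \<in> ?V" by blast
    qed
  qed
  obtain q where q: "p = Suc q" "0 < q" using p_gt_1 by (cases p) auto
  have z: "\<zero> \<in> carrier R" by simp
  \<comment> \<open>The right side is the set of elements killed by something outside
    \<open>N\<close>, that is, the kernel of localization at \<open>N\<close>. For
    \<open>u \<in> ?V\<close> the factor \<open>u^(p-1)\<close> is in \<open>N\<close>, which is how
    Frobenius powers of \<open>?V\<close> get into \<open>N ?V\<close>.\<close>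
  have "?V \<subseteq> sat_add N {\<zero>} \<zero>"
  proof (rule nakayama[OF N, where B="{}"])
    show "?V \<subseteq> carrier R" using ideal.Icarr[OF Vid] by blast
    show "ideal (sat_add N {\<zero>} \<zero>) R" by (rule sat_add_ideal[OF N zeroideal z])
    show "saturated N (sat_add N {\<zero>} \<zero>)" by (rule sat_add_saturated[OF N zeroideal z])
    fix C assume C: "ideal C R" "\<And>n a. n \<in> N \<Longrightarrow> a \<in> ?V \<Longrightarrow> n \<otimes> a \<in> C"
    have "frobenius_power R p ?V \<subseteq> C"
    proof (rule frobenius_power_minimal[OF C(1)])
      fix u assume u: "u \<in> ?V"
      then have "u [^] q \<in> N" using ideal_pow_mem[OF Nid _ q(2)] VN by blast
      then show "u [^] p \<in> C" using C(2)[OF _ u] q(1) by simp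
    qed
    then show "?V \<subseteq> C" using Vp by blast
  qed simp
  then have "v \<in> sat_add N {\<zero>} \<zero>" using v by blast
  then obtain t r where "t \<in> carrier R" "t \<notin> N" "r \<in> carrier R" "t \<otimes> v = \<zero> \<oplus> r \<otimes> \<zero>"
    by (auto elim: sat_addE)
  then show ?thesis by auto
qed

text \<open>The tight closure condition with the tensors removed; \<open>J\<close> will be the
  annihilator of a module element.\<close>

lemma multiplier_iff_tau_subset:
  assumes J: "ideal J R"
  shows "(\<exists>u\<in>carrier R. (\<forall>P. minimal_prime R P \<longrightarrow> u \<notin> P) \<and>
      (\<forall>\<^sub>F e in sequentially. \<forall>h\<in>\<aa>_pow e. u \<otimes> h \<in> frobenius_power R (p ^ e) J))
    \<longleftrightarrow> tau R p \<aa> c \<subseteq> J"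
proof
  assume "tau R p \<aa> c \<subseteq> J"
  then have *: "\<And>e. 0 < e \<Longrightarrow> \<aa>_pow e \<subseteq> frobenius_power R (p ^ e) J" using tau_subset_iff[OF J] by simp
  \<comment> \<open>The multiplier 1 works from \<open>e = 1\<close> on, as \<open>tau\<close>
    collects the roots for positive \<open>e\<close>.\<close>
  have "\<one> \<otimes> h \<in> frobenius_power R (p ^ e) J" if "1 \<le> e" "h \<in> \<aa>_pow e" for e h
    using *[of e] that \<aa>_pow_subset[of e] by (auto simp: subset_iff)
  then have "\<forall>\<^sub>F e in sequentially. \<forall>h\<in>\<aa>_pow e. \<one> \<otimes> h \<in> frobenius_power R (p ^ e) J"
    unfolding eventually_sequentially by blast
  moreover have "\<forall>P. minimal_prime R P \<longrightarrow> \<one> \<notin> P"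
    unfolding minimal_prime_def using prime_one_notin by blast
  ultimately show "\<exists>u\<in>carrier R. (\<forall>P. minimal_prime R P \<longrightarrow> u \<notin> P) \<and>
      (\<forall>\<^sub>F e in sequentially. \<forall>h\<in>\<aa>_pow e. u \<otimes> h \<in> frobenius_power R (p ^ e) J)" by blast
next
  assume "\<exists>u\<in>carrier R. (\<forall>P. minimal_prime R P \<longrightarrow> u \<notin> P) \<and>
      (\<forall>\<^sub>F e in sequentially. \<forall>h\<in>\<aa>_pow e. u \<otimes> h \<in> frobenius_power R (p ^ e) J)"
  then obtain u k where u: "u \<in> carrier R" "\<And>P. minimal_prime R P \<Longrightarrow> u \<notin> P"
    and ev: "\<And>e h. k \<le> e \<Longrightarrow> h \<in> \<aa>_pow e \<Longrightarrow> u \<otimes> h \<in> frobenius_power R (p ^ e) J"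
    unfolding eventually_sequentially by blast
  have "h \<in> frobenius_power R (p ^ e) J" if h: "h \<in> \<aa>_pow e" for e h
  proof (rule ccontr)
    assume nh: "h \<notin> frobenius_power R (p ^ e) J"
    have hc: "h \<in> carrier R" using h \<aa>_pow_subset by blast
    let ?F = "frobenius_power R (p ^ e) J"
    let ?C = "{r \<in> carrier R. r \<otimes> h \<in> ?F}"
    have Fid: "ideal ?F R" by (rule frobenius_power_ideal[OF J])
    have Cid: "ideal ?C R" by (rule ideal_colon[OF Fid hc])
    have "\<one> \<notin> ?C" using nh hc by simp
    then obtain N where "maximalideal N R" and CN: "?C \<subseteq> N" by (rule exists_maximalideal[OF Cid])
    then have N: "primeideal N R" by (intro maximalideal_prime)
    have Nid: "ideal N R" by (rule primeideal.axioms(1)[OF N])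
    \<comment> \<open>One bad \<open>h\<close> yields all exponents: \<open>h^(p^i)\<close> is in
      \<open>\<aa>_pow (e + i)\<close>, so \<open>u h^(p^i)\<close> is in \<open>?F^[p^i]\<close>,
      and the colon formula puts \<open>u\<close> into \<open>?C^[p^i]\<close>. The proper ideal
      \<open>?C\<close>, and with it \<open>N\<close>, stays fixed while \<open>i\<close>
      varies.\<close>
    have large: "u \<in> frobenius_power R (p ^ i) N" if i: "k \<le> i" for i
    proof -
      have "h [^] (p ^ i) \<in> \<aa>_pow (e + i)" by (rule scaled_ideal_power_mem[OF ideal_\<aa> h])
      then have "u \<otimes> h [^] (p ^ i) \<in> frobenius_power R (p ^ (e + i)) J" using i by (intro ev) auto
      then have "u \<otimes> h [^] (p ^ i) \<in> frobenius_power R (p ^ i) ?F"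
        using frobenius_power_mult_subset[OF J, of "p ^ e" "p ^ i"] by (auto simp: power_add)
      then have "u \<in> frobenius_power R (p ^ i) ?C"
        by (rule frobenius_power_colon[OF detects Fid u(1) hc])
      then show ?thesis using frobenius_power_mono[OF Nid CN] by blast
    qed
    have dec: "frobenius_power R (p ^ Suc i) N \<subseteq> frobenius_power R (p ^ i) N" for i
    proof (rule frobenius_power_minimal[OF frobenius_power_ideal[OF Nid]])
      fix v assume v: "v \<in> N"
      then have vc: "v \<in> carrier R" using ideal.Icarr[OF Nid] by blast
      have "(v [^] (p ^ i)) [^] p \<in> frobenius_power R (p ^ i) N"
        using p_gt_1 by (intro ideal_pow_mem[OF frobenius_power_ideal[OF Nid] frobenius_power_mem[OF Nid v]]) auto
      then show "v [^] (p ^ Suc i) \<in> frobenius_power R (p ^ i) N"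
        using vc by (simp add: nat_pow_pow mult.commute)
    qed
    have "u \<in> frobenius_power R (p ^ i) N" for i
    proof -
      have "frobenius_power R (p ^ (k + i)) N \<subseteq> frobenius_power R (p ^ i) N"
        using lift_Suc_antimono_le[of "\<lambda>i. frobenius_power R (p ^ i) N", OF dec, of i "k + i"] by simp
      then show ?thesis using large[of "k + i"] by auto
    qed
    then obtain t where t: "t \<in> carrier R - N" "t \<otimes> u = \<zero>"
      using Inter_frobenius_powers_locally_zero[OF N] by blast
    \<comment> \<open>Since \<open>t u = 0\<close> and \<open>t \<notin> N\<close>, every prime
      inside \<open>N\<close> contains \<open>u\<close>; a minimal one contradicts the choice of
      \<open>u\<close>.\<close>
    obtain P where P: "minimal_prime R P" "P \<subseteq> N" by (rule exists_minimal_prime[OF N])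
    have Pp: "primeideal P R" using P(1) unfolding minimal_prime_def by blast
    have "t \<otimes> u \<in> P" using t(2) ideal_zero[OF primeideal.axioms(1)[OF Pp]] by simp
    then have "u \<in> P" using primeideal.I_prime[OF Pp _ u(1)] t(1) P(2) by blast
    then show False using u(2) P(1) by blast
  qed
  then show "tau R p \<aa> c \<subseteq> J" using tau_subset_iff[OF J] by blast
qed

end

section \<open>Tensor products with the Frobenius module\<close>

lemma frobenius_module_simps [simp]:
  "carrier (frobenius_module R p e) = carrier R"
  "x \<oplus>\<^bsub>frobenius_module R p e\<^esub> y = x \<oplus>\<^bsub>R\<^esub> y"
  "r \<odot>\<^bsub>frobenius_module R p e\<^esub> x = r [^]\<^bsub>R\<^esub> (p ^ e) \<otimes>\<^bsub>R\<^esub> x"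
  "\<zero>\<^bsub>frobenius_module R p e\<^esub> = \<zero>\<^bsub>R\<^esub>"
  unfolding frobenius_module_def restrict_scalars_def self_module_def by simp_all

lemma diff_free_Abelian_group:
  assumes "a \<in> carrier (free_Abelian_group S)" "b \<in> carrier (free_Abelian_group S)"
  shows "a - b \<in> carrier (free_Abelian_group S)"
    and "a - b = a \<otimes>\<^bsub>free_Abelian_group S\<^esub> inv\<^bsub>free_Abelian_group S\<^esub> b"
  using assms keys_diff[of a b] by auto

lemma subgroup_free_Abelian_group_closed:
  assumes K: "subgroup K (free_Abelian_group S)"
  shows "0 \<in> K" "a \<in> K \<Longrightarrow> b \<in> K \<Longrightarrow> a + b \<in> K" "a \<in> K \<Longrightarrow> b \<in> K \<Longrightarrow> a - b \<in> K"
proof -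
  show "0 \<in> K" using subgroup.one_closed[OF K] by simp
  show "a \<in> K \<Longrightarrow> b \<in> K \<Longrightarrow> a + b \<in> K" using subgroup.m_closed[OF K, of a b] by simp
  assume ab: "a \<in> K" "b \<in> K"
  then have "a \<in> carrier (free_Abelian_group S)" "b \<in> carrier (free_Abelian_group S)"
    using subgroup.mem_carrier[OF K] by blast+
  then have e: "a - b = a \<otimes>\<^bsub>free_Abelian_group S\<^esub> inv\<^bsub>free_Abelian_group S\<^esub> b"
    by (rule diff_free_Abelian_group(2))
  show "a - b \<in> K"
    unfolding e by (intro subgroup.m_closed[OF K] subgroup.m_inv_closed[OF K] ab)
qed

lemma tensor_relations_carrier:
  assumes "\<And>x x'. x \<in> carrier M \<Longrightarrow> x' \<in> carrier M \<Longrightarrow> x \<oplus>\<^bsub>M\<^esub> x' \<in> carrier M"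
    and "\<And>r x. r \<in> carrier R \<Longrightarrow> x \<in> carrier M \<Longrightarrow> r \<odot>\<^bsub>M\<^esub> x \<in> carrier M"
    and "\<And>y y'. y \<in> carrier N \<Longrightarrow> y' \<in> carrier N \<Longrightarrow> y \<oplus>\<^bsub>N\<^esub> y' \<in> carrier N"
    and "\<And>r y. r \<in> carrier R \<Longrightarrow> y \<in> carrier N \<Longrightarrow> r \<odot>\<^bsub>N\<^esub> y \<in> carrier N"
  shows "tensor_relations R M N \<subseteq> carrier (free_Abelian_group (carrier M \<times> carrier N))"
  unfolding tensor_relations_def
  by (auto simp del: carrier_free_Abelian_group_iff
      intro!: diff_free_Abelian_group(1) frag_of_in_free_Abelian_group[THEN iffD2] assms)

context noetherian_char_p_ring
begin

context
  fixes M :: "('a, 'c) module" and e :: nat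
  assumes M: "module R M"
begin

interpretation M: module R M by (rule M)

abbreviation "frob_kernel \<equiv> tensor_kernel R (frobenius_module R p e) M"
abbreviation "frob_free \<equiv> free_Abelian_group (carrier R \<times> carrier M)"

lemma frob_relations_carrier:
  "tensor_relations R (frobenius_module R p e) M \<subseteq> carrier frob_free"
  using tensor_relations_carrier[of "frobenius_module R p e" R M] by simp

lemma frob_kernel_subgroup: "subgroup frob_kernel frob_free"
  unfolding tensor_kernel_def frobenius_module_simps
  by (rule group.generate_is_subgroup[OF group_free_Abelian_group frob_relations_carrier])

lemmas frob_kernel_closed = subgroup_free_Abelian_group_closed[OF frob_kernel_subgroup]

lemma frob_relation: "z \<in> tensor_relations R (frobenius_module R p e) M \<Longrightarrow> z \<in> frob_kernel"
  unfolding tensor_kernel_def by (rule generate.incl)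

lemma frob_relation_add:
  assumes "x \<in> carrier R" "x' \<in> carrier R" "y \<in> carrier M"
  shows "frag_of (x \<oplus> x', y) - frag_of (x, y) - frag_of (x', y) \<in> frob_kernel"
  by (rule frob_relation) (use assms in \<open>unfold tensor_relations_def frobenius_module_simps, blast\<close>)

lemma frob_relation_add_right:
  assumes "x \<in> carrier R" "y \<in> carrier M" "y' \<in> carrier M"
  shows "frag_of (x, y \<oplus>\<^bsub>M\<^esub> y') - frag_of (x, y) - frag_of (x, y') \<in> frob_kernel"
  by (rule frob_relation) (use assms in \<open>unfold tensor_relations_def frobenius_module_simps, blast\<close>)

lemma frob_relation_smult:
  assumes "r \<in> carrier R" "x \<in> carrier R" "y \<in> carrier M"
  shows "frag_of (r [^] (p ^ e) \<otimes> x, y) - frag_of (x, r \<odot>\<^bsub>M\<^esub> y) \<in> frob_kernel"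
  by (rule frob_relation) (use assms in \<open>unfold tensor_relations_def frobenius_module_simps, blast\<close>)

lemma frob_zero_right:
  assumes "x \<in> carrier R"
  shows "frag_of (x, \<zero>\<^bsub>M\<^esub>) \<in> frob_kernel"
proof -
  have "frag_of (x, \<zero>\<^bsub>M\<^esub>) - frag_of (x, \<zero>\<^bsub>M\<^esub>) - frag_of (x, \<zero>\<^bsub>M\<^esub>) \<in> frob_kernel"
    using frob_relation_add_right[OF assms M.zero_closed M.zero_closed] by simp
  then show ?thesis using frob_kernel_closed(3)[OF frob_kernel_closed(1)] by fastforce
qed

lemma frob_zero_left:
  assumes "y \<in> carrier M"
  shows "frag_of (\<zero>, y) \<in> frob_kernel"
proof -
  have "frag_of (\<zero>, y) - frag_of (\<zero>, y) - frag_of (\<zero>, y) \<in> frob_kernel"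
    using frob_relation_add[OF zero_closed zero_closed assms] by simp
  then show ?thesis using frob_kernel_closed(3)[OF frob_kernel_closed(1)] by fastforce
qed

lemma annihilator_ideal:
  assumes "m \<in> carrier M"
  shows "ideal {r \<in> carrier R. r \<odot>\<^bsub>M\<^esub> m = \<zero>\<^bsub>M\<^esub>} R"
proof (rule ideal_from_closure)
  show "\<zero> \<in> {r \<in> carrier R. r \<odot>\<^bsub>M\<^esub> m = \<zero>\<^bsub>M\<^esub>}" using M.smult_l_null[OF assms] by simp
qed (use assms in \<open>auto simp: M.smult_l_distr M.smult_assoc1 M.smult_r_null\<close>)

text \<open>If \<open>u\<close> kills \<open>m\<close>, then
  \<open>u^q r \<otimes> m = r \<otimes> u m = 0\<close>. As for Cartier maps, requiring the
  vanishing for all multiples of \<open>y\<close> turns it into an ideal condition.\<close>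

lemma frob_kernel_of_frobenius_power:
  assumes m: "m \<in> carrier M" and y: "y \<in> frobenius_power R (p ^ e) {r \<in> carrier R. r \<odot>\<^bsub>M\<^esub> m = \<zero>\<^bsub>M\<^esub>}"
  shows "frag_of (y, m) \<in> frob_kernel"
proof -
  let ?K = "{y \<in> carrier R. \<forall>r\<in>carrier R. frag_of (r \<otimes> y, m) \<in> frob_kernel}"
  have "ideal ?K R"
  proof (rule ideal_from_closure)
    show "\<zero> \<in> ?K" using frob_zero_left[OF m] by simp
  next
    fix a b assume a: "a \<in> ?K" and b: "b \<in> ?K"
    have "frag_of (r \<otimes> (a \<oplus> b), m) \<in> frob_kernel" if r: "r \<in> carrier R" for r
    proof -
      have "frag_of (r \<otimes> a \<oplus> r \<otimes> b, m) - frag_of (r \<otimes> a, m) - frag_of (r \<otimes> b, m) \<in> frob_kernel"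
        using a b r by (intro frob_relation_add m) auto
      moreover have "frag_of (r \<otimes> a, m) \<in> frob_kernel" "frag_of (r \<otimes> b, m) \<in> frob_kernel"
        using a b r by auto
      ultimately have "frag_of (r \<otimes> a \<oplus> r \<otimes> b, m) - frag_of (r \<otimes> a, m) - frag_of (r \<otimes> b, m)
          + frag_of (r \<otimes> b, m) + frag_of (r \<otimes> a, m) \<in> frob_kernel"
        by (intro frob_kernel_closed(2))
      then show ?thesis using a b r by (simp add: r_distr)
    qed
    then show "a \<oplus> b \<in> ?K" using a b by simp
  next
    fix a s assume a: "a \<in> ?K" and s: "s \<in> carrier R"
    have "frag_of (r \<otimes> (s \<otimes> a), m) \<in> frob_kernel" if "r \<in> carrier R" for r
      using a s that by (simp flip: m_assoc)
    then show "s \<otimes> a \<in> ?K" using a s by simp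
  qed auto
  moreover have "u [^] (p ^ e) \<in> ?K" if u: "u \<in> {r \<in> carrier R. r \<odot>\<^bsub>M\<^esub> m = \<zero>\<^bsub>M\<^esub>}" for u
  proof -
    have "frag_of (r \<otimes> u [^] (p ^ e), m) \<in> frob_kernel" if r: "r \<in> carrier R" for r
    proof -
      have "frag_of (u [^] (p ^ e) \<otimes> r, m) - frag_of (r, u \<odot>\<^bsub>M\<^esub> m) \<in> frob_kernel"
        using u r m by (intro frob_relation_smult) auto
      moreover have "frag_of (r, u \<odot>\<^bsub>M\<^esub> m) \<in> frob_kernel" using u frob_zero_right[OF r] by simp
      ultimately have "frag_of (u [^] (p ^ e) \<otimes> r, m) - frag_of (r, u \<odot>\<^bsub>M\<^esub> m)
          + frag_of (r, u \<odot>\<^bsub>M\<^esub> m) \<in> frob_kernel" by (rule frob_kernel_closed(2))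
      then show ?thesis using u m_comm[OF r, of "u [^] (p ^ e)"] by simp
    qed
    then show ?thesis using u by simp
  qed
  ultimately have "y \<in> ?K" using frobenius_power_minimal y by blast
  then have "frag_of (\<one> \<otimes> y, m) \<in> frob_kernel" "y \<in> carrier R" by blast+
  then show ?thesis by simp
qed

text \<open>The map \<open>(x, n) \<mapsto> \<phi> x \<cdot> n\<close> is balanced, so it is defined on the tensor product.\<close>

lemma cartier_map_frob_kernel:
  assumes \<phi>: "\<phi> \<in> cartier_maps (p ^ e)" and y: "y \<in> carrier R" and m: "m \<in> carrier M"
    and ker: "frag_of (y, m) \<in> frob_kernel"
  shows "\<phi> y \<odot>\<^bsub>M\<^esub> m = \<zero>\<^bsub>M\<^esub>"
proof -
  note \<phi>D = cartier_mapsD[OF \<phi>]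
  let ?G = frob_free
  let ?f = "\<lambda>(x, n). \<phi> x \<odot>\<^bsub>M\<^esub> n"
  have f: "?f ` (carrier R \<times> carrier M) \<subseteq> carrier (add_monoid M)" using \<phi>D(1) by auto
  obtain h where h: "h \<in> hom ?G (add_monoid M)"
    and hf: "\<And>z. z \<in> carrier R \<times> carrier M \<Longrightarrow> h (frag_of z) = ?f z"
    by (rule comm_group.free_Abelian_group_universal[OF M.a_comm_group f], rule that)
  interpret h: group_hom ?G "add_monoid M" h
    by (intro group_hom.intro group_free_Abelian_group group_hom_axioms.intro h M.a_group)
  have hval: "h (frag_of (x, n)) = \<phi> x \<odot>\<^bsub>M\<^esub> n" if "x \<in> carrier R" "n \<in> carrier M" for x n
    using hf[of "(x, n)"] that by simp
  have fr: "frag_of (x, n) \<in> carrier ?G" if "x \<in> carrier R" "n \<in> carrier M" for x n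
    using that by (simp del: carrier_free_Abelian_group_iff)
  have hdiff: "h (a - b) = h a \<ominus>\<^bsub>M\<^esub> h b" if "a \<in> carrier ?G" "b \<in> carrier ?G" for a b
  proof -
    have "h (a - b) = h a \<otimes>\<^bsub>add_monoid M\<^esub> h (inv\<^bsub>?G\<^esub> b)"
      unfolding diff_free_Abelian_group(2)[OF that] by (intro h.hom_mult group.inv_closed[OF group_free_Abelian_group] that)
    also have "h (inv\<^bsub>?G\<^esub> b) = inv\<^bsub>add_monoid M\<^esub> (h b)" by (rule h.hom_inv[OF that(2)])
    finally show ?thesis by (simp add: a_minus_def a_inv_def)
  qed
  have cancel: "a \<oplus>\<^bsub>M\<^esub> b \<ominus>\<^bsub>M\<^esub> a \<ominus>\<^bsub>M\<^esub> b = \<zero>\<^bsub>M\<^esub>" if "a \<in> carrier M" "b \<in> carrier M" for a b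
  proof -
    have "a \<oplus>\<^bsub>M\<^esub> b \<ominus>\<^bsub>M\<^esub> a = b \<oplus>\<^bsub>M\<^esub> (a \<oplus>\<^bsub>M\<^esub> \<ominus>\<^bsub>M\<^esub> a)"
      using that by (simp only: a_minus_def M.a_comm[of a b] M.a_assoc M.a_inv_closed)
    then show ?thesis using that by (simp add: M.r_neg a_minus_def)
  qed
  have cancel2: "a \<ominus>\<^bsub>M\<^esub> a = \<zero>\<^bsub>M\<^esub>" if "a \<in> carrier M" for a
    using that by (simp add: a_minus_def M.r_neg)
  have "tensor_relations R (frobenius_module R p e) M \<subseteq> kernel ?G (add_monoid M) h"
  proof
    fix z assume z: "z \<in> tensor_relations R (frobenius_module R p e) M"
    have zG: "z \<in> carrier ?G" using frob_relations_carrier z by blast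
    consider (1) x x' n where "z = frag_of (x \<oplus> x', n) - frag_of (x, n) - frag_of (x', n)"
        "x \<in> carrier R" "x' \<in> carrier R" "n \<in> carrier M"
      | (2) x n n' where "z = frag_of (x, n \<oplus>\<^bsub>M\<^esub> n') - frag_of (x, n) - frag_of (x, n')"
        "x \<in> carrier R" "n \<in> carrier M" "n' \<in> carrier M"
      | (3) r x n where "z = frag_of (r [^] (p ^ e) \<otimes> x, n) - frag_of (x, r \<odot>\<^bsub>M\<^esub> n)"
        "r \<in> carrier R" "x \<in> carrier R" "n \<in> carrier M"
      using z unfolding tensor_relations_def frobenius_module_simps by blast
    then have "h z = \<zero>\<^bsub>M\<^esub>"
    proof cases
      case 1
      then show ?thesis
        using \<phi>D(1,2) by (simp add: hdiff fr diff_free_Abelian_group(1) hval M.smult_l_distr cancel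
            del: carrier_free_Abelian_group_iff)
    next
      case 2
      then show ?thesis
        using \<phi>D(1,2) by (simp add: hdiff fr diff_free_Abelian_group(1) hval M.smult_r_distr cancel
            del: carrier_free_Abelian_group_iff)
    next
      case 3
      then have "r \<otimes> \<phi> x = \<phi> x \<otimes> r" using \<phi>D(1) m_comm by simp
      then show ?thesis
        using 3 \<phi>D(1,3) by (simp add: hdiff fr diff_free_Abelian_group(1) hval M.smult_assoc1 cancel2
            del: carrier_free_Abelian_group_iff)
    qed
    then show "z \<in> kernel ?G (add_monoid M) h" using zG unfolding kernel_def by simp
  qed
  then have "frob_kernel \<subseteq> kernel ?G (add_monoid M) h"
    unfolding tensor_kernel_def frobenius_module_simps
    by (rule h.generate_subgroup_incl[OF _ h.subgroup_kernel])
  then have "h (frag_of (y, m)) = \<zero>\<^bsub>M\<^esub>" using ker unfolding kernel_def by auto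
  then show ?thesis using hval[OF y m] by simp
qed

text \<open>With \<open>J\<close> the annihilator of \<open>m\<close>, this identifies the left
  submodule of \<open>R^e \<otimes> M\<close> generated by \<open>1 \<otimes> m\<close> with
  \<open>R / J^[q]\<close>, a form of flatness. If \<open>y \<otimes> m\<close> vanishes, every
  \<open>\<phi> y\<close> kills \<open>m\<close>, and detection concludes.\<close>

lemma frag_of_frob_kernel_iff:
  assumes det: "cartier_detects (p ^ e)" and y: "y \<in> carrier R" and m: "m \<in> carrier M"
  shows "frag_of (y, m) \<in> frob_kernel \<longleftrightarrow>
    y \<in> frobenius_power R (p ^ e) {r \<in> carrier R. r \<odot>\<^bsub>M\<^esub> m = \<zero>\<^bsub>M\<^esub>}"
proof
  assume ker: "frag_of (y, m) \<in> frob_kernel"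
  show "y \<in> frobenius_power R (p ^ e) {r \<in> carrier R. r \<odot>\<^bsub>M\<^esub> m = \<zero>\<^bsub>M\<^esub>}"
  proof (rule cartier_detectsD[OF det annihilator_ideal[OF m] y])
    fix \<phi> assume \<phi>: "\<phi> \<in> cartier_maps (p ^ e)"
    then show "\<phi> y \<in> {r \<in> carrier R. r \<odot>\<^bsub>M\<^esub> m = \<zero>\<^bsub>M\<^esub>}"
      using cartier_map_frob_kernel[OF \<phi> y m ker] cartier_mapsD(1)[OF \<phi> y] by simp
  qed
qed (rule frob_kernel_of_frobenius_power[OF m])

text \<open>Every tensor over the zero module is a combination of symbols
  \<open>x \<otimes> 0\<close>, so the image is the neutral coset alone, which as a set is the
  kernel.\<close>

lemma frobenius_image_zero: "frobenius_image R p e M {\<zero>\<^bsub>M\<^esub>} = {frob_kernel}"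
proof -
  let ?M0 = "M\<lparr>carrier := {\<zero>\<^bsub>M\<^esub>}\<rparr>"
  let ?G0 = "free_Abelian_group (carrier R \<times> {\<zero>\<^bsub>M\<^esub>})"
  let ?K0 = "tensor_kernel R (frobenius_module R p e) ?M0"
  have "tensor_relations R (frobenius_module R p e) ?M0
      \<subseteq> carrier (free_Abelian_group (carrier (frobenius_module R p e) \<times> carrier ?M0))"
    by (rule tensor_relations_carrier) (auto simp: M.smult_r_null)
  then have K0: "subgroup ?K0 ?G0"
    unfolding tensor_kernel_def using group.generate_is_subgroup[OF group_free_Abelian_group] by simp
  have in_ker: "w \<in> frob_kernel" if "w \<in> carrier ?G0" for w
  proof -
    have "Poly_Mapping.keys w \<subseteq> carrier R \<times> {\<zero>\<^bsub>M\<^esub>}" using that by simp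
    then show ?thesis
      by (rule free_Abelian_group_induct[where P="\<lambda>w. w \<in> frob_kernel"])
        (use frob_kernel_closed frob_zero_right in auto)
  qed
  have "tensor_map R (frobenius_module R p e) M (\<lambda>y. y) (?K0 #>\<^bsub>?G0\<^esub> z) = frob_kernel"
    if z: "z \<in> carrier ?G0" for z
  proof -
    have ext: "frag_extend (\<lambda>(x, y). frag_of (x, y)) w = w" for w :: "('a \<times> 'c) \<Rightarrow>\<^sub>0 int"
      using frag_expansion[of w] by (simp add: case_prod_unfold)
    have coset: "frob_kernel #>\<^bsub>frob_free\<^esub> w = frob_kernel" if "w \<in> ?K0 #>\<^bsub>?G0\<^esub> z" for w
    proof -
      have "w \<in> carrier ?G0"
        using that monoid.r_coset_subset_G[OF group.is_monoid[OF group_free_Abelian_group] subgroup.subset[OF K0] z] by blast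
      then have "w \<in> frob_kernel" by (rule in_ker)
      then show ?thesis
        using subgroup.mem_carrier[OF frob_kernel_subgroup]
        by (intro group.coset_join2[OF group_free_Abelian_group] frob_kernel_subgroup) auto
    qed
    have "?K0 #>\<^bsub>?G0\<^esub> z \<noteq> {}"
      using group.rcos_self[OF group_free_Abelian_group z K0] by blast
    then show ?thesis
      unfolding tensor_map_def ext frobenius_module_simps using coset by auto
  qed
  moreover have "carrier (tensor_product R (frobenius_module R p e) ?M0) = (\<lambda>z. ?K0 #>\<^bsub>?G0\<^esub> z) ` carrier ?G0"
    unfolding tensor_product_def carrier_FactGroup by simp
  moreover have "carrier ?G0 \<noteq> {}" using subgroup.mem_carrier[OF K0 subgroup.one_closed[OF K0]] by blast
  ultimately show ?thesis unfolding frobenius_image_def by (auto simp: image_image)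
qed

lemma pure_tensor_eq_kernel_iff:
  assumes "y \<in> carrier R" "m \<in> carrier M"
  shows "pure_tensor R (frobenius_module R p e) M y m = frob_kernel \<longleftrightarrow> frag_of (y, m) \<in> frob_kernel"
proof -
  have c: "frag_of (y, m) \<in> carrier frob_free" using assms by (simp del: carrier_free_Abelian_group_iff)
  show ?thesis
    unfolding pure_tensor_def frobenius_module_simps
    using group.coset_join1[OF group_free_Abelian_group _ c frob_kernel_subgroup]
      group.coset_join2[OF group_free_Abelian_group c frob_kernel_subgroup] by blast
qed

end

end

text \<open>Vanishing of \<open>u h \<otimes> m\<close> becomes membership of \<open>u h\<close> in
  a Frobenius power of the annihilator of \<open>m\<close>, to which
  \<open>multiplier_iff_tau_subset\<close> applies.\<close>

lemma (in cartier_ring) tight_closure_zero: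
  assumes M: "module R (M :: ('a, 'c) module)"
  shows "tight_closure R p \<aa> c M {\<zero>\<^bsub>M\<^esub>}
    = {m \<in> carrier M. tau R p \<aa> c \<subseteq> {r \<in> carrier R. r \<odot>\<^bsub>M\<^esub> m = \<zero>\<^bsub>M\<^esub>}}"
proof -
  have "({pure_tensor R (frobenius_module R p e) M (u \<otimes> h) m | h. h \<in> \<aa>_pow e}
      \<subseteq> frobenius_image R p e M {\<zero>\<^bsub>M\<^esub>})
    \<longleftrightarrow> (\<forall>h\<in>\<aa>_pow e. u \<otimes> h \<in> frobenius_power R (p ^ e) {r \<in> carrier R. r \<odot>\<^bsub>M\<^esub> m = \<zero>\<^bsub>M\<^esub>})"
    if u: "u \<in> carrier R" and m: "m \<in> carrier M" for u m e
  proof -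
    have "pure_tensor R (frobenius_module R p e) M (u \<otimes> h) m \<in> frobenius_image R p e M {\<zero>\<^bsub>M\<^esub>}
      \<longleftrightarrow> u \<otimes> h \<in> frobenius_power R (p ^ e) {r \<in> carrier R. r \<odot>\<^bsub>M\<^esub> m = \<zero>\<^bsub>M\<^esub>}" if "h \<in> \<aa>_pow e" for h
    proof -
      have uh: "u \<otimes> h \<in> carrier R" using u that \<aa>_pow_subset by blast
      show ?thesis
        unfolding frobenius_image_zero[OF M] singleton_iff pure_tensor_eq_kernel_iff[OF M uh m]
        by (rule frag_of_frob_kernel_iff[OF M detects uh m])
    qed
    then show ?thesis by blast
  qed
  then have "(\<exists>u\<in>carrier R. (\<forall>P. minimal_prime R P \<longrightarrow> u \<notin> P) \<and>
      (\<forall>\<^sub>F e in sequentially. {pure_tensor R (frobenius_module R p e) M (u \<otimes> h) m | h. h \<in> \<aa>_pow e}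
        \<subseteq> frobenius_image R p e M {\<zero>\<^bsub>M\<^esub>}))
    \<longleftrightarrow> tau R p \<aa> c \<subseteq> {r \<in> carrier R. r \<odot>\<^bsub>M\<^esub> m = \<zero>\<^bsub>M\<^esub>}" if "m \<in> carrier M" for m
    unfolding multiplier_iff_tau_subset[OF annihilator_ideal[OF M that], symmetric]
    using that by (intro bex_cong) auto
  then show ?thesis unfolding tight_closure_def by (intro Collect_cong conj_cong) auto
qed

section \<open>Direct sums and injective hulls\<close>

lemma direct_sum_module:
  assumes R: "cring R" and M: "\<And>i. i \<in> I \<Longrightarrow> module R (M i)"
  shows "module R (direct_sum I M)"
proof -
  let ?S = "direct_sum I M"
  have ab: "abelian_group (M i)" if "i \<in> I" for i using M[OF that] by (rule module.axioms(2))
  have mon: "abelian_monoid (M i)" if "i \<in> I" for i using ab[OF that] by (rule abelian_group.axioms(1))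
  have carr: "x \<in> carrier ?S \<longleftrightarrow> x \<in> (\<Pi>\<^sub>E i\<in>I. carrier (M i)) \<and> finite {i \<in> I. x i \<noteq> \<zero>\<^bsub>M i\<^esub>}" for x
    unfolding direct_sum_def by simp
  have nth: "x i \<in> carrier (M i)" if "x \<in> carrier ?S" "i \<in> I" for x i
    using that unfolding carr by auto
  have add: "x \<oplus>\<^bsub>?S\<^esub> y = (\<lambda>i\<in>I. x i \<oplus>\<^bsub>M i\<^esub> y i)" for x y unfolding direct_sum_def by simp
  have smult: "r \<odot>\<^bsub>?S\<^esub> x = (\<lambda>i\<in>I. r \<odot>\<^bsub>M i\<^esub> x i)" for r x unfolding direct_sum_def by simp
  have zero: "\<zero>\<^bsub>?S\<^esub> = (\<lambda>i\<in>I. \<zero>\<^bsub>M i\<^esub>)" unfolding direct_sum_def by simp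
  have ext: "x = y" if "x \<in> carrier ?S" "y \<in> carrier ?S" "\<And>i. i \<in> I \<Longrightarrow> x i = y i" for x y
    using that unfolding carr by (intro PiE_ext[of x I _ y]) auto
  have addc: "x \<oplus>\<^bsub>?S\<^esub> y \<in> carrier ?S" if x: "x \<in> carrier ?S" and y: "y \<in> carrier ?S" for x y
  proof -
    have "{i \<in> I. x i \<oplus>\<^bsub>M i\<^esub> y i \<noteq> \<zero>\<^bsub>M i\<^esub>} \<subseteq> {i \<in> I. x i \<noteq> \<zero>\<^bsub>M i\<^esub>} \<union> {i \<in> I. y i \<noteq> \<zero>\<^bsub>M i\<^esub>}"
      using abelian_monoid.l_zero[OF mon] abelian_monoid.zero_closed[OF mon] by auto
    then have "finite {i \<in> I. x i \<oplus>\<^bsub>M i\<^esub> y i \<noteq> \<zero>\<^bsub>M i\<^esub>}"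
      using x y unfolding carr by (meson finite_UnI finite_subset)
    then show ?thesis
      unfolding carr add using abelian_monoid.a_closed[OF mon] nth[OF x] nth[OF y]
      by (auto cong: conj_cong)
  qed
  have smultc: "r \<odot>\<^bsub>?S\<^esub> x \<in> carrier ?S" if r: "r \<in> carrier R" and x: "x \<in> carrier ?S" for r x
  proof -
    have "{i \<in> I. r \<odot>\<^bsub>M i\<^esub> x i \<noteq> \<zero>\<^bsub>M i\<^esub>} \<subseteq> {i \<in> I. x i \<noteq> \<zero>\<^bsub>M i\<^esub>}"
      using module.smult_r_null[OF M r] by auto
    then have "finite {i \<in> I. r \<odot>\<^bsub>M i\<^esub> x i \<noteq> \<zero>\<^bsub>M i\<^esub>}"
      using x unfolding carr by (meson finite_subset)
    then show ?thesis
      unfolding carr smult using module.smult_closed[OF M r] nth[OF x] by (auto cong: conj_cong)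
  qed
  have zeroc: "\<zero>\<^bsub>?S\<^esub> \<in> carrier ?S"
    unfolding carr zero using abelian_monoid.zero_closed[OF mon] by (auto cong: conj_cong)
  show ?thesis
  proof (rule moduleI[OF R])
    show "abelian_group ?S"
    proof (rule abelian_groupI)
      fix x y assume x: "x \<in> carrier ?S" and y: "y \<in> carrier ?S"
      show "x \<oplus>\<^bsub>?S\<^esub> y = y \<oplus>\<^bsub>?S\<^esub> x"
        using nth[OF x] nth[OF y] by (intro ext addc x y) (simp add: add abelian_monoid.a_comm[OF mon])
      fix z assume z: "z \<in> carrier ?S"
      show "x \<oplus>\<^bsub>?S\<^esub> y \<oplus>\<^bsub>?S\<^esub> z = x \<oplus>\<^bsub>?S\<^esub> (y \<oplus>\<^bsub>?S\<^esub> z)"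
        using nth[OF x] nth[OF y] nth[OF z]
        by (intro ext addc x y z) (simp add: add abelian_monoid.a_assoc[OF mon])
    next
      fix x assume x: "x \<in> carrier ?S"
      show "\<zero>\<^bsub>?S\<^esub> \<oplus>\<^bsub>?S\<^esub> x = x"
        using nth[OF x] by (intro ext addc x zeroc) (simp add: add zero abelian_monoid.l_zero[OF mon])
      let ?y = "(\<ominus>\<^bsub>R\<^esub> \<one>\<^bsub>R\<^esub>) \<odot>\<^bsub>?S\<^esub> x"
      have m1: "\<ominus>\<^bsub>R\<^esub> \<one>\<^bsub>R\<^esub> \<in> carrier R" "\<one>\<^bsub>R\<^esub> \<in> carrier R"
        using R by (simp_all add: cring.cring_simprules)
      have "?y \<oplus>\<^bsub>?S\<^esub> x = \<zero>\<^bsub>?S\<^esub>"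
      proof (rule ext[OF addc[OF smultc[OF m1(1) x] x] zeroc])
        fix i assume i: "i \<in> I"
        then have "(\<ominus>\<^bsub>R\<^esub> \<one>\<^bsub>R\<^esub>) \<odot>\<^bsub>M i\<^esub> x i \<oplus>\<^bsub>M i\<^esub> \<one>\<^bsub>R\<^esub> \<odot>\<^bsub>M i\<^esub> x i = (\<ominus>\<^bsub>R\<^esub> \<one>\<^bsub>R\<^esub> \<oplus>\<^bsub>R\<^esub> \<one>\<^bsub>R\<^esub>) \<odot>\<^bsub>M i\<^esub> x i"
          using module.smult_l_distr[OF M[OF i] m1 nth[OF x i]] by simp
        also have "\<ominus>\<^bsub>R\<^esub> \<one>\<^bsub>R\<^esub> \<oplus>\<^bsub>R\<^esub> \<one>\<^bsub>R\<^esub> = \<zero>\<^bsub>R\<^esub>" using m1 R by (simp add: cring.cring_simprules)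
        finally show "(?y \<oplus>\<^bsub>?S\<^esub> x) i = \<zero>\<^bsub>?S\<^esub> i"
          using i by (simp add: add smult zero module.smult_one[OF M[OF i] nth[OF x i]]
              module.smult_l_null[OF M[OF i] nth[OF x i]])
      qed
      then show "\<exists>y\<in>carrier ?S. y \<oplus>\<^bsub>?S\<^esub> x = \<zero>\<^bsub>?S\<^esub>" using smultc[OF m1(1) x] by blast
    qed (use addc zeroc in auto)
  next
    fix r s x assume r: "r \<in> carrier R" and s: "s \<in> carrier R" and x: "x \<in> carrier ?S"
    have rs: "r \<oplus>\<^bsub>R\<^esub> s \<in> carrier R" "r \<otimes>\<^bsub>R\<^esub> s \<in> carrier R" using R r s by (simp_all add: cring.cring_simprules)
    show "(r \<oplus>\<^bsub>R\<^esub> s) \<odot>\<^bsub>?S\<^esub> x = r \<odot>\<^bsub>?S\<^esub> x \<oplus>\<^bsub>?S\<^esub> s \<odot>\<^bsub>?S\<^esub> x"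
      using nth[OF x] by (intro ext addc smultc r s x rs) (simp add: add smult module.smult_l_distr[OF M r s])
    show "(r \<otimes>\<^bsub>R\<^esub> s) \<odot>\<^bsub>?S\<^esub> x = r \<odot>\<^bsub>?S\<^esub> (s \<odot>\<^bsub>?S\<^esub> x)"
      using nth[OF x] by (intro ext smultc r s x rs) (simp add: smult module.smult_assoc1[OF M r s])
  next
    fix r x y assume r: "r \<in> carrier R" and x: "x \<in> carrier ?S" and y: "y \<in> carrier ?S"
    show "r \<odot>\<^bsub>?S\<^esub> (x \<oplus>\<^bsub>?S\<^esub> y) = r \<odot>\<^bsub>?S\<^esub> x \<oplus>\<^bsub>?S\<^esub> r \<odot>\<^bsub>?S\<^esub> y"
      using nth[OF x] nth[OF y]
      by (intro ext addc smultc r x y) (simp add: add smult module.smult_r_distr[OF M r])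
  next
    fix x assume x: "x \<in> carrier ?S"
    have "\<one>\<^bsub>R\<^esub> \<in> carrier R" using R by (simp add: cring.cring_simprules)
    then have c: "\<one>\<^bsub>R\<^esub> \<odot>\<^bsub>?S\<^esub> x \<in> carrier ?S" using x by (rule smultc)
    show "\<one>\<^bsub>R\<^esub> \<odot>\<^bsub>?S\<^esub> x = x"
    proof (rule ext[OF c x])
      show "(\<one>\<^bsub>R\<^esub> \<odot>\<^bsub>?S\<^esub> x) i = x i" if i: "i \<in> I" for i
        using i module.smult_one[OF M[OF i] nth[OF x i]] by (simp add: smult)
    qed
  qed (rule smultc)
qed

lemma direct_sum_single:
  assumes M: "\<And>i. i \<in> I \<Longrightarrow> module R (M i)" and j: "j \<in> I" and v: "v \<in> carrier (M j)"
  defines "s \<equiv> \<lambda>i\<in>I. if i = j then v else \<zero>\<^bsub>M i\<^esub>"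
  shows "s \<in> carrier (direct_sum I M)"
    and "r \<in> carrier R \<Longrightarrow> r \<odot>\<^bsub>direct_sum I M\<^esub> s = \<zero>\<^bsub>direct_sum I M\<^esub> \<longleftrightarrow> r \<odot>\<^bsub>M j\<^esub> v = \<zero>\<^bsub>M j\<^esub>"
proof -
  have z: "\<zero>\<^bsub>M i\<^esub> \<in> carrier (M i)" if "i \<in> I" for i
    using abelian_monoid.zero_closed[OF abelian_group.axioms(1)[OF module.axioms(2)[OF M[OF that]]]] .
  have "finite {i \<in> I. s i \<noteq> \<zero>\<^bsub>M i\<^esub>}"
    by (rule finite_subset[of _ "{j}"]) (auto simp: s_def)
  then show "s \<in> carrier (direct_sum I M)"
    using v z unfolding direct_sum_def s_def by auto
  assume r: "r \<in> carrier R"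
  have "(\<lambda>i\<in>I. r \<odot>\<^bsub>M i\<^esub> s i) = (\<lambda>i\<in>I. \<zero>\<^bsub>M i\<^esub>) \<longleftrightarrow> (\<forall>i\<in>I. r \<odot>\<^bsub>M i\<^esub> s i = \<zero>\<^bsub>M i\<^esub>)"
    by (auto simp: fun_eq_iff restrict_def)
  also have "\<dots> \<longleftrightarrow> r \<odot>\<^bsub>M j\<^esub> v = \<zero>\<^bsub>M j\<^esub>"
    using j module.smult_r_null[OF M r] by (auto simp: s_def)
  finally show "r \<odot>\<^bsub>direct_sum I M\<^esub> s = \<zero>\<^bsub>direct_sum I M\<^esub> \<longleftrightarrow> r \<odot>\<^bsub>M j\<^esub> v = \<zero>\<^bsub>M j\<^esub>"
    unfolding direct_sum_def by simp
qed

section \<open>Injective hulls of residue fields as cogenerators\<close>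

context cring
begin

text \<open>A copy of an ideal on the type \<open>'a + 'b\<close>, on which \<open>injective_module\<close> places its test modules.\<close>

definition ideal_copy :: "'a set \<Rightarrow> ('a, 'a + 'c) module" where
  "ideal_copy C = \<lparr>carrier = Inl ` C, monoid.mult = (\<lambda>u v. u), monoid.one = Inl \<one>,
     ring.zero = Inl \<zero>, ring.add = (\<lambda>u v. Inl (projl u \<oplus> projl v)),
     smult = (\<lambda>r u. Inl (r \<otimes> projl u))\<rparr>"

lemma ideal_copy_simps [simp]:
  "carrier (ideal_copy C) = Inl ` C"
  "\<zero>\<^bsub>ideal_copy C\<^esub> = Inl \<zero>"
  "u \<oplus>\<^bsub>ideal_copy C\<^esub> v = Inl (projl u \<oplus> projl v)"
  "r \<odot>\<^bsub>ideal_copy C\<^esub> u = Inl (r \<otimes> projl u)"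
  unfolding ideal_copy_def by simp_all

lemma ideal_copy_module:
  assumes C: "ideal C R"
  shows "module R (ideal_copy C)"
proof (rule moduleI[OF is_cring])
  note Cc = ideal.Icarr[OF C]
  show "abelian_group (ideal_copy C)"
  proof (rule abelian_groupI)
    fix u assume "u \<in> carrier (ideal_copy C)"
    then obtain a where a: "a \<in> C" "u = Inl a" by auto
    then have "\<ominus> a \<in> C" using additive_subgroup.a_inv_closed[OF ideal.axioms(1)[OF C]] by blast
    then show "\<exists>v\<in>carrier (ideal_copy C). v \<oplus>\<^bsub>ideal_copy C\<^esub> u = \<zero>\<^bsub>ideal_copy C\<^esub>"
      using a Cc by (intro bexI[of _ "Inl (\<ominus> a)"]) (auto simp: l_neg)
  qed (use Cc ideal_add[OF C] ideal_zero[OF C] in \<open>auto simp: a_ac\<close>)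
qed (use ideal.Icarr[OF C] ideal.I_l_closed[OF C] in \<open>auto simp: l_distr r_distr m_assoc\<close>)

text \<open>The image of 1 under the embedding of \<open>R / N\<close>: nonzero by injectivity,
  killed by \<open>N\<close> by linearity.\<close>

lemma injective_hull_element:
  assumes N: "maximalideal N R" and E: "injective_hull R (residue_field R N) E"
  obtains w where "w \<in> carrier E" "w \<noteq> \<zero>\<^bsub>E\<^esub>" "\<And>r. r \<in> N \<Longrightarrow> r \<odot>\<^bsub>E\<^esub> w = \<zero>\<^bsub>E\<^esub>"
proof -
  have Nid: "ideal N R" by (rule maximalideal.axioms(1)[OF N])
  interpret E: module R E using E unfolding injective_hull_def injective_module_def by blast
  let ?K = "residue_field R N"
  obtain i where i: "i \<in> mod_hom R ?K E" "inj_on i (carrier ?K)"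
    using E unfolding injective_hull_def by blast
  have K: "N +> r \<in> carrier ?K" if "r \<in> carrier R" for r
    using that unfolding residue_field_def restrict_scalars_def self_module_def FactRing_def A_RCOSETS_def'
    by auto
  have Ks: "r \<odot>\<^bsub>?K\<^esub> (N +> s) = N +> (r \<otimes> s)" if "r \<in> carrier R" "s \<in> carrier R" for r s
    using ideal.rcoset_mult_add[OF Nid that]
    unfolding residue_field_def restrict_scalars_def self_module_def FactRing_def by simp
  let ?w = "i (N +> \<one>)"
  have wc: "?w \<in> carrier E" using i(1) K[OF one_closed] unfolding mod_hom_def by auto
  have ir: "i (N +> r) = r \<odot>\<^bsub>E\<^esub> ?w" if r: "r \<in> carrier R" for r
  proof -
    have "i (r \<odot>\<^bsub>?K\<^esub> (N +> \<one>)) = r \<odot>\<^bsub>E\<^esub> ?w" using i(1) K[OF one_closed] r unfolding mod_hom_def by blast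
    then show ?thesis using Ks[OF r one_closed] r by simp
  qed
  have N0: "N +> r = N +> \<zero>" if "r \<in> N" for r
    using a_rcos_zero[OF Nid that] a_rcos_zero[OF Nid ideal_zero[OF Nid]] by simp
  have "r \<odot>\<^bsub>E\<^esub> ?w = \<zero>\<^bsub>E\<^esub>" if r: "r \<in> N" for r
    using ir[OF ideal.Icarr[OF Nid r]] ir[OF zero_closed] N0[OF r] E.smult_l_null[OF wc] by simp
  moreover have "?w \<noteq> \<zero>\<^bsub>E\<^esub>"
  proof
    assume "?w = \<zero>\<^bsub>E\<^esub>"
    then have "i (N +> \<one>) = i (N +> \<zero>)" using ir[OF zero_closed] E.smult_l_null[OF wc] by simp
    then have "N +> \<one> = N +> \<zero>" using i(2) K unfolding inj_on_def by blast
    then have "N +> \<one> = N" using a_rcos_zero[OF Nid ideal_zero[OF Nid]] by simp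
    then have "\<one> \<in> N" by (rule ideal.rcos_const_imp_mem[OF Nid one_closed])
    then show False using prime_one_notin[OF maximalideal_prime[OF N]] by simp
  qed
  ultimately show ?thesis using that wc by blast
qed

end

text \<open>For \<open>x \<notin> T\<close> choose a maximal \<open>N \<supseteq> (T : x)\<close>. The map \<open>T + (x) \<rightarrow> E\<^sub>N\<close> that kills \<open>T\<close> and
  sends \<open>x\<close> to a nonzero element killed by \<open>N\<close> extends to \<open>R\<close>.\<close>

lemma (in noetherian_cring) injective_hulls_separate:
  assumes T: "ideal T R" and x: "x \<in> carrier R" "x \<notin> T"
    and E: "\<And>N. maximalideal N R \<Longrightarrow> injective_hull R (residue_field R N) (E N :: ('a, 'c) module)"
  obtains N v where "maximalideal N R" "v \<in> carrier (E N)" "\<And>t. t \<in> T \<Longrightarrow> t \<odot>\<^bsub>E N\<^esub> v = \<zero>\<^bsub>E N\<^esub>"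
    "x \<odot>\<^bsub>E N\<^esub> v \<noteq> \<zero>\<^bsub>E N\<^esub>"
proof -
  let ?C = "{r \<in> carrier R. r \<otimes> x \<in> T}"
  have "\<one> \<notin> ?C" using x by simp
  then obtain N where N: "maximalideal N R" and CN: "?C \<subseteq> N"
    by (rule exists_maximalideal[OF ideal_colon[OF T x(1)]])
  obtain w where w: "w \<in> carrier (E N)" "w \<noteq> \<zero>\<^bsub>E N\<^esub>" and Nw: "\<And>r. r \<in> N \<Longrightarrow> r \<odot>\<^bsub>E N\<^esub> w = \<zero>\<^bsub>E N\<^esub>"
    using injective_hull_element[OF N E[OF N]] by blast
  have inj: "injective_module R (E N)" using E[OF N] unfolding injective_hull_def by blast
  then interpret E: module R "E N" unfolding injective_module_def by blast
  have Tc: "T \<subseteq> carrier R" using ideal.Icarr[OF T] by blast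
  let ?D = "Idl (insert x T)"
  have Did: "ideal ?D R" using x(1) Tc by (intro genideal_ideal) auto
  have D: "a \<in> ?D \<longleftrightarrow> (\<exists>b\<in>T. \<exists>r\<in>carrier R. a = b \<oplus> r \<otimes> x)" for a
    using Idl_insert_iff[OF Tc x(1)] Idl_of_ideal[OF T] by simp
  define g where "g = (\<lambda>a. (SOME r. r \<in> carrier R \<and> (\<exists>b\<in>T. a = b \<oplus> r \<otimes> x)) \<odot>\<^bsub>E N\<^esub> w)"
  \<comment> \<open>Two coefficients of \<open>x\<close> for the same element differ by a member of
    \<open>(T : x)\<close>, which lies in \<open>N\<close> and so kills \<open>w\<close>; the choice
    made in \<open>g\<close> is harmless.\<close>
  have g: "g (b \<oplus> r \<otimes> x) = r \<odot>\<^bsub>E N\<^esub> w" if b: "b \<in> T" and r: "r \<in> carrier R" for b r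
  proof -
    let ?s = "SOME s. s \<in> carrier R \<and> (\<exists>b'\<in>T. b \<oplus> r \<otimes> x = b' \<oplus> s \<otimes> x)"
    have "?s \<in> carrier R \<and> (\<exists>b'\<in>T. b \<oplus> r \<otimes> x = b' \<oplus> ?s \<otimes> x)"
      by (rule someI[of _ r]) (use b r in blast)
    then obtain b' where s: "?s \<in> carrier R" and b': "b' \<in> T" "b \<oplus> r \<otimes> x = b' \<oplus> ?s \<otimes> x" by blast
    define s where "s = ?s"
    have sc: "s \<in> carrier R" and e: "b \<oplus> r \<otimes> x = b' \<oplus> s \<otimes> x" using s b' unfolding s_def by auto
    have bc: "b \<in> carrier R" "b' \<in> carrier R" using b b'(1) Tc by auto
    have "(r \<ominus> s) \<otimes> x = (b \<oplus> r \<otimes> x) \<ominus> b \<ominus> s \<otimes> x" using bc r sc x(1) by algebra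
    also have "\<dots> = b' \<ominus> b" unfolding e using bc sc x(1) by algebra
    also have "\<dots> \<in> T" by (rule ideal_minus[OF T b'(1) b])
    finally have "r \<ominus> s \<in> N" using CN r sc by auto
    then have 0: "(r \<ominus> s) \<odot>\<^bsub>E N\<^esub> w = \<zero>\<^bsub>E N\<^esub>" by (rule Nw)
    have "r = (r \<ominus> s) \<oplus> s" using r sc by algebra
    then have "r \<odot>\<^bsub>E N\<^esub> w = ((r \<ominus> s) \<oplus> s) \<odot>\<^bsub>E N\<^esub> w" by simp
    also have "\<dots> = s \<odot>\<^bsub>E N\<^esub> w"
      using 0 r sc w(1) E.smult_l_distr[of "r \<ominus> s" s w] by simp
    finally show ?thesis unfolding g_def s_def by simp
  qed
  let ?A = "ideal_copy ?D :: ('a, 'a + 'c) module" and ?B = "ideal_copy (carrier R) :: ('a, 'a + 'c) module"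
  have A: "module R ?A" and B: "module R ?B" by (intro ideal_copy_module Did oneideal)+
  have f: "(\<lambda>u. u) \<in> mod_hom R ?A ?B"
    unfolding mod_hom_def using ideal.Icarr[OF Did] by auto
  have "(\<lambda>u. g (projl u)) \<in> mod_hom R ?A (E N)"
    unfolding mod_hom_def
  proof (intro CollectI conjI ballI)
    show "(\<lambda>u. g (projl u)) \<in> carrier ?A \<rightarrow> carrier (E N)" using g w(1) by (auto simp: D)
  next
    fix u v assume "u \<in> carrier ?A" "v \<in> carrier ?A"
    then obtain b r b' r' where 1: "b \<in> T" "r \<in> carrier R" "projl u = b \<oplus> r \<otimes> x"
      and 2: "b' \<in> T" "r' \<in> carrier R" "projl v = b' \<oplus> r' \<otimes> x" by (auto simp: D)
    have bc: "b \<in> carrier R" "b' \<in> carrier R" using 1 2 Tc by auto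
    have "projl u \<oplus> projl v = (b \<oplus> b') \<oplus> (r \<oplus> r') \<otimes> x"
      unfolding 1(3) 2(3) using bc 1(2) 2(2) x(1) by algebra
    then have "g (projl u \<oplus> projl v) = (r \<oplus> r') \<odot>\<^bsub>E N\<^esub> w"
      using g[OF ideal_add[OF T 1(1) 2(1)]] 1(2) 2(2) by simp
    then show "g (projl (u \<oplus>\<^bsub>?A\<^esub> v)) = g (projl u) \<oplus>\<^bsub>E N\<^esub> g (projl v)"
      using 1 2 w(1) g by (simp add: E.smult_l_distr)
  next
    fix s u assume s: "s \<in> carrier R" and "u \<in> carrier ?A"
    then obtain b r where 1: "b \<in> T" "r \<in> carrier R" "projl u = b \<oplus> r \<otimes> x" by (auto simp: D)
    have bc: "b \<in> carrier R" using 1 Tc by auto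
    have "s \<otimes> projl u = s \<otimes> b \<oplus> (s \<otimes> r) \<otimes> x"
      unfolding 1(3) using bc 1(2) s x(1) by algebra
    then have "g (s \<otimes> projl u) = (s \<otimes> r) \<odot>\<^bsub>E N\<^esub> w"
      using g[OF ideal.I_l_closed[OF T 1(1) s]] 1(2) s by simp
    then show "g (projl (s \<odot>\<^bsub>?A\<^esub> u)) = s \<odot>\<^bsub>E N\<^esub> g (projl u)"
      using 1 s w(1) g by (simp add: E.smult_assoc1)
  qed
  moreover have "inj_on (\<lambda>u. u) (carrier ?A)" by simp
  ultimately have "\<exists>h\<in>mod_hom R ?B (E N). \<forall>u\<in>carrier ?A. h u = g (projl u)"
    using inj A B f unfolding injective_module_def by blast
  then obtain h where h: "h \<in> mod_hom R ?B (E N)" and hg: "\<And>u. u \<in> carrier ?A \<Longrightarrow> h u = g (projl u)" by blast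
  \<comment> \<open>A linear map out of \<open>R\<close> is determined by the image of 1, so this
    element turns the values of the extension into scalar multiples: \<open>T\<close> kills it and
    \<open>x\<close> sends it to \<open>w\<close>.\<close>
  let ?v = "h (Inl \<one>)"
  have hv: "r \<odot>\<^bsub>E N\<^esub> ?v = h (Inl r)" if r: "r \<in> carrier R" for r
  proof -
    have "Inl \<one> \<in> carrier ?B" by simp
    then have "h (r \<odot>\<^bsub>?B\<^esub> Inl \<one>) = r \<odot>\<^bsub>E N\<^esub> ?v" using h r unfolding mod_hom_def by blast
    then show ?thesis using r by simp
  qed
  have hD: "a \<odot>\<^bsub>E N\<^esub> ?v = r \<odot>\<^bsub>E N\<^esub> w" if "b \<in> T" "r \<in> carrier R" "a = b \<oplus> r \<otimes> x" for a b r
  proof -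
    have a: "a \<in> ?D" using that D by blast
    then have "h (Inl a) = g a" using hg[of "Inl a"] by simp
    then show ?thesis using hv[OF ideal.Icarr[OF Did a]] g[OF that(1,2)] that(3) by simp
  qed
  show ?thesis
  proof (rule that[OF N])
    show "?v \<in> carrier (E N)" using h unfolding mod_hom_def by auto
    show "t \<odot>\<^bsub>E N\<^esub> ?v = \<zero>\<^bsub>E N\<^esub>" if t: "t \<in> T" for t
    proof -
      have "t = t \<oplus> \<zero> \<otimes> x" using t Tc x(1) by auto
      then show ?thesis using hD[OF t zero_closed] E.smult_l_null[OF w(1)] by simp
    qed
    have "x = \<zero> \<oplus> \<one> \<otimes> x" using x(1) by simp
    then have "x \<odot>\<^bsub>E N\<^esub> ?v = w"
      using hD[OF ideal_zero[OF T] one_closed] E.smult_one[OF w(1)] by simp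
    then show "x \<odot>\<^bsub>E N\<^esub> ?v \<noteq> \<zero>\<^bsub>E N\<^esub>" using w(2) by simp
  qed
qed

lemma (in noetherian_char_p_ring) F_finite_p_generates:
  assumes "F_finite R p"
  shows "\<exists>F. finite F \<and> F \<subseteq> carrier R \<and> p_generates F (\<lambda>x. x)"
proof -
  let ?M = "frobenius_module R p 1"
  obtain F where F: "F \<subseteq> carrier R" "finite F"
    and gen: "\<And>N. submodule N R ?M \<Longrightarrow> F \<subseteq> N \<Longrightarrow> N = carrier R"
    using assms unfolding F_finite_def fin_gen_module_def frobenius_module_simps by blast
  \<comment> \<open>Finite generation is phrased through submodules containing the generators, so
    the span has to be shown to be one, with \<open>a\<close> acting as multiplication by
    \<open>a^p\<close>.\<close>
  let ?N = "{p_comb F (\<lambda>x. x) c | c. c \<in> F \<rightarrow> carrier R}"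
  have id: "(\<lambda>x. x) \<in> F \<rightarrow> carrier R" using F(1) by auto
  have "subgroup ?N (add_monoid R)"
  proof (rule add.subgroupI)
    show "?N \<subseteq> carrier R" using p_comb_closed[OF id] by auto
    show "?N \<noteq> {}" by (auto intro!: exI[of _ "\<lambda>_. \<zero>"])
    fix a assume "a \<in> ?N"
    then obtain c where c: "c \<in> F \<rightarrow> carrier R" "a = p_comb F (\<lambda>x. x) c" by blast
    have z: "(\<lambda>_. \<zero>) \<in> F \<rightarrow> carrier R" by simp
    have "p_comb F (\<lambda>x. x) (\<lambda>_. \<zero>) = \<zero>"
      unfolding p_comb_def using F(1) by (intro add.finprod_one_eqI) (auto simp: frobenius_zero)
    then have "p_comb F (\<lambda>x. x) (\<lambda>l. \<zero> \<ominus> c l) = \<ominus> a"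
      using p_comb_minus[OF id z c(1)] p_comb_closed[OF id c(1)] c(2) by (simp add: a_minus_def)
    moreover have "(\<lambda>l. \<zero> \<ominus> c l) \<in> F \<rightarrow> carrier R" using c(1) by (auto simp: Pi_iff)
    ultimately show "\<ominus> a \<in> ?N" by (metis (mono_tags, lifting) mem_Collect_eq)
    fix b assume "b \<in> ?N"
    then obtain d where d: "d \<in> F \<rightarrow> carrier R" "b = p_comb F (\<lambda>x. x) d" by blast
    have "a \<oplus> b = p_comb F (\<lambda>x. x) (\<lambda>l. c l \<oplus> d l)" using p_comb_add[OF id c(1) d(1)] c(2) d(2) by simp
    moreover have "(\<lambda>l. c l \<oplus> d l) \<in> F \<rightarrow> carrier R" using c(1) d(1) by (auto simp: Pi_iff)
    ultimately show "a \<oplus> b \<in> ?N" by blast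
  qed
  moreover have "inv\<^bsub>add_monoid ?M\<^esub> a = inv\<^bsub>add_monoid R\<^esub> a" for a
    by (simp add: m_inv_def)
  ultimately have "subgroup ?N (add_monoid ?M)" unfolding subgroup_def by simp
  then have "submodule ?N R ?M"
  proof (rule submodule.intro)
    show "submodule_axioms ?N R ?M"
    proof
      fix a x assume a: "a \<in> carrier R" and "x \<in> ?N"
      then obtain c where c: "c \<in> F \<rightarrow> carrier R" "x = p_comb F (\<lambda>x. x) c" by blast
      have "a \<odot>\<^bsub>?M\<^esub> x = p_comb F (\<lambda>x. x) (\<lambda>l. a \<otimes> c l)"
        using p_comb_smult[OF id c(1) a F(2)] c(2) by simp
      moreover have "(\<lambda>l. a \<otimes> c l) \<in> F \<rightarrow> carrier R" using a c(1) by (auto simp: Pi_iff)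
      ultimately show "a \<odot>\<^bsub>?M\<^esub> x \<in> ?N" by blast
    qed
  qed
  moreover have "F \<subseteq> ?N"
  proof
    fix x assume x: "x \<in> F"
    let ?c = "\<lambda>l. if l = x then \<one> else \<zero>"
    have "p_comb F (\<lambda>x. x) ?c = (\<Oplus>l\<in>F. if x = l then l else \<zero>)"
      unfolding p_comb_def using F(1) frobenius_zero by (intro finsum_cong') auto
    also have "\<dots> = x" using x F by (intro finsum_singleton) auto
    finally have "x = p_comb F (\<lambda>x. x) ?c" by simp
    moreover have "?c \<in> F \<rightarrow> carrier R" by simp
    ultimately show "x \<in> ?N" by blast
  qed
  ultimately have "?N = carrier R" by (rule gen)
  then have "p_generates F (\<lambda>x. x)" unfolding p_generates_def by blast
  then show ?thesis using F by blast
qed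

theorem proposition2p22:
  fixes R :: "('a, 'r) ring_scheme"
    and E :: "'a set \<Rightarrow> ('a, 'b) module"
    and p :: nat and \<aa> :: "'a set" and c :: real
  assumes "regular_ring R"
    and "Factorial_Ring.prime p" and "has_characteristic R p" and "F_finite R p"
    and "\<And>M. maximalideal M R \<Longrightarrow> injective_hull R (residue_field R M) (E M)"
    and "ideal \<aa> R" and "c > 0"
  shows "tau R p \<aa> c = tau' R p E \<aa> c"
proof -
  have "cring R" "noetherian_ring R" using assms(1) unfolding regular_ring_def by auto
  moreover have "add_pow R p \<one>\<^bsub>R\<^esub> = \<zero>\<^bsub>R\<^esub>" using assms(3) unfolding has_characteristic_def by simp
  ultimately interpret noetherian_char_p_ring R p
    by (intro noetherian_char_p_ring.intro noetherian_cring.intro noetherian_char_p_ring_axioms.intro assms(2))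
  obtain F where "finite F" "F \<subseteq> carrier R" "p_generates F (\<lambda>x. x)"
    using F_finite_p_generates[OF assms(4)] by blast
  then have "cartier_detects p" by (rule cartier_detects_p[OF assms(1)])
  then interpret cartier_ring R p \<aa> c
    by (intro cartier_ring.intro noetherian_char_p_ring_axioms cartier_ring_axioms.intro assms(6))
  let ?I = "{M. maximalideal M R}"
  let ?S = "direct_sum ?I E"
  have E: "module R (E M)" if "M \<in> ?I" for M
    using assms(5)[of M] that unfolding injective_hull_def injective_module_def by simp
  have S: "module R ?S" by (rule direct_sum_module[OF is_cring E])
  \<comment> \<open>The double annihilator of \<open>tau\<close> in the direct sum. It contains
    \<open>tau\<close> by construction; the separation property of injective hulls gives the other
    inclusion.\<close>
  have tau': "tau' R p E \<aa> c = {r \<in> carrier R. \<forall>m\<in>carrier ?S.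
      tau R p \<aa> c \<subseteq> {r \<in> carrier R. r \<odot>\<^bsub>?S\<^esub> m = \<zero>\<^bsub>?S\<^esub>} \<longrightarrow> r \<odot>\<^bsub>?S\<^esub> m = \<zero>\<^bsub>?S\<^esub>}"
    unfolding tau'_def Let_def annihilator_def tight_closure_zero[OF S] by auto
  show ?thesis
  proof
    show "tau R p \<aa> c \<subseteq> tau' R p E \<aa> c" unfolding tau' using ideal.Icarr[OF tau_ideal] by blast
    show "tau' R p E \<aa> c \<subseteq> tau R p \<aa> c"
    proof (rule subsetI, rule ccontr)
      fix x assume x: "x \<in> tau' R p E \<aa> c" and nx: "x \<notin> tau R p \<aa> c"
      have xc: "x \<in> carrier R" using x unfolding tau' by blast
      obtain N v where N: "maximalideal N R" and v: "v \<in> carrier (E N)"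
        and tv: "\<And>t. t \<in> tau R p \<aa> c \<Longrightarrow> t \<odot>\<^bsub>E N\<^esub> v = \<zero>\<^bsub>E N\<^esub>" and xv: "x \<odot>\<^bsub>E N\<^esub> v \<noteq> \<zero>\<^bsub>E N\<^esub>"
        using injective_hulls_separate[OF tau_ideal xc nx assms(5)] by blast
      \<comment> \<open>The separating element of a single hull, placed in its summand; a scalar
        kills it exactly when it kills \<open>v\<close>.\<close>
      let ?s = "\<lambda>i\<in>?I. if i = N then v else \<zero>\<^bsub>E i\<^esub>"
      have NI: "N \<in> ?I" using N by simp
      have s1: "?s \<in> carrier ?S"
        by (rule direct_sum_single(1)[where I="?I" and M=E and R=R, OF E NI v])
      have s2: "r \<odot>\<^bsub>?S\<^esub> ?s = \<zero>\<^bsub>?S\<^esub> \<longleftrightarrow> r \<odot>\<^bsub>E N\<^esub> v = \<zero>\<^bsub>E N\<^esub>" if "r \<in> carrier R" for r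
        by (rule direct_sum_single(2)[where I="?I" and M=E and R=R, OF E NI v that])
      have "tau R p \<aa> c \<subseteq> {r \<in> carrier R. r \<odot>\<^bsub>?S\<^esub> ?s = \<zero>\<^bsub>?S\<^esub>}"
        using tv ideal.Icarr[OF tau_ideal] s2 by auto
      then have "x \<odot>\<^bsub>?S\<^esub> ?s = \<zero>\<^bsub>?S\<^esub>" using x s1 unfolding tau' by blast
      then show False using s2[OF xc] xv by simp
    qed
  qed
qed

end
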